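(* Let $\mathbb{B}$ be the weighted adjacency matrix of the line graph of a finite, simple, weighted directed graph with $m$ edges, and let $X=L^{\infty}([0,1],\mathbb{C}^m)$. Let $c_1,\dots,c_m>0$ be real numbers, $C=\mathrm{diag}(c_j)$ and $\mathbb{B}^C=C^{-1}\mathbb{B}C$. Then the operator $(A_C,D(A_C))$ on $X$ given by $$A_C:=\mathrm{diag}\left(c_j\cdot\frac{d}{dx}\right),\qquad D(A_C):=\left\{f\in W^{1,\infty}([0,1],\mathbb{C}^m)\mid f(1)=\mathbb{B}^Cf(0)\right\}$$ generates a bi-continuous semigroup $(T_C(t))_{t\ge0}$ on $X$ with respect to the weak$^*$-topology.
   Context: **Graph.** $G=(V,E)$ is a finite directed graph with edges $E=\{e_1,\dots,e_m\}\subseteq V\times V$, simple (no loops or multiple edges). For an edge $(v_i,v_k)$, $v_i$ is its tail and $v_k$ its head. It carries weights $0\le w_{ij}\le 1$ ($1\le i,j\le m$), with $w_{ij}\ne0$ only if the head of $e_j$ is the tail of $e_i$, such that $\sum_{i=1}^m w_{ij}=1$ for all $j$. The $m\times m$ matrix $\mathbb{B}$ is defined by $\mathbb{B}_{ij}=w_{ij}$ if the head of $e_j$ is the tail of $e_i$, and $\mathbb{B}_{ij}=0$ otherwise; it is column-stochastic. **Space.** $\mathbb{C}^m\cong\ell^1(\{1,\dots,m\})$ carries the $\ell^1$-norm, and $\|f\|_X=\operatorname{ess\,sup}_{s\in[0,1]}\|f(s)\|_{\ell^1}$. $X$ is identified with the dual of $L^1([0,1],\mathbb{C}^m)$ via $\langle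 f,g\rangle=\int_0^1\langle f(s),g(s)\rangle\,ds$; the weak$^*$-topology on $X$ is the one induced by this duality. Functions in $W^{1,\infty}$ are evaluated at points through continuous representatives. $A_C$ maps $(f_j)$ to $(c_jf_j')$. **Bi-continuous semigroups.** Let $X$ be a Banach space and $\tau$ a locally convex Hausdorff topology on $X$, coarser than the norm topology, sequentially complete on norm-bounded sets, and such that $(X,\tau)'$ is norming for $X$. A family $(T(t))_{t\ge0}$ of bounded linear operators is a bi-continuous semigroup (with respect to $\tau$) if: (i) $T(0)=I$ and $T(t+s)=T(t)T(s)$ for all $s,t\ge0$; (ii) $t\mapsto T(t)f$ is continuous from $[0,\infty)$ to $(X,\tau)$ for every $f\in X$; (iii) there are $M\ge1$, $\omega\in\mathbb{R}$ with $\|T(t)\|\le Me^{\omega t}$ for all $t\ge0$; (iv) for every norm-bounded sequence $(f_n)$ that is $\tau$-convergent to $0$, $T(s)f_n\to0$ in $\tau$ uniformly for $s\in[0,t_0]$, for each $t_0\ge0$. Its generator is $Af:=\tau\text{-}\lim_{t\to0}\frac{T(t)f-f}{t}$ with domain consisting of all $f\in X$ for which this limit exists and $\sup_{t\in(0,1]}\frac{\|T(t)f-f\|}{t}<\infty$. *)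

theory Defs
  imports
    "HOL-Analysis.Analysis"
    "HOL-Probability.Essential_Supremum"
    "Graph_Theory.Pair_Digraph"
begin

section \<open>Complex Banach spaces\<close>

class complex_banach = banach +
  fixes scaleC :: "complex \<Rightarrow> 'a \<Rightarrow> 'a"  (infixr "*\<^sub>C" 75)
  assumes scaleC_add_right: "a *\<^sub>C (x + y) = a *\<^sub>C x + a *\<^sub>C y"
    and scaleC_add_left: "(a + b) *\<^sub>C x = a *\<^sub>C x + b *\<^sub>C x"
    and scaleC_scaleC: "a *\<^sub>C (b *\<^sub>C x) = (a * b) *\<^sub>C x"
    and scaleC_of_real: "complex_of_real r *\<^sub>C x = r *\<^sub>R x"
    and norm_scaleC: "norm (a *\<^sub>C x) = cmod a * norm x"

definition bounded_clinear_op :: "('a::complex_banach \<Rightarrow> 'a) \<Rightarrow> bool" where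
  "bounded_clinear_op T \<longleftrightarrow> bounded_linear T \<and> (\<forall>a x. T (a *\<^sub>C x) = a *\<^sub>C T x)"

section \<open>Bi-continuous semigroups\<close>

definition locally_convex_topology :: "'a::complex_banach topology \<Rightarrow> bool" where
  "locally_convex_topology \<tau> \<longleftrightarrow>
     topspace \<tau> = UNIV \<and>
     continuous_map (prod_topology \<tau> \<tau>) \<tau> (\<lambda>(x, y). x + y) \<and>
     continuous_map (prod_topology euclidean \<tau>) \<tau> (\<lambda>(a, x). a *\<^sub>C x) \<and>
     (\<forall>U. openin \<tau> U \<and> 0 \<in> U \<longrightarrow> (\<exists>V. openin \<tau> V \<and> convex V \<and> 0 \<in> V \<and> V \<subseteq> U))"

definition top_Cauchy :: "'a::complex_banach topology \<Rightarrow> (nat \<Rightarrow> 'a) \<Rightarrow> bool" where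
  "top_Cauchy \<tau> f \<longleftrightarrow>
     (\<forall>U. openin \<tau> U \<and> 0 \<in> U \<longrightarrow> (\<exists>N. \<forall>m\<ge>N. \<forall>n\<ge>N. f m - f n \<in> U))"

definition top_dual :: "'a::complex_banach topology \<Rightarrow> ('a \<Rightarrow> complex) set" where
  "top_dual \<tau> = {\<phi>. (\<forall>x y. \<phi> (x + y) = \<phi> x + \<phi> y) \<and> (\<forall>a x. \<phi> (a *\<^sub>C x) = a * \<phi> x) \<and>
                    continuous_map \<tau> euclidean \<phi>}"

definition norming :: "('a::complex_banach \<Rightarrow> complex) set \<Rightarrow> bool" where
  "norming \<Phi> \<longleftrightarrow>
     (\<forall>x. norm x = (SUP \<phi> \<in> {\<phi> \<in> \<Phi>. \<forall>y. cmod (\<phi> y) \<le> norm y}. cmod (\<phi> x)))"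

definition bicontinuous_setting :: "'a::complex_banach topology \<Rightarrow> bool" where
  "bicontinuous_setting \<tau> \<longleftrightarrow>
     locally_convex_topology \<tau> \<and> Hausdorff_space \<tau> \<and>
     (\<forall>U. openin \<tau> U \<longrightarrow> open U) \<and>
     (\<forall>f. bounded (range f) \<and> top_Cauchy \<tau> f \<longrightarrow> (\<exists>x. limitin \<tau> f x sequentially)) \<and>
     norming (top_dual \<tau>)"

text \<open>
  A semigroup is a total function of \<open>t :: real\<close>, of which only the values at \<open>t \<ge> 0\<close> matter.
  The standing assumptions on the space and its topology are part of the notion.
\<close>

definition bicontinuous_semigroup ::
    "'a::complex_banach topology \<Rightarrow> (real \<Rightarrow> 'a \<Rightarrow> 'a) \<Rightarrow> bool" where
  "bicontinuous_semigroup \<tau> T \<longleftrightarrow>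
     bicontinuous_setting \<tau> \<and>
     (\<forall>t\<ge>0. bounded_clinear_op (T t)) \<and>
     T 0 = id \<and> (\<forall>s\<ge>0. \<forall>t\<ge>0. T (t + s) = T t \<circ> T s) \<and>
     (\<forall>f. continuous_map (top_of_set {0..}) \<tau> (\<lambda>t. T t f)) \<and>
     (\<exists>M\<ge>1. \<exists>\<omega>. \<forall>t\<ge>0. onorm (T t) \<le> M * exp (\<omega> * t)) \<and>
     (\<forall>f. bounded (range f) \<and> limitin \<tau> f 0 sequentially \<longrightarrow>
        (\<forall>t\<^sub>0\<ge>0. \<forall>U. openin \<tau> U \<and> 0 \<in> U \<longrightarrow>
           (\<forall>\<^sub>F n in sequentially. \<forall>s\<in>{0..t\<^sub>0}. T s (f n) \<in> U)))"

text \<open>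
  An unbounded operator is given by a total function \<open>A\<close> and its domain \<open>D\<close>; the values of \<open>A\<close>
  outside \<open>D\<close> are irrelevant.
\<close>

definition is_generator ::
    "'a::complex_banach topology \<Rightarrow> (real \<Rightarrow> 'a \<Rightarrow> 'a) \<Rightarrow> ('a \<Rightarrow> 'a) \<Rightarrow> 'a set \<Rightarrow> bool" where
  "is_generator \<tau> T A D \<longleftrightarrow>
     D = {f. (\<exists>g. limitin \<tau> (\<lambda>t. (T t f - f) /\<^sub>R t) g (at_right 0)) \<and>
             bdd_above ((\<lambda>t. norm (T t f - f) / t) ` {0<..1})} \<and>
     (\<forall>f\<in>D. limitin \<tau> (\<lambda>t. (T t f - f) /\<^sub>R t) (A f) (at_right 0))"

definition generates_bicontinuous_semigroup ::
    "'a::complex_banach topology \<Rightarrow> ('a \<Rightarrow> 'a) \<Rightarrow> 'a set \<Rightarrow> bool" where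
  "generates_bicontinuous_semigroup \<tau> A D \<longleftrightarrow>
     (\<exists>T. bicontinuous_semigroup \<tau> T \<and> is_generator \<tau> T A D)"

section \<open>The space of essentially bounded functions\<close>

abbreviation unit_leb :: "real measure" where
  "unit_leb \<equiv> lebesgue_on {0..1}"

definition l1norm :: "complex ^ 'm::finite \<Rightarrow> real" where
  "l1norm v = (\<Sum>i\<in>UNIV. cmod (v $ i))"

definition ess_bounded :: "(real \<Rightarrow> complex ^ 'm::finite) \<Rightarrow> bool" where
  "ess_bounded f \<longleftrightarrow> f \<in> borel_measurable unit_leb \<and> (\<exists>K. AE s in unit_leb. l1norm (f s) \<le> K)"

definition linf_rel :: "(real \<Rightarrow> complex ^ 'm::finite) \<Rightarrow> (real \<Rightarrow> complex ^ 'm) \<Rightarrow> bool" where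
  "linf_rel f g \<longleftrightarrow> ess_bounded f \<and> ess_bounded g \<and> (AE s in unit_leb. f s = g s)"

definition ess_norm :: "(real \<Rightarrow> complex ^ 'm::finite) \<Rightarrow> real" where
  "ess_norm f = real_of_ereal (esssup unit_leb (\<lambda>s. ereal (l1norm (f s))))"

lemma l1norm_nonneg [simp]: "0 \<le> l1norm v"
  by (simp add: l1norm_def sum_nonneg)

lemma l1norm_zero [simp]: "l1norm 0 = 0"
  by (simp add: l1norm_def)

lemma l1norm_eq_0: "l1norm v = 0 \<Longrightarrow> v = 0"
  by (simp add: l1norm_def sum_nonneg_eq_0_iff vec_eq_iff)

lemma l1norm_triangle: "l1norm (v + w) \<le> l1norm v + l1norm w"
  by (simp add: l1norm_def sum.distrib [symmetric] sum_mono norm_triangle_ineq)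

lemma l1norm_scaleR: "l1norm (r *\<^sub>R v) = \<bar>r\<bar> * l1norm v"
  by (simp add: l1norm_def sum_distrib_left)

lemma l1norm_scaleC: "l1norm (a *s v) = cmod a * l1norm v"
  by (simp add: l1norm_def sum_distrib_left norm_mult)

lemma l1norm_uminus [simp]: "l1norm (- v) = l1norm v"
  by (simp add: l1norm_def)

lemma norm_le_l1norm: "norm v \<le> l1norm v"
  unfolding l1norm_def norm_vec_def by (rule L2_set_le_sum) simp

lemma l1norm_matrix_vector:
  "l1norm (A *v v) \<le> (\<Sum>i\<in>UNIV. \<Sum>j\<in>UNIV. cmod (A $ i $ j)) * l1norm v"
proof -
  have "cmod ((A *v v) $ i) \<le> (\<Sum>j\<in>UNIV. cmod (A $ i $ j)) * l1norm v" for i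
  proof -
    have "cmod ((A *v v) $ i) \<le> (\<Sum>j\<in>UNIV. cmod (A $ i $ j) * cmod (v $ j))"
      unfolding matrix_vector_mult_def by (auto intro!: order_trans [OF norm_sum] simp: norm_mult)
    also have "\<dots> \<le> (\<Sum>j\<in>UNIV. cmod (A $ i $ j) * l1norm v)"
      by (intro sum_mono mult_left_mono) (auto simp: l1norm_def intro!: member_le_sum)
    finally show ?thesis by (simp add: sum_distrib_right)
  qed
  then show ?thesis
    unfolding l1norm_def [of "A *v v"] sum_distrib_right [of _ UNIV "l1norm v"]
    by (intro sum_mono) (simp add: sum_distrib_right)
qed

lemma l1norm_measurable [measurable]: "l1norm \<in> borel_measurable borel"
  unfolding l1norm_def by (intro borel_measurable_continuous_onI continuous_intros)

lemma matrix_vector_measurable: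
  "((*v) A :: complex ^ 'm::finite \<Rightarrow> complex ^ 'n::finite) \<in> borel_measurable borel"
  unfolding matrix_vector_mult_def
  by (intro borel_measurable_continuous_onI continuous_on_vec_lambda continuous_intros)

lemma scaleC_measurable:
  "((*s) a :: complex ^ 'm::finite \<Rightarrow> complex ^ 'm) \<in> borel_measurable borel"
  unfolding vector_scalar_mult_def
  by (intro borel_measurable_continuous_onI continuous_on_vec_lambda continuous_intros)

lemma ess_boundedI:
  "f \<in> borel_measurable unit_leb \<Longrightarrow> AE s in unit_leb. l1norm (f s) \<le> K \<Longrightarrow> ess_bounded f"
  unfolding ess_bounded_def by blast

lemma ess_bounded_measurable [measurable_dest]:
  "ess_bounded f \<Longrightarrow> f \<in> borel_measurable unit_leb"
  by (simp add: ess_bounded_def)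

lemma unit_leb_nontrivial: "emeasure unit_leb (space unit_leb) \<noteq> 0"
  by (simp add: emeasure_restrict_space)

lemma unit_leb_AE_const: "(AE s in unit_leb. P) \<Longrightarrow> P"
  using unit_leb_nontrivial by (simp add: eventually_const_iff ae_filter_eq_bot_iff)

lemma ess_norm_aux:
  assumes "ess_bounded f"
  shows "esssup unit_leb (\<lambda>s. ereal (l1norm (f s))) = ereal (ess_norm f)"
    and "0 \<le> ess_norm f"
proof -
  let ?E = "esssup unit_leb (\<lambda>s. ereal (l1norm (f s)))"
  from assms obtain K where K: "AE s in unit_leb. l1norm (f s) \<le> K"
    and [measurable]: "f \<in> borel_measurable unit_leb"
    by (auto simp: ess_bounded_def)
  have "?E \<le> ereal K"
    using K by (intro esssup_I) auto
  moreover have "AE s in unit_leb. 0 \<le> ?E"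
    using esssup_AE [of "\<lambda>s. ereal (l1norm (f s))" unit_leb]
    by eventually_elim (meson ereal_less_eq(5) l1norm_nonneg order_trans)
  then have "0 \<le> ?E" by (rule unit_leb_AE_const)
  ultimately show "?E = ereal (ess_norm f)" "0 \<le> ess_norm f"
    unfolding ess_norm_def by (cases ?E; simp)+
qed

lemma ess_norm_AE:
  assumes "ess_bounded f" shows "AE s in unit_leb. l1norm (f s) \<le> ess_norm f"
  using esssup_AE [of "\<lambda>s. ereal (l1norm (f s))" unit_leb] by (simp add: ess_norm_aux [OF assms])

lemma ess_norm_le:
  assumes "ess_bounded f" and "AE s in unit_leb. l1norm (f s) \<le> c" shows "ess_norm f \<le> c"
proof -
  have [measurable]: "f \<in> borel_measurable unit_leb" using assms by (simp add: ess_bounded_def)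
  have "esssup unit_leb (\<lambda>s. ereal (l1norm (f s))) \<le> ereal c"
    using assms by (intro esssup_I) auto
  then show ?thesis by (simp add: ess_norm_aux [OF assms(1)])
qed

lemma ess_bounded_zero: "ess_bounded (\<lambda>s. 0)"
  by (rule ess_boundedI [where K = 0]) auto

lemma ess_bounded_add:
  assumes "ess_bounded f" "ess_bounded g" shows "ess_bounded (\<lambda>s. f s + g s)"
proof (rule ess_boundedI)
  show "(\<lambda>s. f s + g s) \<in> borel_measurable unit_leb"
    using assms by (auto simp: ess_bounded_def)
  show "AE s in unit_leb. l1norm (f s + g s) \<le> ess_norm f + ess_norm g"
    using ess_norm_AE [OF assms(1)] ess_norm_AE [OF assms(2)]
    by eventually_elim (auto intro: order_trans [OF l1norm_triangle] add_mono)
qed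

lemma ess_bounded_uminus: "ess_bounded f \<Longrightarrow> ess_bounded (\<lambda>s. - f s)"
  by (auto simp: ess_bounded_def)

lemma ess_bounded_matrix:
  assumes "ess_bounded f" shows "ess_bounded (\<lambda>s. A *v f s)"
proof (rule ess_boundedI)
  show "(\<lambda>s. A *v f s) \<in> borel_measurable unit_leb"
    using assms measurable_compose [OF _ matrix_vector_measurable] by (auto simp: ess_bounded_def)
  show "AE s in unit_leb. l1norm (A *v f s) \<le>
      (\<Sum>i\<in>UNIV. \<Sum>j\<in>UNIV. cmod (A $ i $ j)) * ess_norm f"
    using ess_norm_AE [OF assms]
    by eventually_elim
      (auto intro!: order_trans [OF l1norm_matrix_vector] mult_left_mono sum_nonneg)
qed

lemma ess_bounded_scaleC:
  assumes "ess_bounded f" shows "ess_bounded (\<lambda>s. a *s f s)"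
proof (rule ess_boundedI)
  show "(\<lambda>s. a *s f s) \<in> borel_measurable unit_leb"
    using assms measurable_compose [OF _ scaleC_measurable] by (auto simp: ess_bounded_def)
  show "AE s in unit_leb. l1norm (a *s f s) \<le> cmod a * ess_norm f"
    using ess_norm_AE [OF assms]
    by eventually_elim (auto simp: l1norm_scaleC intro: mult_left_mono)
qed

lemma scaleR_eq_scaleC: "r *\<^sub>R v = complex_of_real r *s v"
  by (simp add: vec_eq_iff scaleR_conv_of_real [where 'a = complex])

lemma ess_bounded_scaleR: "ess_bounded f \<Longrightarrow> ess_bounded (\<lambda>s. r *\<^sub>R f s)"
  unfolding scaleR_eq_scaleC by (rule ess_bounded_scaleC)

quotient_type 'm linf = "real \<Rightarrow> complex ^ 'm::finite" / partial: linf_rel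
proof (rule part_equivpI)
  show "\<exists>f :: real \<Rightarrow> complex ^ 'm. linf_rel f f"
    using ess_bounded_zero by (auto simp: linf_rel_def)
  show "symp (linf_rel :: (real \<Rightarrow> complex ^ 'm) \<Rightarrow> _)"
    by (rule sympI) (auto simp: linf_rel_def elim: eventually_mono)
  show "transp (linf_rel :: (real \<Rightarrow> complex ^ 'm) \<Rightarrow> _)"
    by (rule transpI) (auto simp: linf_rel_def elim: eventually_elim2)
qed

instantiation linf :: (finite) real_normed_vector
begin

lift_definition zero_linf :: "'a linf" is "\<lambda>s. 0"
  by (simp add: linf_rel_def ess_bounded_zero)

lift_definition plus_linf :: "'a linf \<Rightarrow> 'a linf \<Rightarrow> 'a linf" is "\<lambda>f g s. f s + g s"
  by (auto simp: linf_rel_def ess_bounded_add elim: eventually_elim2)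

lift_definition uminus_linf :: "'a linf \<Rightarrow> 'a linf" is "\<lambda>f s. - f s"
  by (auto simp: linf_rel_def ess_bounded_uminus elim: eventually_mono)

definition minus_linf :: "'a linf \<Rightarrow> 'a linf \<Rightarrow> 'a linf" where
  "minus_linf f g = f + (- g)"

lift_definition scaleR_linf :: "real \<Rightarrow> 'a linf \<Rightarrow> 'a linf" is "\<lambda>r f s. r *\<^sub>R f s"
  by (auto simp: linf_rel_def ess_bounded_scaleR elim: eventually_mono)

lift_definition norm_linf :: "'a linf \<Rightarrow> real" is ess_norm
proof -
  fix f g :: "real \<Rightarrow> complex ^ 'a"
  assume "linf_rel f g"
  then have "ess_bounded f" "ess_bounded g" "AE s in unit_leb. f s = g s"
    by (auto simp: linf_rel_def)
  then show "ess_norm f = ess_norm g"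
    unfolding ess_norm_def
    by (intro arg_cong [where f = real_of_ereal] esssup_AE_cong)
      (auto simp: ess_bounded_def elim: eventually_mono)
qed

definition dist_linf :: "'a linf \<Rightarrow> 'a linf \<Rightarrow> real" where
  "dist_linf f g = norm (f - g)"

definition sgn_linf :: "'a linf \<Rightarrow> 'a linf" where
  "sgn_linf f = inverse (norm f) *\<^sub>R f"

definition uniformity_linf :: "('a linf \<times> 'a linf) filter" where
  "uniformity_linf = (INF e\<in>{0 <..}. principal {(x, y). dist x y < e})"

definition open_linf :: "'a linf set \<Rightarrow> bool" where
  "open_linf U \<longleftrightarrow> (\<forall>x\<in>U. \<forall>\<^sub>F (x', y) in uniformity. x' = x \<longrightarrow> y \<in> U)"

instance
proof
  fix f g h :: "'a linf" and a b :: real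
  show "f + g + h = f + (g + h)"
    by transfer (auto simp: linf_rel_def ess_bounded_add add.assoc)
  show "f + g = g + f"
    by transfer (auto simp: linf_rel_def ess_bounded_add add.commute)
  show "0 + f = f"
    by transfer (auto simp: linf_rel_def)
  show "- f + f = 0"
    by transfer (auto simp: linf_rel_def ess_bounded_zero)
  show "f - g = f + - g"
    by (fact minus_linf_def)
  show "a *\<^sub>R (f + g) = a *\<^sub>R f + a *\<^sub>R g"
    by transfer
      (auto simp: linf_rel_def scaleR_add_right intro: ess_bounded_add ess_bounded_scaleR)
  show "(a + b) *\<^sub>R f = a *\<^sub>R f + b *\<^sub>R f"
    by transfer
      (auto simp: linf_rel_def scaleR_add_left intro: ess_bounded_add ess_bounded_scaleR)
  show "a *\<^sub>R b *\<^sub>R f = (a * b) *\<^sub>R f"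
    by transfer (auto simp: linf_rel_def intro: ess_bounded_scaleR)
  show "1 *\<^sub>R f = f"
    by transfer (auto simp: linf_rel_def)
  show "dist f g = norm (f - g)"
    by (fact dist_linf_def)
  show "sgn f = inverse (norm f) *\<^sub>R f"
    by (fact sgn_linf_def)
  show "uniformity = (INF e\<in>{0 <..}. principal {(x :: 'a linf, y). dist x y < e})"
    by (fact uniformity_linf_def)
  show "open U \<longleftrightarrow> (\<forall>x\<in>U. \<forall>\<^sub>F (x', y) in uniformity. x' = x \<longrightarrow> y \<in> U)" for U :: "'a linf set"
    by (fact open_linf_def)
  show "norm f = 0 \<longleftrightarrow> f = 0"
  proof transfer
    fix f :: "real \<Rightarrow> complex ^ 'a" assume "linf_rel f f"
    then have f: "ess_bounded f" by (simp add: linf_rel_def)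
    show "ess_norm f = 0 \<longleftrightarrow> linf_rel f (\<lambda>s. 0)"
    proof
      assume "ess_norm f = 0"
      with ess_norm_AE [OF f] have "AE s in unit_leb. f s = 0"
        by (auto elim!: eventually_mono intro!: l1norm_eq_0 intro: order_antisym)
      with f show "linf_rel f (\<lambda>s. 0)"
        by (simp add: linf_rel_def ess_bounded_zero)
    next
      assume "linf_rel f (\<lambda>s. 0)"
      then have "ess_norm f \<le> 0"
        by (intro ess_norm_le [OF f]) (auto simp: linf_rel_def elim: eventually_mono)
      with ess_norm_aux(2) [OF f] show "ess_norm f = 0" by simp
    qed
  qed
  show "norm (f + g) \<le> norm f + norm g"
  proof transfer
    fix f g :: "real \<Rightarrow> complex ^ 'a" assume "linf_rel f f" "linf_rel g g"
    then have fg: "ess_bounded f" "ess_bounded g" by (auto simp: linf_rel_def)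
    show "ess_norm (\<lambda>s. f s + g s) \<le> ess_norm f + ess_norm g"
    proof (rule ess_norm_le [OF ess_bounded_add [OF fg]])
      show "AE s in unit_leb. l1norm (f s + g s) \<le> ess_norm f + ess_norm g"
        using ess_norm_AE [OF fg(1)] ess_norm_AE [OF fg(2)]
        by eventually_elim (auto intro: order_trans [OF l1norm_triangle] add_mono)
    qed
  qed
  show "norm (a *\<^sub>R f) = \<bar>a\<bar> * norm f"
  proof transfer
    fix a :: real and f :: "real \<Rightarrow> complex ^ 'a" assume "linf_rel f f"
    then have f: "ess_bounded f" by (simp add: linf_rel_def)
    have le: "ess_norm (\<lambda>s. r *\<^sub>R g s) \<le> \<bar>r\<bar> * ess_norm g" if "ess_bounded g"
      for r and g :: "real \<Rightarrow> complex ^ 'a"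
      using ess_norm_AE [OF that]
      by (intro ess_norm_le [OF ess_bounded_scaleR [OF that]])
        (auto simp: l1norm_scaleR mult_left_mono elim: eventually_mono)
    show "ess_norm (\<lambda>s. a *\<^sub>R f s) = \<bar>a\<bar> * ess_norm f"
    proof (cases "a = 0")
      case True
      then show ?thesis
        using le [OF f, of 0] ess_norm_aux(2) [OF ess_bounded_scaleR [OF f, of 0]] by simp
    next
      case False
      have "ess_norm f \<le> \<bar>inverse a\<bar> * ess_norm (\<lambda>s. a *\<^sub>R f s)"
        using le [OF ess_bounded_scaleR [OF f, of a], of "inverse a"] False by simp
      with False have "\<bar>a\<bar> * ess_norm f \<le> ess_norm (\<lambda>s. a *\<^sub>R f s)"
        by (simp add: field_simps abs_inverse)
      with le [OF f, of a] show ?thesis by simp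
    qed
  qed
qed

end

lemma ess_bounded_rep: "ess_bounded (rep_linf f)"
  using Quotient3_rep_reflp [OF Quotient3_linf, of f] by (simp add: linf_rel_def)

lemma rep_abs_linf: "ess_bounded f \<Longrightarrow> AE s in unit_leb. rep_linf (abs_linf f) s = f s"
  using Quotient3_rep_abs [OF Quotient3_linf, of f] by (simp add: linf_rel_def)

lemma abs_rep_linf [simp]: "abs_linf (rep_linf f) = f"
  by (rule Quotient3_abs_rep [OF Quotient3_linf])

lemma rep_linf_AE_eq: "(AE s in unit_leb. rep_linf f s = rep_linf g s) \<longleftrightarrow> f = g"
  using Quotient3_rel_rep [OF Quotient3_linf, of f g]
  by (simp add: linf_rel_def ess_bounded_rep)

lemma rep_linf_add: "AE s in unit_leb. rep_linf (f + g) s = rep_linf f s + rep_linf g s"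
  unfolding plus_linf_def by (simp add: rep_abs_linf ess_bounded_add ess_bounded_rep)

lemma rep_linf_uminus: "AE s in unit_leb. rep_linf (- f) s = - rep_linf f s"
  unfolding uminus_linf_def by (simp add: rep_abs_linf ess_bounded_uminus ess_bounded_rep)

lemma rep_linf_diff: "AE s in unit_leb. rep_linf (f - g) s = rep_linf f s - rep_linf g s"
  unfolding minus_linf_def using rep_linf_add [of f "- g"] rep_linf_uminus [of g]
  by eventually_elim simp

lemma norm_linf_rep: "norm f = ess_norm (rep_linf f)"
  by (simp add: norm_linf_def)

lemma norm_linf_AE: "AE s in unit_leb. l1norm (rep_linf f s) \<le> norm f"
  unfolding norm_linf_rep by (intro ess_norm_AE ess_bounded_rep)

lemma norm_linf_le: "AE s in unit_leb. l1norm (rep_linf f s) \<le> c \<Longrightarrow> norm f \<le> c"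
  unfolding norm_linf_rep by (intro ess_norm_le ess_bounded_rep)

lemma l1norm_tendsto: "(v \<longlongrightarrow> w) F \<Longrightarrow> ((\<lambda>n. l1norm (v n)) \<longlongrightarrow> l1norm w) F"
  unfolding l1norm_def by (intro tendsto_intros)

instance linf :: (finite) banach
proof
  fix X :: "nat \<Rightarrow> 'a linf"
  assume X: "Cauchy X"
  define L where "L s = lim (\<lambda>n. rep_linf (X n) s)" for s
  have diff: "AE s in unit_leb. \<forall>m n. l1norm (rep_linf (X m) s - rep_linf (X n) s) \<le> norm (X m - X n)"
    unfolding AE_all_countable
  proof (intro allI)
    fix m n
    show "AE s in unit_leb. l1norm (rep_linf (X m) s - rep_linf (X n) s) \<le> norm (X m - X n)"
      using norm_linf_AE [of "X m - X n"] rep_linf_diff [of "X m" "X n"]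
      by eventually_elim simp
  qed
  have lim: "AE s in unit_leb. (\<lambda>n. rep_linf (X n) s) \<longlonglongrightarrow> L s"
    using diff
  proof eventually_elim
    fix s assume s: "\<forall>m n. l1norm (rep_linf (X m) s - rep_linf (X n) s) \<le> norm (X m - X n)"
    have "Cauchy (\<lambda>n. rep_linf (X n) s)"
    proof (rule CauchyI)
      fix e :: real assume "0 < e"
      then obtain N where "\<forall>m\<ge>N. \<forall>n\<ge>N. norm (X m - X n) < e"
        using CauchyD [OF X] by blast
      then show "\<exists>N. \<forall>m\<ge>N. \<forall>n\<ge>N. norm (rep_linf (X m) s - rep_linf (X n) s) < e"
        using s by (meson norm_le_l1norm order_le_less_trans)
    qed
    then show "(\<lambda>n. rep_linf (X n) s) \<longlonglongrightarrow> L s"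
      unfolding L_def by (simp add: Cauchy_convergent convergent_LIMSEQ_iff [symmetric])
  qed
  have L: "ess_bounded L"
  proof -
    obtain K where K: "\<And>n. norm (X n) \<le> K"
      using Cauchy_Bseq [OF X] by (auto simp: Bseq_def)
    show ?thesis
    proof (rule ess_boundedI)
      show "L \<in> borel_measurable unit_leb"
        unfolding L_def [abs_def]
        by (rule borel_measurable_lim_metric) (simp add: ess_bounded_measurable ess_bounded_rep)
      have "AE s in unit_leb. \<forall>n. l1norm (rep_linf (X n) s) \<le> K"
        unfolding AE_all_countable
        by (intro allI eventually_mono [OF norm_linf_AE]) (use K order_trans in blast)
      with lim show "AE s in unit_leb. l1norm (L s) \<le> K"
        by eventually_elim (auto intro: LIMSEQ_le_const2 l1norm_tendsto)
    qed
  qed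
  have "X \<longlonglongrightarrow> abs_linf L"
  proof (rule LIMSEQ_I)
    fix e :: real assume "0 < e"
    then obtain N where N: "\<forall>m\<ge>N. \<forall>n\<ge>N. norm (X m - X n) < e / 2"
      using CauchyD [OF X, of "e / 2"] by auto
    have "norm (X n - abs_linf L) < e" if "n \<ge> N" for n
    proof -
      have "AE s in unit_leb. l1norm (rep_linf (X n - abs_linf L) s) \<le> e / 2"
        using diff lim rep_abs_linf [OF L] rep_linf_diff [of "X n" "abs_linf L"]
      proof eventually_elim
        case (elim s)
        have "(\<lambda>m. l1norm (rep_linf (X n) s - rep_linf (X m) s)) \<longlonglongrightarrow> l1norm (rep_linf (X n) s - L s)"
          by (intro l1norm_tendsto tendsto_intros elim)
        moreover have "l1norm (rep_linf (X n) s - rep_linf (X m) s) \<le> e / 2" if "m \<ge> N" for m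
          using elim(1) N \<open>n \<ge> N\<close> that by (meson less_imp_le order_trans)
        ultimately have "l1norm (rep_linf (X n) s - L s) \<le> e / 2"
          by (intro LIMSEQ_le_const2) auto
        then show ?case using elim by simp
      qed
      then have "norm (X n - abs_linf L) \<le> e / 2" by (rule norm_linf_le)
      with \<open>0 < e\<close> show ?thesis by simp
    qed
    then show "\<exists>N. \<forall>n\<ge>N. norm (X n - abs_linf L) < e" by blast
  qed
  then show "convergent X" by (auto simp: convergent_def)
qed

instantiation linf :: (finite) complex_banach
begin

lift_definition scaleC_linf :: "complex \<Rightarrow> 'a linf \<Rightarrow> 'a linf" is "\<lambda>a f s. a *s f s"
  by (auto simp: linf_rel_def ess_bounded_scaleC elim: eventually_mono)

instance
proof
  fix f g :: "'a linf" and a b :: complex and r :: real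
  show "a *\<^sub>C (f + g) = a *\<^sub>C f + a *\<^sub>C g"
    by transfer
      (auto simp: linf_rel_def vector_add_ldistrib intro: ess_bounded_add ess_bounded_scaleC)
  show "(a + b) *\<^sub>C f = a *\<^sub>C f + b *\<^sub>C f"
    by transfer
      (auto simp: linf_rel_def vector_sadd_rdistrib intro: ess_bounded_add ess_bounded_scaleC)
  show "a *\<^sub>C (b *\<^sub>C f) = (a * b) *\<^sub>C f"
    by transfer (auto simp: linf_rel_def vector_smult_assoc intro: ess_bounded_scaleC)
  show "complex_of_real r *\<^sub>C f = r *\<^sub>R f"
    by transfer (auto simp: linf_rel_def scaleR_eq_scaleC [symmetric] intro: ess_bounded_scaleR)
  show "norm (a *\<^sub>C f) = cmod a * norm f"
  proof transfer
    fix a and f :: "real \<Rightarrow> complex ^ 'a" assume "linf_rel f f"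
    then have f: "ess_bounded f" by (simp add: linf_rel_def)
    have le: "ess_norm (\<lambda>s. b *s g s) \<le> cmod b * ess_norm g" if "ess_bounded g"
      for b and g :: "real \<Rightarrow> complex ^ 'a"
      using ess_norm_AE [OF that]
      by (intro ess_norm_le [OF ess_bounded_scaleC [OF that]])
        (auto simp: l1norm_scaleC mult_left_mono elim: eventually_mono)
    show "ess_norm (\<lambda>s. a *s f s) = cmod a * ess_norm f"
    proof (cases "a = 0")
      case True
      then show ?thesis
        using le [OF f, of 0] ess_norm_aux(2) [OF ess_bounded_scaleC [OF f, of 0]] by simp
    next
      case False
      have "ess_norm f \<le> cmod (inverse a) * ess_norm (\<lambda>s. a *s f s)"
        using le [OF ess_bounded_scaleC [OF f, of a], of "inverse a"] False
        by (simp add: vector_smult_assoc)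
      with False have "cmod a * ess_norm f \<le> ess_norm (\<lambda>s. a *s f s)"
        by (simp add: norm_inverse pos_le_divide_eq inverse_eq_divide norm_divide mult.commute)
      with le [OF f, of a] show ?thesis by simp
    qed
  qed
qed

end

lift_definition matrix_app :: "complex ^ 'm::finite ^ 'm \<Rightarrow> 'm linf \<Rightarrow> 'm linf" is "\<lambda>A f s. A *v f s"
  by (auto simp: linf_rel_def ess_bounded_matrix elim: eventually_mono)

text \<open>
  The pairing of \<open>f\<close> with an integrable \<open>g\<close>; it is bilinear and independent of the
  representative \<open>rep_linf f\<close>.
\<close>

definition linf_pairing :: "'m::finite linf \<Rightarrow> (real \<Rightarrow> complex ^ 'm) \<Rightarrow> complex" where
  "linf_pairing f g = (\<integral>s. (\<Sum>j\<in>UNIV. rep_linf f s $ j * g s $ j) \<partial>unit_leb)"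

definition weak_star :: "'m::finite linf topology" where
  "weak_star = topology_generated_by
     {(\<lambda>f. linf_pairing f g) -` U | g U. integrable unit_leb g \<and> open U}"

section \<open>Sobolev functions\<close>

text \<open>
  The test functions are the smooth functions on the line with compact support in the open
  interval \<open>(0, 1)\<close>: a closed subset of \<open>(0, 1)\<close> is bounded, hence compact. Real-valued ones
  suffice, since the defining identity of the weak derivative is complex linear.
\<close>

definition test_function :: "(real \<Rightarrow> real) \<Rightarrow> bool" where
  "test_function \<phi> \<longleftrightarrow>
     (\<forall>n x. (deriv ^^ n) \<phi> differentiable (at x)) \<and> closure {x. \<phi> x \<noteq> 0} \<subseteq> {0<..<1}"

definition has_weak_deriv :: "'m::finite linf \<Rightarrow> 'm linf \<Rightarrow> bool" where
  "has_weak_deriv f g \<longleftrightarrow>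
     (\<forall>\<phi>. test_function \<phi> \<longrightarrow>
        (\<integral>s. deriv \<phi> s *\<^sub>R rep_linf f s \<partial>unit_leb) = - (\<integral>s. \<phi> s *\<^sub>R rep_linf g s \<partial>unit_leb))"

definition W1inf :: "'m::finite linf set" where
  "W1inf = {f. \<exists>g. has_weak_deriv f g}"

definition weak_deriv :: "'m::finite linf \<Rightarrow> 'm linf" where
  "weak_deriv f = (THE g. has_weak_deriv f g)"

definition continuous_rep :: "'m::finite linf \<Rightarrow> (real \<Rightarrow> complex ^ 'm) \<Rightarrow> bool" where
  "continuous_rep f F \<longleftrightarrow> continuous_on {0..1} F \<and> (AE s in unit_leb. rep_linf f s = F s)"

section \<open>The network operator\<close>

text \<open>
  The edges of the digraph \<open>G\<close> are enumerated by the bijection \<open>e\<close> from a finite index type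
  with \<open>m\<close> elements; the tail and head of an edge \<open>(u, v)\<close> are \<open>u = fst (u, v)\<close> and
  \<open>v = snd (u, v)\<close>.
\<close>

definition weighted_digraph ::
    "'v pair_pre_digraph \<Rightarrow> ('m::finite \<Rightarrow> 'v \<times> 'v) \<Rightarrow> ('m \<Rightarrow> 'm \<Rightarrow> real) \<Rightarrow> bool" where
  "weighted_digraph G e w \<longleftrightarrow>
     pair_digraph G \<and> bij_betw e UNIV (parcs G) \<and>
     (\<forall>i j. 0 \<le> w i j \<and> w i j \<le> 1) \<and>
     (\<forall>i j. w i j \<noteq> 0 \<longrightarrow> snd (e j) = fst (e i)) \<and>
     (\<forall>j. (\<Sum>i\<in>UNIV. w i j) = 1)"

definition line_adjacency ::
    "('m::finite \<Rightarrow> 'v \<times> 'v) \<Rightarrow> ('m \<Rightarrow> 'm \<Rightarrow> real) \<Rightarrow> complex ^ 'm ^ 'm" where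
  "line_adjacency e w = (\<chi> i j. if snd (e j) = fst (e i) then complex_of_real (w i j) else 0)"

definition diag_matrix :: "('m::finite \<Rightarrow> real) \<Rightarrow> complex ^ 'm ^ 'm" where
  "diag_matrix c = (\<chi> i j. if i = j then complex_of_real (c i) else 0)"

definition conj_diag :: "('m::finite \<Rightarrow> real) \<Rightarrow> complex ^ 'm ^ 'm \<Rightarrow> complex ^ 'm ^ 'm" where
  "conj_diag c B = matrix_inv (diag_matrix c) ** B ** diag_matrix c"

definition A_op :: "('m::finite \<Rightarrow> real) \<Rightarrow> 'm linf \<Rightarrow> 'm linf" where
  "A_op c f = matrix_app (diag_matrix c) (weak_deriv f)"

definition A_dom :: "('m::finite \<Rightarrow> real) \<Rightarrow> complex ^ 'm ^ 'm \<Rightarrow> 'm linf set" where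
  "A_dom c B = {f \<in> W1inf. \<exists>F. continuous_rep f F \<and> F 1 = conj_diag c B *v F 0}"

end

theory Submission
  imports Defs
begin

text \<open>
  The Cauchy problem of the operator is a transport equation on every edge, where the time derivative
  of \<open>u_j\<close> is \<open>c_j\<close> times its space derivative. The profiles
  travel towards the endpoint \<open>0\<close> with speed \<open>c_j\<close>, and what arrives there is redistributed
  to the endpoints \<open>1\<close> by the matrix \<open>K\<close> of the boundary condition \<open>f(1) = K f(0)\<close>. Its solution
  is explicit.

  Let \<open>H_j(t)\<close> be the value that arrives at the endpoint \<open>0\<close> of the edge \<open>j\<close> at time \<open>t\<close> (\<open>arrival\<close>). Then
  \<open>H_j(t) = f_j(c_j t)\<close> for \<open>t < 1 / c_j\<close>, and afterwards \<open>H_j(t)\<close> is the sum over \<open>k\<close> of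
  \<open>K_jk H_k(t - 1 / c_j)\<close>. These delay equations determine \<open>H\<close> recursively, and the semigroup is
  \<open>(T(t) f)_j(x) = H_j(t + x / c_j)\<close> (\<open>transport\<close>). The semigroup law is the uniqueness of \<open>H\<close>, and
  the exponential bound follows by induction along the delay equations.

  Weak-star statements are reduced to intervals: the linear combinations of indicators of intervals
  are dense in \<open>L\<^sup>1\<close>, so that a bounded family in \<open>L\<^sup>\<infinity>\<close> converges weakly-star along a filter as soon as
  its integrals over intervals converge (\<open>linf_pairing_tendsto_intervals\<close>). The integral of \<open>(T(t) f)_j\<close>
  over \<open>[a, b]\<close> is \<open>c_j (P_j(t + b / c_j) - P_j(t + a / c_j))\<close> with the primitive \<open>P_j\<close> of \<open>H_j\<close>. Since \<open>P_j\<close>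
  is locally Lipschitz with a constant controlled by the norm of \<open>f\<close>, this gives the continuity of
  the orbits; for a bounded weak-star null sequence the \<open>P_j\<close> tend to zero pointwise, again by the delay
  equations, and hence locally uniformly, which is the equicontinuity.

  The requirements on the weak-star topology itself need \<open>L\<^sup>\<infinity>\<close> to be the dual of \<open>L\<^sup>1\<close> in one place only:
  the limit of a bounded weak-star Cauchy sequence is obtained from the Radon--Nikodym theorem.

  For the generator, let first the difference quotients of \<open>f\<close> be bounded and weak-star convergent to \<open>g\<close>.
  Translating them to test functions shows that \<open>f_j\<close> has the weak derivative \<open>g_j / c_j\<close>, and the lemma
  of du Bois-Reymond turns \<open>f\<close> into a Lipschitz function. If \<open>f(1) \<noteq> K f(0)\<close>, then \<open>H\<close> would jump at some
  time \<open>1 / c_j\<close>, which contradicts the bound on \<open>T(t) f - f\<close>. Conversely, let \<open>f\<close> be in the domain. Then \<open>H\<close>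
  is locally Lipschitz, so that the difference quotients are bounded; on intervals they are difference
  quotients of \<open>P_j\<close> and converge by the fundamental theorem of calculus.
\<close>

section \<open>Bounded functions tested against integrable functions\<close>

lemma integrable_bounded_mult:
  fixes u g :: "'a \<Rightarrow> complex"
  assumes u: "u \<in> borel_measurable M" "AE s in M. cmod (u s) \<le> K" and g: "integrable M g"
  shows "integrable M (\<lambda>s. u s * g s)"
    and "cmod (\<integral>s. u s * g s \<partial>M) \<le> K * (\<integral>s. cmod (g s) \<partial>M)"
proof -
  have [measurable]: "u \<in> borel_measurable M" "g \<in> borel_measurable M" using u g by auto
  have int: "integrable M (\<lambda>s. K * cmod (g s))" using g by auto
  have ae: "AE s in M. cmod (u s * g s) \<le> K * cmod (g s)"
    using u(2) by eventually_elim (simp add: norm_mult mult_right_mono)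
  show 1: "integrable M (\<lambda>s. u s * g s)"
    by (rule Bochner_Integration.integrable_bound [OF int])
      (measurable, use ae in eventually_elim, simp add: order_trans [OF _ abs_ge_self])
  have "cmod (\<integral>s. u s * g s \<partial>M) \<le> (\<integral>s. cmod (u s * g s) \<partial>M)" by (rule integral_norm_bound)
  also have "\<dots> \<le> (\<integral>s. K * cmod (g s) \<partial>M)"
    by (intro integral_mono_AE ae int integrable_norm 1)
  finally show "cmod (\<integral>s. u s * g s \<partial>M) \<le> K * (\<integral>s. cmod (g s) \<partial>M)" by simp
qed

text \<open>
  The integrable functions \<open>g\<close> for which the conclusion below holds form a subspace closed in
  \<open>L\<^sup>1\<close>, because the functions \<open>u x\<close> are uniformly bounded.
\<close>

lemma tendsto_integral_L1_closed:
  fixes u :: "'x \<Rightarrow> 'a \<Rightarrow> complex"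
  assumes u: "\<forall>\<^sub>F x in F. u x \<in> borel_measurable M \<and> (AE s in M. cmod (u x s) \<le> K)"
    and h: "\<And>i::nat. integrable M (h i)" and g: "integrable M g"
    and conv: "\<And>i. ((\<lambda>x. \<integral>s. u x s * h i s \<partial>M) \<longlongrightarrow> 0) F"
    and L1: "(\<lambda>i. \<integral>s. cmod (g s - h i s) \<partial>M) \<longlonglongrightarrow> 0"
  shows "((\<lambda>x. \<integral>s. u x s * g s \<partial>M) \<longlongrightarrow> 0) F"
proof (rule tendstoI)
  fix e :: real assume e: "0 < e"
  have "0 < e / (2 * (\<bar>K\<bar> + 1))" using e by simp
  then have "\<forall>\<^sub>F i in sequentially. (\<integral>s. cmod (g s - h i s) \<partial>M) < e / (2 * (\<bar>K\<bar> + 1))"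
    using L1 by (rule order_tendstoD(2) [rotated])
  then obtain i where i: "(\<integral>s. cmod (g s - h i s) \<partial>M) < e / (2 * (\<bar>K\<bar> + 1))"
    by (auto simp: eventually_sequentially)
  have "\<forall>\<^sub>F x in F. dist (\<integral>s. u x s * h i s \<partial>M) 0 < e / 2"
    using conv [of i] e by (intro tendstoD) auto
  with u show "\<forall>\<^sub>F x in F. dist (\<integral>s. u x s * g s \<partial>M) 0 < e"
  proof eventually_elim
    case (elim x)
    then have ux: "u x \<in> borel_measurable M" "AE s in M. cmod (u x s) \<le> K" by auto
    have gh: "integrable M (\<lambda>s. g s - h i s)" using g h by auto
    have "(\<integral>s. u x s * g s \<partial>M) = (\<integral>s. u x s * (g s - h i s) \<partial>M) + (\<integral>s. u x s * h i s \<partial>M)"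
      using integrable_bounded_mult(1) [OF ux gh] integrable_bounded_mult(1) [OF ux h [of i]]
      by (subst Bochner_Integration.integral_add [symmetric]) (auto simp: algebra_simps)
    moreover have "cmod (\<integral>s. u x s * (g s - h i s) \<partial>M) \<le> K * (\<integral>s. cmod (g s - h i s) \<partial>M)"
      by (rule integrable_bounded_mult [OF ux gh])
    moreover have "K * (\<integral>s. cmod (g s - h i s) \<partial>M) \<le> (\<bar>K\<bar> + 1) * (\<integral>s. cmod (g s - h i s) \<partial>M)"
      by (intro mult_right_mono) auto
    moreover have "(\<bar>K\<bar> + 1) * (\<integral>s. cmod (g s - h i s) \<partial>M) < e / 2"
      using i by (simp add: field_simps add_pos_pos)
    ultimately show ?case
      using elim norm_triangle_ineq [of "\<integral>s. u x s * (g s - h i s) \<partial>M" "\<integral>s. u x s * h i s \<partial>M"]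
      by simp
  qed
qed

text \<open>
  A uniformly bounded family that tends to zero when tested against intervals tends to zero
  weakly-star. All convergence statements about the semigroup are reduced to this one, for
  various filters.
\<close>

lemma tendsto_integral_intervals:
  fixes u :: "'x \<Rightarrow> real \<Rightarrow> complex"
  assumes u: "\<forall>\<^sub>F x in F. u x \<in> borel_measurable unit_leb \<and> (AE s in unit_leb. cmod (u x s) \<le> K)"
    and conv: "\<And>a b. 0 \<le> a \<Longrightarrow> a \<le> b \<Longrightarrow> b \<le> 1 \<Longrightarrow>
      ((\<lambda>x. \<integral>s. u x s * indicator {a..b} s \<partial>unit_leb) \<longlongrightarrow> 0) F"
    and g: "integrable unit_leb g"
  shows "((\<lambda>x. \<integral>s. u x s * g s \<partial>unit_leb) \<longlongrightarrow> 0) F"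
proof -
  let ?P = "\<lambda>g. ((\<lambda>x. \<integral>s. u x s * g s \<partial>unit_leb) \<longlongrightarrow> 0) F"
  have fin: "finite_measure unit_leb"
    by (rule finite_measureI) (simp add: emeasure_restrict_space)
  have int_ind: "integrable unit_leb (indicator A :: real \<Rightarrow> complex)" if "A \<in> sets unit_leb" for A
    using that
    by (intro finite_measure.integrable_const_bound [OF fin, where B = 1]) (auto simp: indicator_def)
  have borel_unit: "A \<inter> {0..1} \<in> sets unit_leb" if "A \<in> sets borel" for A :: "real set"
    using that by (auto simp: sets_restrict_space)
  have cmult: "?P (\<lambda>s. g s * c)" if "?P g" for g c
  proof -
    have "(\<lambda>x. \<integral>s. u x s * (g s * c) \<partial>unit_leb) = (\<lambda>x. (\<integral>s. u x s * g s \<partial>unit_leb) * c)"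
      by (simp add: mult.assoc [symmetric])
    with tendsto_mult_left_zero [OF that, of c] show ?thesis by simp
  qed
  have add2: "?P (\<lambda>s. g s + h s)" if "?P g" "?P h" "integrable unit_leb g" "integrable unit_leb h" for g h
  proof (rule Lim_transform_eventually)
    show "((\<lambda>x. (\<integral>s. u x s * g s \<partial>unit_leb) + (\<integral>s. u x s * h s \<partial>unit_leb)) \<longlongrightarrow> 0) F"
      using tendsto_add [OF that(1,2)] by simp
    show "\<forall>\<^sub>F x in F. (\<integral>s. u x s * g s \<partial>unit_leb) + (\<integral>s. u x s * h s \<partial>unit_leb) =
        (\<integral>s. u x s * (g s + h s) \<partial>unit_leb)"
      using u
    proof eventually_elim
      case (elim x)
      then have ux: "u x \<in> borel_measurable unit_leb" "AE s in unit_leb. cmod (u x s) \<le> K" by auto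
      show ?case
        unfolding distrib_left
        by (intro Bochner_Integration.integral_add [symmetric] integrable_bounded_mult(1) [OF ux] that)
    qed
  qed
  have ae: "?P h" if "?P g" "AE s in unit_leb. g s = h s" "g \<in> borel_measurable unit_leb"
    "h \<in> borel_measurable unit_leb" for g h
    using that(1)
  proof (rule Lim_transform_eventually)
    show "\<forall>\<^sub>F x in F. (\<integral>s. u x s * g s \<partial>unit_leb) = (\<integral>s. u x s * h s \<partial>unit_leb)"
      using u
    proof eventually_elim
      case (elim x)
      then have [measurable]: "u x \<in> borel_measurable unit_leb" by simp
      note [measurable] = that(3,4)
      show ?case using that(2) by (intro integral_cong_AE) (auto elim: eventually_mono)
    qed
  qed
  have borel: "?P (indicator (A \<inter> {0..1}))" if "A \<in> sets borel" for A
  proof -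
    have "Int_stable (range (\<lambda>(a, b). {a..b::real}))"
      by (rule Int_stableI) (fastforce simp: image_iff)
    moreover have "range (\<lambda>(a, b). {a..b::real}) \<subseteq> Pow UNIV" by simp
    moreover have "A \<in> sigma_sets UNIV (range (\<lambda>(a, b). {a..b::real}))"
      using that by (simp add: borel_eq_atLeastAtMost)
    ultimately show ?thesis
    proof (induction rule: sigma_sets_induct_disjoint)
      case (basic A)
      then obtain a b where A: "A = {a..b}" by auto
      then have eq: "A \<inter> {0..1} = {max a 0..min b 1}" by auto
      show ?case
      proof (cases "max a 0 \<le> min b 1")
        case True
        then show ?thesis unfolding eq by (intro conv) auto
      next
        case False
        then have "A \<inter> {0..1} = {}" unfolding eq by auto
        then show ?thesis by (simp only:) simp
      qed
    next
      case empty
      then show ?case by simp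
    next
      case (compl A)
      then have "A \<in> sets borel" by (simp add: borel_eq_atLeastAtMost)
      have "?P (\<lambda>s. indicator {0..1} s + indicator (A \<inter> {0..1}) s * (- 1))"
        using \<open>A \<in> sets borel\<close>
        by (intro add2 cmult compl conv integrable_mult_left int_ind borel_unit) auto
      also have "(\<lambda>s. indicator {0..1} s + indicator (A \<inter> {0..1}) s * (- 1) :: complex) =
          indicator ((UNIV - A) \<inter> {0..1})"
        by (auto simp: indicator_def)
      finally show ?case .
    next
      case (union A)
      then have A [measurable]: "\<And>i. A i \<in> sets borel" by (simp add: borel_eq_atLeastAtMost image_subset_iff)
      define h where "h n = (\<lambda>s. \<Sum>i<n. indicator (A i \<inter> {0..1}) s :: complex)" for n :: nat
      have h_int: "integrable unit_leb (h n)" for n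
        unfolding h_def by (intro Bochner_Integration.integrable_sum int_ind borel_unit A)
      have h_eq: "h n = indicator ((\<Union>i<n. A i) \<inter> {0..1})" for n
      proof
        fix s
        have "disjoint_family_on A {..<n}" using union(1) by (auto simp: disjoint_family_on_def)
        then have "indicator (\<Union>i<n. A i) s = (\<Sum>i<n. indicator (A i) s :: complex)"
          by (simp add: indicator_UN_disjoint)
        then show "h n s = indicator ((\<Union>i<n. A i) \<inter> {0..1}) s"
          by (simp add: h_def indicator_inter_arith sum_distrib_right)
      qed
      have Ph: "?P (h n)" for n
      proof (induction n)
        case 0 then show ?case by (simp add: h_def)
      next
        case (Suc n)
        have "?P (\<lambda>s. h n s + indicator (A n \<inter> {0..1}) s)"
          using Suc union(3) by (intro add2 h_int int_ind borel_unit A) auto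
        then show ?case by (simp add: h_def)
      qed
      let ?g = "indicator ((\<Union>i. A i) \<inter> {0..1}) :: real \<Rightarrow> complex"
      have g_int: "integrable unit_leb ?g" by (intro int_ind borel_unit) auto
      have "(\<lambda>n. \<integral>s. cmod (?g s - h n s) \<partial>unit_leb) \<longlonglongrightarrow> (\<integral>s. 0 \<partial>unit_leb)"
      proof (rule integral_dominated_convergence [where w = "\<lambda>s. 1"])
        show "integrable unit_leb (\<lambda>s. 1 :: real)"
          using finite_measure.integrable_const [OF fin] .
        have [measurable]: "h n \<in> borel_measurable unit_leb" "?g \<in> borel_measurable unit_leb" for n
          using h_int g_int by auto
        show "(\<lambda>s. cmod (?g s - h n s)) \<in> borel_measurable unit_leb" for n by measurable
        show "AE s in unit_leb. norm (cmod (?g s - h n s)) \<le> 1" for n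
          by (auto simp: h_eq indicator_def)
        show "AE s in unit_leb. (\<lambda>n. cmod (?g s - h n s)) \<longlonglongrightarrow> 0"
        proof (rule AE_I2)
          fix s :: real
          have "\<forall>\<^sub>F n in sequentially. ?g s = h n s"
          proof (cases "\<exists>i. s \<in> A i")
            case True
            then obtain i where "s \<in> A i" ..
            then show ?thesis unfolding eventually_sequentially h_eq
              by (intro exI [of _ "Suc i"]) (auto simp: indicator_def)
          next
            case False
            then show ?thesis unfolding h_eq by (auto simp: indicator_def)
          qed
          then have "\<forall>\<^sub>F n in sequentially. cmod (?g s - h n s) = 0"
            by eventually_elim simp
          then show "(\<lambda>n. cmod (?g s - h n s)) \<longlonglongrightarrow> 0"
            by (rule tendsto_eventually)
        qed
      qed simp
      then show ?case
        using tendsto_integral_L1_closed [OF u h_int g_int Ph] by simp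
    qed
  qed
  show ?thesis
    using g
  proof (induction rule: integrable_induct)
    case (base A c)
    then have A: "A \<in> sets lebesgue" "A \<subseteq> {0..1}" by (auto simp: sets_restrict_space)
    obtain B N where B: "B \<in> sets borel" "negligible N" "B \<union> N = A" "B \<inter> N = {}"
    proof -
      from A(1) obtain B N N' where "A = B \<union> N" "N \<subseteq> N'" "N' \<in> null_sets lborel" "B \<in> sets lborel"
        by (auto elim: sets_completionE)
      then have "negligible (N - B)"
        by (meson Diff_subset negligible_iff_null_sets negligible_subset null_sets_completionI)
      then show ?thesis using that [of B "N - B"] \<open>A = B \<union> N\<close> \<open>B \<in> sets lborel\<close> by auto
    qed
    have "AE s in unit_leb. indicator (B \<inter> {0..1}) s * c = indicator A s *\<^sub>R c"
    proof -
      have "AE s in lebesgue. s \<notin> N"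
        using B(2) by (simp add: AE_not_in negligible_iff_null_sets)
      then have "AE s in unit_leb. s \<notin> N"
        by (subst AE_restrict_space_iff) (auto elim: eventually_mono)
      then show ?thesis
        using AE_space by eventually_elim (use B(3) in \<open>auto simp: indicator_def space_restrict_space\<close>)
    qed
    then show ?case
      by (rule ae [OF cmult [OF borel [OF B(1)]]])
        (use base(1) borel_unit [OF B(1)] in measurable)
  next
    case (add f g)
    then show ?case by (intro add2)
  next
    case (lim f s)
    have "(\<lambda>i. \<integral>x. cmod (f x - s i x) \<partial>unit_leb) \<longlonglongrightarrow> (\<integral>x. 0 \<partial>unit_leb)"
    proof (rule integral_dominated_convergence [where w = "\<lambda>x. 3 * cmod (f x)"])
      show "integrable unit_leb (\<lambda>x. 3 * cmod (f x))" using lim by auto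
      have [measurable]: "s n \<in> borel_measurable unit_leb" "f \<in> borel_measurable unit_leb" for n
        using lim by auto
      show "(\<lambda>x. cmod (f x - s n x)) \<in> borel_measurable unit_leb" for n by measurable
      show "AE x in unit_leb. norm (cmod (f x - s n x)) \<le> 3 * cmod (f x)" for n
      proof (rule AE_I2)
        fix x assume "x \<in> space unit_leb"
        then show "norm (cmod (f x - s n x)) \<le> 3 * cmod (f x)"
          using lim(3) [of x n] norm_triangle_ineq4 [of "f x" "s n x"] by simp
      qed
      show "AE x in unit_leb. (\<lambda>n. cmod (f x - s n x)) \<longlonglongrightarrow> 0"
      proof (rule AE_I2)
        fix x assume "x \<in> space unit_leb"
        then have "(\<lambda>n. cmod (f x - s n x)) \<longlonglongrightarrow> cmod (f x - f x)"
          by (intro tendsto_intros lim(2))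
        then show "(\<lambda>n. cmod (f x - s n x)) \<longlonglongrightarrow> 0" by simp
      qed
    qed simp
    then show ?case
      using tendsto_integral_L1_closed [OF u lim(1) lim(4) lim(5)] by simp
  qed
qed

section \<open>The pairing of essentially bounded with integrable functions\<close>

lemma integrable_vec_nth:
  assumes "integrable M (g :: 'a \<Rightarrow> complex ^ 'm::finite)" shows "integrable M (\<lambda>s. g s $ j)"
  using integrable_bounded_linear [OF bounded_linear_vec_nth assms] .

lemma bounded_linear_axis: "bounded_linear (axis j :: complex \<Rightarrow> complex ^ 'm::finite)"
proof -
  have "linear (axis j :: complex \<Rightarrow> complex ^ 'm)"
    by (rule linearI) (auto simp: axis_def vec_eq_iff)
  then show ?thesis by (rule linear_linear [THEN iffD2])
qed

lemma integrable_axis: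
  assumes "integrable M (g :: 'a \<Rightarrow> complex)" shows "integrable M (\<lambda>s. axis j (g s) :: complex ^ 'm::finite)"
  by (rule integrable_bounded_linear [OF bounded_linear_axis assms])

lemma cmod_le_l1norm: "cmod (v $ j) \<le> l1norm v"
  unfolding l1norm_def by (rule member_le_sum) auto

lemma cmod_rep_linf_le: "AE s in unit_leb. cmod (rep_linf f s $ j) \<le> norm f"
  using norm_linf_AE [of f] by eventually_elim (rule order_trans [OF cmod_le_l1norm])

lemma rep_linf_measurable [measurable]: "rep_linf f \<in> borel_measurable unit_leb"
  by (rule ess_bounded_measurable [OF ess_bounded_rep])

lemma vec_nth_measurable [measurable]:
  "(\<lambda>v. v $ j) \<in> borel_measurable (borel :: (complex ^ 'm::finite) measure)"
  by (intro borel_measurable_continuous_onI continuous_intros)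

lemma rep_linf_nth_measurable [measurable]: "(\<lambda>s. rep_linf f s $ j) \<in> borel_measurable unit_leb"
  by (rule measurable_compose [OF rep_linf_measurable vec_nth_measurable])

lemma rep_linf_scaleC: "AE s in unit_leb. rep_linf (a *\<^sub>C f) s = a *s rep_linf f s"
  unfolding scaleC_linf_def by (simp add: rep_abs_linf ess_bounded_scaleC ess_bounded_rep)

lemma rep_linf_zero: "AE s in unit_leb. rep_linf 0 s = 0"
  unfolding zero_linf_def by (simp add: rep_abs_linf ess_bounded_zero)

lemma integrable_pairing_component:
  assumes "integrable unit_leb g"
  shows "integrable unit_leb (\<lambda>s. rep_linf f s $ j * g s $ j)"
  by (rule integrable_bounded_mult(1) [OF _ cmod_rep_linf_le integrable_vec_nth [OF assms]]) simp

lemma linf_pairing_sum: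
  assumes "integrable unit_leb g"
  shows "linf_pairing f g = (\<Sum>j\<in>UNIV. \<integral>s. rep_linf f s $ j * g s $ j \<partial>unit_leb)"
  unfolding linf_pairing_def
  by (intro Bochner_Integration.integral_sum integrable_pairing_component assms)

lemma linf_pairing_axis:
  "linf_pairing f (\<lambda>s. axis j (g s)) = (\<integral>s. rep_linf f s $ j * g s \<partial>unit_leb)"
  unfolding linf_pairing_def axis_def by (simp add: if_distrib cong: if_cong)

lemma linf_pairing_cong_AE:
  assumes g: "integrable unit_leb g" and h: "h \<in> borel_measurable unit_leb"
    and eq: "AE s in unit_leb. rep_linf f s = h s"
  shows "linf_pairing f g = (\<integral>s. (\<Sum>j\<in>UNIV. h s $ j * g s $ j) \<partial>unit_leb)"
  unfolding linf_pairing_def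
proof (rule integral_cong_AE)
  have [measurable]: "\<And>j. (\<lambda>s. g s $ j) \<in> borel_measurable unit_leb"
    using integrable_vec_nth [OF g] by auto
  have [measurable]: "\<And>j. (\<lambda>s. h s $ j) \<in> borel_measurable unit_leb"
    by (rule measurable_compose [OF h vec_nth_measurable])
  show "(\<lambda>s. \<Sum>j\<in>UNIV. rep_linf f s $ j * g s $ j) \<in> borel_measurable unit_leb" by measurable
  show "(\<lambda>s. \<Sum>j\<in>UNIV. h s $ j * g s $ j) \<in> borel_measurable unit_leb" by measurable
  show "AE s in unit_leb. (\<Sum>j\<in>UNIV. rep_linf f s $ j * g s $ j) = (\<Sum>j\<in>UNIV. h s $ j * g s $ j)"
    using eq by eventually_elim simp
qed

lemma linf_pairing_add:
  assumes g: "integrable unit_leb g"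
  shows "linf_pairing (f + h) g = linf_pairing f g + linf_pairing h g"
proof -
  have "linf_pairing (f + h) g =
      (\<integral>s. (\<Sum>j\<in>UNIV. (rep_linf f s + rep_linf h s) $ j * g s $ j) \<partial>unit_leb)"
    by (rule linf_pairing_cong_AE [OF g _ rep_linf_add]) measurable
  also have "\<dots> = linf_pairing f g + linf_pairing h g"
    unfolding linf_pairing_def
    by (subst Bochner_Integration.integral_add [symmetric])
      (auto intro!: Bochner_Integration.integrable_sum integrable_pairing_component g
        simp: distrib_right sum.distrib)
  finally show ?thesis .
qed

lemma linf_pairing_scaleC:
  assumes g: "integrable unit_leb g"
  shows "linf_pairing (a *\<^sub>C f) g = a * linf_pairing f g"
proof -
  have "linf_pairing (a *\<^sub>C f) g = (\<integral>s. (\<Sum>j\<in>UNIV. (a *s rep_linf f s) $ j * g s $ j) \<partial>unit_leb)"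
    by (rule linf_pairing_cong_AE [OF g _ rep_linf_scaleC])
      (rule measurable_compose [OF rep_linf_measurable scaleC_measurable])
  also have "\<dots> = a * linf_pairing f g"
    unfolding linf_pairing_def
    by (simp add: mult.assoc sum_distrib_left [symmetric])
  finally show ?thesis .
qed

lemma scaleR_linf_eq_scaleC: "r *\<^sub>R (f :: 'm::finite linf) = complex_of_real r *\<^sub>C f"
  by (simp add: scaleC_of_real)

lemma linf_pairing_scaleR:
  "integrable unit_leb g \<Longrightarrow> linf_pairing (r *\<^sub>R f) g = complex_of_real r * linf_pairing f g"
  by (simp add: scaleR_linf_eq_scaleC linf_pairing_scaleC)

lemma linf_pairing_diff:
  assumes g: "integrable unit_leb g"
  shows "linf_pairing (f - h) g = linf_pairing f g - linf_pairing h g"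
  using linf_pairing_add [OF g, of f "(- 1) *\<^sub>R h"] linf_pairing_scaleR [OF g, of "- 1" h] by simp

lemma linf_pairing_zero: "integrable unit_leb g \<Longrightarrow> linf_pairing 0 g = 0"
  using linf_pairing_scaleR [of g 0 0] by simp

lemma linf_pairing_bound:
  assumes g: "integrable unit_leb g"
  shows "cmod (linf_pairing f g) \<le> norm f * (\<Sum>j\<in>UNIV. \<integral>s. cmod (g s $ j) \<partial>unit_leb)"
  unfolding linf_pairing_sum [OF g] sum_distrib_left
  by (intro sum_norm_le integrable_bounded_mult(2) cmod_rep_linf_le integrable_vec_nth g) simp

lemma finite_unit_leb: "finite_measure unit_leb"
  by (rule finite_measureI) (simp add: emeasure_restrict_space)

lemma Icc_sets_unit_leb: "0 \<le> a \<Longrightarrow> b \<le> 1 \<Longrightarrow> {a..b} \<in> sets unit_leb"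
  by (auto simp: sets_restrict_space intro!: image_eqI [of _ _ "{a..b}"])

lemma integrable_indicator_Icc:
  assumes "0 \<le> a" "b \<le> 1"
  shows "integrable unit_leb (indicator {a..b} :: real \<Rightarrow> complex)"
  using Icc_sets_unit_leb [OF assms]
  by (intro finite_measure.integrable_const_bound [OF finite_unit_leb, where B = 1])
    (auto simp: indicator_def)

text \<open>The integral of the component \<open>j\<close> of \<open>f\<close> over \<open>[a, b]\<close>, for \<open>0 \<le> a\<close> and \<open>b \<le> 1\<close>.\<close>

abbreviation interval_integral :: "'m::finite linf \<Rightarrow> 'm \<Rightarrow> real \<Rightarrow> real \<Rightarrow> complex" where
  "interval_integral f j a b \<equiv> \<integral>s. rep_linf f s $ j * indicator {a..b} s \<partial>unit_leb"

text \<open>Testing against intervals suffices for weak-star convergence of bounded families.\<close>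

lemma linf_pairing_tendsto_intervals:
  assumes bdd: "\<forall>\<^sub>F x in F. norm (h x) \<le> K"
    and conv: "\<And>j a b. 0 \<le> a \<Longrightarrow> a \<le> b \<Longrightarrow> b \<le> 1 \<Longrightarrow>
      ((\<lambda>x. interval_integral (h x) j a b) \<longlongrightarrow>
        interval_integral l j a b) F"
    and g: "integrable unit_leb g"
  shows "((\<lambda>x. linf_pairing (h x) g) \<longlongrightarrow> linf_pairing l g) F"
proof -
  have "((\<lambda>x. \<integral>s. rep_linf (h x) s $ j * g s $ j \<partial>unit_leb) \<longlongrightarrow>
      (\<integral>s. rep_linf l s $ j * g s $ j \<partial>unit_leb)) F" for j
  proof -
    let ?u = "\<lambda>x s. rep_linf (h x) s $ j - rep_linf l s $ j"
    have diff: "(\<integral>s. ?u x s * k s \<partial>unit_leb) =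
        (\<integral>s. rep_linf (h x) s $ j * k s \<partial>unit_leb) - (\<integral>s. rep_linf l s $ j * k s \<partial>unit_leb)"
      if "integrable unit_leb k" for k x
      unfolding left_diff_distrib
      by (intro Bochner_Integration.integral_diff integrable_bounded_mult(1) [OF _ cmod_rep_linf_le that]) simp_all
    have "((\<lambda>x. \<integral>s. ?u x s * g s $ j \<partial>unit_leb) \<longlongrightarrow> 0) F"
    proof (rule tendsto_integral_intervals [where K = "K + norm l"])
      show "\<forall>\<^sub>F x in F. ?u x \<in> borel_measurable unit_leb \<and>
          (AE s in unit_leb. cmod (?u x s) \<le> K + norm l)"
        using bdd
      proof eventually_elim
        case (elim x)
        have "AE s in unit_leb. cmod (?u x s) \<le> K + norm l"
          using cmod_rep_linf_le [of "h x" j] cmod_rep_linf_le [of l j]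
          by eventually_elim (use elim norm_triangle_ineq4 order_trans in \<open>smt (verit)\<close>)
        then show ?case by simp
      qed
      show "((\<lambda>x. \<integral>s. ?u x s * indicator {a..b} s \<partial>unit_leb) \<longlongrightarrow> 0) F"
        if "0 \<le> a" "a \<le> b" "b \<le> 1" for a b
      proof -
        have "integrable unit_leb (indicator {a..b} :: real \<Rightarrow> complex)"
          using that by (intro integrable_indicator_Icc)
        from diff [OF this] show ?thesis
          using conv [OF that, of j] by (simp add: LIM_zero_iff)
      qed
    qed (rule integrable_vec_nth [OF g])
    then show ?thesis unfolding diff [OF integrable_vec_nth [OF g]] by (simp add: LIM_zero_iff)
  qed
  then show ?thesis
    unfolding linf_pairing_sum [OF g] by (intro tendsto_sum)
qed

section \<open>The weak-star topology\<close>

lemma topspace_weak_star [simp]: "topspace weak_star = UNIV"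
  unfolding weak_star_def topology_generated_by_topspace by (auto intro!: exI [of _ UNIV] exI [of _ "\<lambda>s. 0"])

lemma openin_weak_star_vimage:
  "integrable unit_leb g \<Longrightarrow> open U \<Longrightarrow> openin weak_star ((\<lambda>f. linf_pairing f g) -` U)"
  unfolding weak_star_def by (rule topology_generated_by_Basis) blast

lemma continuous_map_pairing:
  "integrable unit_leb g \<Longrightarrow> continuous_map weak_star euclidean (\<lambda>f. linf_pairing f g)"
  using openin_weak_star_vimage by (auto simp: continuous_map vimage_def)

lemma continuous_map_into_weak_star:
  fixes h :: "'x \<Rightarrow> 'm::finite linf"
  assumes "\<And>g. integrable unit_leb g \<Longrightarrow> continuous_map X euclidean (\<lambda>x. linf_pairing (h x) g)"
  shows "continuous_map X weak_star h"
  unfolding weak_star_def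
proof (rule continuous_on_generated_topo)
  fix U :: "'m linf set"
  assume *: "U \<in> {(\<lambda>f :: 'm linf. linf_pairing f g) -` U |g U. integrable unit_leb g \<and> open U}"
  show "openin X (h -` U \<inter> topspace X)"
  proof -
    from * obtain g V where "U = (\<lambda>f. linf_pairing f g) -` V" "integrable unit_leb g" "open V"
      by blast
    then show ?thesis
      using openin_continuous_map_preimage [OF assms, of g V] by (simp add: vimage_def Int_def conj_commute)
  qed
next
  have "\<Union> {(\<lambda>f :: 'm linf. linf_pairing f g) -` U |g U. integrable unit_leb g \<and> open U} = UNIV"
    using topspace_weak_star unfolding weak_star_def topology_generated_by_topspace .
  then show "h ` topspace X \<subseteq> \<Union> {(\<lambda>f. linf_pairing f g) -` U |g U. integrable unit_leb g \<and> open U}"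
    by simp
qed

text \<open>The basic neighbourhoods of \<open>f\<close>, for finite sets \<open>G\<close> of integrable functions and \<open>r > 0\<close>.\<close>

definition weak_star_ball :: "(real \<Rightarrow> complex ^ 'm::finite) set \<Rightarrow> real \<Rightarrow> 'm linf \<Rightarrow> 'm linf set" where
  "weak_star_ball G r f = {h. \<forall>g\<in>G. cmod (linf_pairing h g - linf_pairing f g) < r}"

lemma weak_star_ball_subset:
  assumes "openin weak_star U" and "f \<in> U"
  obtains G r where "finite G" "\<And>g. g \<in> G \<Longrightarrow> integrable unit_leb g" "0 < r"
    "weak_star_ball G r f \<subseteq> U"
proof -
  have "generate_topology_on {(\<lambda>f. linf_pairing f g) -` U | g U. integrable unit_leb g \<and> open U} U"
    using assms(1) unfolding weak_star_def by (rule openin_topology_generated_by)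
  then have "\<exists>G r. finite G \<and> (\<forall>g\<in>G. integrable unit_leb g) \<and> 0 < r \<and> weak_star_ball G r f \<subseteq> U"
    using assms(2)
  proof (induction)
    case Empty
    then show ?case by simp
  next
    case (Int a b)
    then obtain G r H q where
      "finite G" "\<forall>g\<in>G. integrable unit_leb g" "0 < r" "weak_star_ball G r f \<subseteq> a"
      "finite H" "\<forall>g\<in>H. integrable unit_leb g" "0 < q" "weak_star_ball H q f \<subseteq> b"
      by auto
    then show ?case
      by (intro exI [of _ "G \<union> H"] exI [of _ "min r q"]) (auto simp: weak_star_ball_def)
  next
    case (UN K)
    then obtain k where k: "k \<in> K" "f \<in> k" by blast
    with UN.IH obtain G r where "finite G" "\<forall>g\<in>G. integrable unit_leb g" "0 < r"
      "weak_star_ball G r f \<subseteq> k" by meson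
    with k show ?case by blast
  next
    case (Basis s)
    then obtain g V where s: "s = (\<lambda>f. linf_pairing f g) -` V" "integrable unit_leb g" "open V" by blast
    with Basis have "linf_pairing f g \<in> V" by simp
    with s(3) obtain r where "0 < r" "ball (linf_pairing f g) r \<subseteq> V"
      by (meson openE)
    with s show ?case
      by (intro exI [of _ "{g}"] exI [of _ r])
        (auto simp: weak_star_ball_def dist_norm norm_minus_commute subset_eq)
  qed
  then show ?thesis using that by blast
qed

lemma openin_weak_star_ball:
  assumes "finite G" "\<And>g. g \<in> G \<Longrightarrow> integrable unit_leb g"
  shows "openin weak_star (weak_star_ball G r f)"
proof -
  have "openin weak_star {h \<in> topspace weak_star. linf_pairing h g \<in> ball (linf_pairing f g) r}"
    if "g \<in> G" for g
    by (rule openin_continuous_map_preimage [OF continuous_map_pairing]) (use assms that in auto)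
  then have "openin weak_star (topspace weak_star \<inter>
      \<Inter> ((\<lambda>g. {h \<in> topspace weak_star. linf_pairing h g \<in> ball (linf_pairing f g) r}) ` G))"
    using openin_topspace [of weak_star]
    by (cases "G = {}") (auto intro!: openin_Int openin_Inter assms simp del: topspace_weak_star)
  also have "topspace weak_star \<inter>
      \<Inter> ((\<lambda>g. {h \<in> topspace weak_star. linf_pairing h g \<in> ball (linf_pairing f g) r}) ` G) =
      weak_star_ball G r f"
    by (auto simp: weak_star_ball_def dist_norm norm_minus_commute)
  finally show ?thesis .
qed

lemma limitin_weak_star_iff:
  fixes h :: "'x \<Rightarrow> 'm::finite linf"
  shows
  "limitin weak_star h l F \<longleftrightarrow>
    (\<forall>g. integrable unit_leb g \<longrightarrow> ((\<lambda>x. linf_pairing (h x) g) \<longlongrightarrow> linf_pairing l g) F)"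
proof (intro iffI allI impI)
  fix g :: "real \<Rightarrow> complex ^ 'm" assume "limitin weak_star h l F" "integrable unit_leb g"
  then show "((\<lambda>x. linf_pairing (h x) g) \<longlongrightarrow> linf_pairing l g) F"
    using continuous_map_limit [OF continuous_map_pairing [of g], of h l F] by (simp add: o_def)
next
  assume *: "\<forall>g. integrable unit_leb g \<longrightarrow> ((\<lambda>x. linf_pairing (h x) g) \<longlongrightarrow> linf_pairing l g) F"
  show "limitin weak_star h l F"
    unfolding limitin_def
  proof (intro conjI allI impI)
    fix U assume "openin weak_star U \<and> l \<in> U"
    then obtain G r where G: "finite G" "\<And>g. g \<in> G \<Longrightarrow> integrable unit_leb g" "0 < r"
      "weak_star_ball G r l \<subseteq> U"
      using weak_star_ball_subset by metis
    have "\<forall>\<^sub>F x in F. \<forall>g\<in>G. dist (linf_pairing (h x) g) (linf_pairing l g) < r"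
      using G * by (intro eventually_ball_finite ballI tendstoD) auto
    then show "\<forall>\<^sub>F x in F. h x \<in> U"
      by eventually_elim (use G(4) in \<open>auto simp: weak_star_ball_def dist_norm\<close>)
  qed simp
qed

lemma convex_weak_star_ball:
  assumes G: "\<And>g. g \<in> G \<Longrightarrow> integrable unit_leb g"
  shows "convex (weak_star_ball G r f)"
proof -
  have "convex {h. cmod (linf_pairing h g - linf_pairing f g) < r}" if "g \<in> G" for g
  proof -
    have "linear (\<lambda>h. linf_pairing h g)"
      by (rule linearI)
        (simp_all add: linf_pairing_add linf_pairing_scaleR G that scaleR_conv_of_real)
    then have "convex ((\<lambda>h. linf_pairing h g) -` ball (linf_pairing f g) r)"
      by (rule convex_linear_vimage) simp
    then show ?thesis by (simp add: vimage_def dist_norm norm_minus_commute)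
  qed
  then have "convex (\<Inter>g\<in>G. {h. cmod (linf_pairing h g - linf_pairing f g) < r})"
    by (intro convex_INT)
  also have "(\<Inter>g\<in>G. {h. cmod (linf_pairing h g - linf_pairing f g) < r}) = weak_star_ball G r f"
    by (auto simp: weak_star_ball_def)
  finally show ?thesis .
qed

lemma locally_convex_weak_star: "locally_convex_topology (weak_star :: 'm::finite linf topology)"
  unfolding locally_convex_topology_def
proof (intro conjI allI impI)
  show "continuous_map (prod_topology weak_star weak_star) (weak_star :: 'm linf topology) (\<lambda>(x, y). x + y)"
  proof (rule continuous_map_into_weak_star)
    fix g :: "real \<Rightarrow> complex ^ 'm" assume g: "integrable unit_leb g"
    have "continuous_map (prod_topology weak_star weak_star) euclidean
        (\<lambda>p. linf_pairing (fst p) g + linf_pairing (snd p) g)"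
      using continuous_map_compose [OF continuous_map_fst continuous_map_pairing [OF g]]
        continuous_map_compose [OF continuous_map_snd continuous_map_pairing [OF g]]
      by (intro continuous_map_add) (auto simp: o_def)
    then show "continuous_map (prod_topology weak_star weak_star) euclidean
        (\<lambda>x. linf_pairing (case x of (x, y) \<Rightarrow> x + y) g)"
      by (simp add: case_prod_beta linf_pairing_add [OF g])
  qed
  show "continuous_map (prod_topology euclidean weak_star) (weak_star :: 'm linf topology) (\<lambda>(a, x). a *\<^sub>C x)"
  proof (rule continuous_map_into_weak_star)
    fix g :: "real \<Rightarrow> complex ^ 'm" assume g: "integrable unit_leb g"
    have "continuous_map (prod_topology euclidean weak_star) euclidean
        (\<lambda>p. fst p * linf_pairing (snd p) g)"
      using continuous_map_compose [OF continuous_map_snd [of euclidean] continuous_map_pairing [OF g]]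
        continuous_map_fst [of euclidean "weak_star :: 'm linf topology"]
      unfolding continuous_map_atin by (auto intro!: tendsto_mult simp: o_def)
    then show "continuous_map (prod_topology euclidean weak_star) euclidean
        (\<lambda>x. linf_pairing (case x of (a, x) \<Rightarrow> a *\<^sub>C x) g)"
      by (simp add: case_prod_beta linf_pairing_scaleC [OF g])
  qed
  fix U :: "'m linf set" assume "openin weak_star U \<and> 0 \<in> U"
  then obtain G r where G: "finite G" "\<And>g. g \<in> G \<Longrightarrow> integrable unit_leb g" "0 < r"
    "weak_star_ball G r 0 \<subseteq> U"
    using weak_star_ball_subset by metis
  then show "\<exists>V. openin weak_star V \<and> convex V \<and> 0 \<in> V \<and> V \<subseteq> U"
    using openin_weak_star_ball [OF G(1,2)] convex_weak_star_ball [OF G(2)]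
    by (intro exI [of _ "weak_star_ball G r 0"]) (auto simp: weak_star_ball_def)
qed simp

lemma weak_star_coarser:
  assumes "openin weak_star U" shows "open (U :: 'm::finite linf set)"
proof -
  have "continuous_map euclidean weak_star (\<lambda>f :: 'm linf. f)"
  proof (rule continuous_map_into_weak_star)
    fix g :: "real \<Rightarrow> complex ^ 'm" assume g: "integrable unit_leb g"
    have "bounded_linear (\<lambda>f. linf_pairing f g)"
      by (rule bounded_linear_intro [OF _ _ linf_pairing_bound [OF g]])
        (simp_all add: linf_pairing_add linf_pairing_scaleR g scaleR_conv_of_real)
    then show "continuous_map euclidean euclidean (\<lambda>f. linf_pairing f g)"
      by (simp add: linear_continuous_on)
  qed
  then have "openin euclidean {f \<in> topspace euclidean. f \<in> U}"
    using assms by (rule openin_continuous_map_preimage)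
  then show ?thesis by simp
qed

lemma borel_measurable_vecI:
  fixes h :: "'a \<Rightarrow> complex ^ 'm::finite"
  assumes "\<And>j. (\<lambda>s. h s $ j) \<in> borel_measurable M"
  shows "h \<in> borel_measurable M"
proof -
  have "axis j \<in> borel_measurable (borel :: complex measure)" for j :: 'm
    by (intro borel_measurable_continuous_onI linear_continuous_on bounded_linear_axis)
  then have "(\<lambda>s. \<Sum>j\<in>UNIV. axis j (h s $ j) :: complex ^ 'm) \<in> borel_measurable M"
    by (intro borel_measurable_sum measurable_compose [OF assms])
  also have "(\<lambda>s. \<Sum>j\<in>UNIV. axis j (h s $ j)) = h"
    by (rule ext) (simp add: vec_eq_iff axis_def if_distrib cong: if_cong)
  finally show ?thesis .
qed

section \<open>Weak-star sequential completeness\<close>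

text \<open>
  The set function \<open>m A\<close> in the proof is the limit of the integrals over \<open>A\<close>. It is countably additive
  because it is finitely additive and dominated by a multiple of the finite measure \<open>M\<close>.
\<close>

lemma density_of_setwise_limit_nonneg:
  fixes u :: "nat \<Rightarrow> 'a \<Rightarrow> real"
  assumes M: "finite_measure M"
    and u: "\<And>n. u n \<in> borel_measurable M" "\<And>n. AE s in M. 0 \<le> u n s \<and> u n s \<le> K"
    and conv: "\<And>A. A \<in> sets M \<Longrightarrow> convergent (\<lambda>n. \<integral>s. u n s * indicator A s \<partial>M)"
  shows "\<exists>v. integrable M v \<and>
    (\<forall>A\<in>sets M. (\<lambda>n. \<integral>s. u n s * indicator A s \<partial>M) \<longlonglongrightarrow> (\<integral>s. v s * indicator A s \<partial>M))"
proof -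
  interpret finite_measure M by (rule M)
  define m where "m A = lim (\<lambda>n. \<integral>s. u n s * indicator A s \<partial>M)" for A
  have m: "(\<lambda>n. \<integral>s. u n s * indicator A s \<partial>M) \<longlonglongrightarrow> m A" if "A \<in> sets M" for A
    unfolding m_def using conv [OF that] by (simp add: convergent_LIMSEQ_iff)
  have int: "integrable M (\<lambda>s. u n s * indicator A s)" if [measurable]: "A \<in> sets M" for A n
  proof (rule integrable_const_bound)
    show "AE s in M. norm (u n s * indicator A s) \<le> \<bar>K\<bar>"
      using u(2) [of n] by eventually_elim (auto simp: indicator_def)
    show "(\<lambda>s. u n s * indicator A s) \<in> borel_measurable M"
      using u(1) [of n] by measurable
  qed
  have m_nonneg: "0 \<le> m A" if A: "A \<in> sets M" for A
  proof (rule LIMSEQ_le_const [OF m [OF A]], intro exI allI impI)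
    show "0 \<le> (\<integral>s. u n s * indicator A s \<partial>M)" for n
      using u(2) [of n] by (intro integral_nonneg_AE) (auto elim!: eventually_mono)
  qed
  have m_le: "m A \<le> K * measure M A" if A: "A \<in> sets M" for A
  proof (rule LIMSEQ_le_const2 [OF m [OF A]], intro exI allI impI)
    fix n
    have "(\<integral>s. u n s * indicator A s \<partial>M) \<le> (\<integral>s. K * indicator A s \<partial>M)"
    proof (intro integral_mono_AE int A)
      show "integrable M (\<lambda>s. K * indicator A s)" using A by (auto simp: less_top [symmetric])
      show "AE s in M. u n s * indicator A s \<le> K * indicator A s"
        using u(2) [of n] by eventually_elim (simp add: mult_right_mono)
    qed
    also have "\<dots> = K * measure M A" using A by (simp add: Int_absorb2 sets.sets_into_space)
    finally show "(\<integral>s. u n s * indicator A s \<partial>M) \<le> K * measure M A" .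
  qed
  have m_add: "m (A \<union> B) = m A + m B" if A: "A \<in> sets M" and B: "B \<in> sets M" and "A \<inter> B = {}" for A B
  proof (rule LIMSEQ_unique [OF m])
    show "A \<union> B \<in> sets M" using A B by auto
    have "(\<integral>s. u n s * indicator (A \<union> B) s \<partial>M) =
        (\<integral>s. u n s * indicator A s \<partial>M) + (\<integral>s. u n s * indicator B s \<partial>M)" for n
      by (subst Bochner_Integration.integral_add [OF int [OF A] int [OF B], symmetric])
        (intro Bochner_Integration.integral_cong, use \<open>A \<inter> B = {}\<close> in \<open>auto simp: indicator_def\<close>)
    then show "(\<lambda>n. \<integral>s. u n s * indicator (A \<union> B) s \<partial>M) \<longlonglongrightarrow> m A + m B"
      using tendsto_add [OF m [OF A] m [OF B]] by simp
  qed
  define \<nu> where "\<nu> = measure_of (space M) (sets M) (\<lambda>A. ennreal (m A))"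
  have sets_\<nu> [simp]: "sets \<nu> = sets M" and space_\<nu> [simp]: "space \<nu> = space M"
    by (simp_all add: \<nu>_def)
  have em: "emeasure \<nu> A = ennreal (m A)" if "A \<in> sets M" for A
  proof (rule emeasure_measure_of [OF \<nu>_def])
    show "positive (sets \<nu>) (\<lambda>A. ennreal (m A))"
    proof -
      have "m {} = 0" using m_le [of "{}"] m_nonneg [of "{}"] by (intro antisym) auto
      then show ?thesis by (simp add: positive_def)
    qed
    show "countably_additive (sets \<nu>) (\<lambda>A. ennreal (m A))"
    proof (rule countably_additiveI)
      fix A :: "nat \<Rightarrow> 'a set"
      assume A: "range A \<subseteq> sets \<nu>" "disjoint_family A" "\<Union> (range A) \<in> sets \<nu>"
      then have [measurable]: "\<And>i. A i \<in> sets M" by auto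
      define R where "R k = \<Union> (range A) - (\<Union>i<k. A i)" for k :: nat
      have [measurable]: "R k \<in> sets M" for k unfolding R_def by measurable
      have R_Suc: "R k = A k \<union> R (Suc k)" "A k \<inter> R (Suc k) = {}" for k
      proof -
        have "A i \<inter> A k = {}" if "i < k" for i
          using disjoint_family_onD [OF A(2), of i k] that by simp
        then show "R k = A k \<union> R (Suc k)" "A k \<inter> R (Suc k) = {}"
          by (fastforce simp: R_def lessThan_Suc)+
      qed
      have split_sum: "f (\<Union> (range A)) = (\<Sum>i<k. f (A i)) + f (R k)"
        if "\<And>B C. B \<in> sets M \<Longrightarrow> C \<in> sets M \<Longrightarrow> B \<inter> C = {} \<Longrightarrow> f (B \<union> C) = f B + f C"
        for f :: "'a set \<Rightarrow> real" and k
      proof (induction k)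
        case 0 then show ?case by (simp add: R_def)
      next
        case (Suc k)
        have "f (R k) = f (A k) + f (R (Suc k))"
          by (subst R_Suc(1)) (rule that, use R_Suc(2) in auto)
        with Suc show ?case by simp
      qed
      have meas: "measure M (\<Union> (range A)) = (\<Sum>i<k. measure M (A i)) + measure M (R k)" for k
        by (rule split_sum) (rule finite_measure_Union)
      have "(\<lambda>k. measure M (\<Union> (range A)) - (\<Sum>i<k. measure M (A i))) \<longlonglongrightarrow>
          measure M (\<Union> (range A)) - measure M (\<Union> (range A))"
        using A by (intro tendsto_diff tendsto_const finite_measure_UNION [unfolded sums_def]) auto
      moreover have "measure M (\<Union> (range A)) - (\<Sum>i<k. measure M (A i)) = measure M (R k)" for k
        using meas [of k] by linarith
      ultimately have "(\<lambda>k. K * measure M (R k)) \<longlonglongrightarrow> 0"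
        by (intro tendsto_mult_right_zero) (simp only: diff_self)
      then have "(\<lambda>k. m (R k)) \<longlonglongrightarrow> 0"
        by (rule tendsto_sandwich [OF _ _ tendsto_const, rotated 2]) (intro always_eventually allI m_nonneg m_le; simp)+
      then have "(\<lambda>k. m (\<Union> (range A)) - m (R k)) \<longlonglongrightarrow> m (\<Union> (range A)) - 0"
        by (intro tendsto_intros)
      moreover have "m (\<Union> (range A)) - m (R k) = (\<Sum>i<k. m (A i))" for k
        using split_sum [of m k, OF m_add] by linarith
      ultimately have "(\<lambda>i. m (A i)) sums m (\<Union> (range A))"
        unfolding sums_def by (simp only: diff_zero)
      then show "(\<Sum>i. ennreal (m (A i))) = ennreal (m (\<Union> (range A)))"
        by (intro sums_unique [symmetric]) (simp add: sums_ennreal m_nonneg)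
    qed
  qed (use that sets.sets_into_space in auto)
  have "absolutely_continuous M \<nu>"
    unfolding absolutely_continuous_def
  proof
    fix N assume "N \<in> null_sets M"
    then have "N \<in> sets M" "measure M N = 0" by (auto simp: measure_def)
    with m_le [of N] show "N \<in> null_sets \<nu>" by (auto simp: em intro!: null_setsI ennreal_neg)
  qed
  then obtain f where f [measurable]: "f \<in> borel_measurable M" and dens: "density M f = \<nu>"
    using Radon_Nikodym [of \<nu>] by auto
  have nn: "(\<integral>\<^sup>+s. f s * indicator A s \<partial>M) = ennreal (m A)" if "A \<in> sets M" for A
    using emeasure_density [OF f that] em [OF that] dens by simp
  have "(\<integral>\<^sup>+s. f s \<partial>M) = ennreal (m (space M))"
    using nn [of "space M"] by (simp cong: nn_integral_cong)
  then have fin: "AE s in M. f s \<noteq> \<infinity>"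
    by (intro nn_integral_PInf_AE) auto
  have v: "has_bochner_integral M (\<lambda>s. enn2real (f s) * indicator A s) (m A)" if [measurable]: "A \<in> sets M" for A
  proof (rule has_bochner_integral_nn_integral)
    have "(\<integral>\<^sup>+s. ennreal (enn2real (f s) * indicator A s) \<partial>M) = (\<integral>\<^sup>+s. f s * indicator A s \<partial>M)"
      using fin by (intro nn_integral_cong_AE)
        (auto elim!: eventually_mono simp: indicator_def less_top)
    then show "(\<integral>\<^sup>+s. ennreal (enn2real (f s) * indicator A s) \<partial>M) = ennreal (m A)"
      by (simp add: nn)
  qed (auto simp: m_nonneg)
  show ?thesis
  proof (intro exI conjI ballI)
    have "integrable M (\<lambda>s. enn2real (f s) * indicator (space M) s)"
      using v [of "space M"] by (auto intro: integrable.intros)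
    then show "integrable M (\<lambda>s. enn2real (f s))"
      by (simp cong: Bochner_Integration.integrable_cong)
    show "(\<lambda>n. \<integral>s. u n s * indicator A s \<partial>M) \<longlonglongrightarrow> (\<integral>s. enn2real (f s) * indicator A s \<partial>M)"
      if "A \<in> sets M" for A
      using m [OF that] has_bochner_integral_integral_eq [OF v [OF that]] by simp
  qed
qed

lemma density_of_setwise_limit_real:
  fixes u :: "nat \<Rightarrow> 'a \<Rightarrow> real"
  assumes M: "finite_measure M"
    and u: "\<And>n. u n \<in> borel_measurable M" "\<And>n. AE s in M. \<bar>u n s\<bar> \<le> K"
    and conv: "\<And>A. A \<in> sets M \<Longrightarrow> convergent (\<lambda>n. \<integral>s. u n s * indicator A s \<partial>M)"
  shows "\<exists>v. integrable M v \<and>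
    (\<forall>A\<in>sets M. (\<lambda>n. \<integral>s. u n s * indicator A s \<partial>M) \<longlonglongrightarrow> (\<integral>s. v s * indicator A s \<partial>M))"
proof -
  interpret finite_measure M by (rule M)
  have int: "integrable M (\<lambda>s. u n s * indicator A s)" if [measurable]: "A \<in> sets M" for A n
  proof (rule integrable_const_bound)
    show "AE s in M. norm (u n s * indicator A s) \<le> \<bar>K\<bar>"
      using u(2) [of n] by eventually_elim (auto simp: indicator_def)
    show "(\<lambda>s. u n s * indicator A s) \<in> borel_measurable M"
      using u(1) [of n] by measurable
  qed
  have shift: "(\<integral>s. (f s + c) * indicator A s \<partial>M) = (\<integral>s. f s * indicator A s \<partial>M) + c * measure M A"
    if A: "A \<in> sets M" and f: "integrable M (\<lambda>s. f s * indicator A s)" for f :: "'a \<Rightarrow> real" and A c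
    using A f by (simp add: distrib_right Int_absorb2 sets.sets_into_space less_top [symmetric])
  have "\<exists>v. integrable M v \<and> (\<forall>A\<in>sets M.
      (\<lambda>n. \<integral>s. (u n s + K) * indicator A s \<partial>M) \<longlonglongrightarrow> (\<integral>s. v s * indicator A s \<partial>M))"
  proof (rule density_of_setwise_limit_nonneg [OF M, of _ "2 * K"])
    show "(\<lambda>s. u n s + K) \<in> borel_measurable M" for n using u(1) [of n] by measurable
    show "AE s in M. 0 \<le> u n s + K \<and> u n s + K \<le> 2 * K" for n
      using u(2) [of n] by eventually_elim auto
    show "convergent (\<lambda>n. \<integral>s. (u n s + K) * indicator A s \<partial>M)" if "A \<in> sets M" for A
      unfolding shift [OF that int [OF that]] using conv [OF that] by (intro convergent_add convergent_const)
  qed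
  then obtain v where v: "integrable M v" "\<And>A. A \<in> sets M \<Longrightarrow>
      (\<lambda>n. \<integral>s. (u n s + K) * indicator A s \<partial>M) \<longlonglongrightarrow> (\<integral>s. v s * indicator A s \<partial>M)" by blast
  show ?thesis
  proof (intro exI conjI ballI)
    show "integrable M (\<lambda>s. v s + - K)" using v(1) by auto
    show "(\<lambda>n. \<integral>s. u n s * indicator A s \<partial>M) \<longlonglongrightarrow> (\<integral>s. (v s + - K) * indicator A s \<partial>M)"
      if A: "A \<in> sets M" for A
    proof -
      have "integrable M (\<lambda>s. v s * indicator A s)"
        using integrable_real_mult_indicator [OF A v(1)] by (simp add: mult.commute)
      from tendsto_diff [OF v(2) [OF A] tendsto_const [of "K * measure M A"]] show ?thesis
        unfolding shift [OF A int [OF A]] shift [OF A \<open>integrable M (\<lambda>s. v s * indicator A s)\<close>] by simp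
    qed
  qed
qed

text \<open>
  By the averaging theorem the density inherits the bound of the \<open>u n\<close>.
\<close>

lemma density_of_setwise_limit:
  fixes u :: "nat \<Rightarrow> 'a \<Rightarrow> complex"
  assumes M: "finite_measure M"
    and u: "\<And>n. u n \<in> borel_measurable M" "\<And>n. AE s in M. cmod (u n s) \<le> K"
    and conv: "\<And>A. A \<in> sets M \<Longrightarrow> convergent (\<lambda>n. \<integral>s. u n s * indicator A s \<partial>M)"
  shows "\<exists>v. v \<in> borel_measurable M \<and> (AE s in M. cmod (v s) \<le> K) \<and>
    (\<forall>A\<in>sets M. (\<lambda>n. \<integral>s. u n s * indicator A s \<partial>M) \<longlonglongrightarrow> (\<integral>s. v s * indicator A s \<partial>M))"
proof -
  interpret finite_measure M by (rule M)
  have ind: "integrable M (indicator A :: 'a \<Rightarrow> complex)" if "A \<in> sets M" for A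
    using that by (intro integrable_const_bound [where B = 1]) (auto simp: indicator_def)
  have cmod_ind: "cmod (indicator A s) = indicator A s" for A and s :: 'a by (auto simp: indicator_def)
  have Re_ind: "Re (z * indicator A s) = Re z * indicator A s" "Im (z * indicator A s) = Im z * indicator A s"
    for z A and s :: 'a by (auto simp: indicator_def)
  have int: "integrable M (\<lambda>s. u n s * indicator A s)" if "A \<in> sets M" for A n
    by (rule integrable_bounded_mult(1) [OF u ind [OF that]])
  have "\<exists>v. integrable M v \<and> (\<forall>A\<in>sets M.
      (\<lambda>n. \<integral>s. Re (u n s) * indicator A s \<partial>M) \<longlonglongrightarrow> (\<integral>s. v s * indicator A s \<partial>M))"
  proof (rule density_of_setwise_limit_real [OF M])
    show "(\<lambda>s. Re (u n s)) \<in> borel_measurable M" for n using u(1) [of n] by measurable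
    show "AE s in M. \<bar>Re (u n s)\<bar> \<le> K" for n
      using u(2) [of n] by eventually_elim (rule order_trans [OF abs_Re_le_cmod])
    show "convergent (\<lambda>n. \<integral>s. Re (u n s) * indicator A s \<partial>M)" if "A \<in> sets M" for A
      using conv [OF that] unfolding Re_ind [symmetric] integral_Re [OF int [OF that]]
      by (auto simp: convergent_def intro: tendsto_Re)
  qed
  then obtain v where v: "integrable M v" "\<And>A. A \<in> sets M \<Longrightarrow>
      (\<lambda>n. \<integral>s. Re (u n s) * indicator A s \<partial>M) \<longlonglongrightarrow> (\<integral>s. v s * indicator A s \<partial>M)" by blast
  have "\<exists>w. integrable M w \<and> (\<forall>A\<in>sets M.
      (\<lambda>n. \<integral>s. Im (u n s) * indicator A s \<partial>M) \<longlonglongrightarrow> (\<integral>s. w s * indicator A s \<partial>M))"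
  proof (rule density_of_setwise_limit_real [OF M])
    show "(\<lambda>s. Im (u n s)) \<in> borel_measurable M" for n using u(1) [of n] by measurable
    show "AE s in M. \<bar>Im (u n s)\<bar> \<le> K" for n
      using u(2) [of n] by eventually_elim (rule order_trans [OF abs_Im_le_cmod])
    show "convergent (\<lambda>n. \<integral>s. Im (u n s) * indicator A s \<partial>M)" if "A \<in> sets M" for A
      using conv [OF that] unfolding Re_ind [symmetric] integral_Im [OF int [OF that]]
      by (auto simp: convergent_def intro: tendsto_Im)
  qed
  then obtain w where w: "integrable M w" "\<And>A. A \<in> sets M \<Longrightarrow>
      (\<lambda>n. \<integral>s. Im (u n s) * indicator A s \<partial>M) \<longlonglongrightarrow> (\<integral>s. w s * indicator A s \<partial>M)" by blast
  define h where "h s = of_real (v s) + \<i> * of_real (w s)" for s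
  have h_int: "integrable M h"
    unfolding h_def using v(1) w(1) by (intro Bochner_Integration.integrable_add integrable_mult_right integrable_of_real)
  have hA: "integrable M (\<lambda>s. h s * indicator A s)" if "A \<in> sets M" for A
    using integrable_mult_indicator [OF that h_int] by (simp add: scaleR_conv_of_real of_real_indicator mult.commute)
  have lim: "(\<lambda>n. \<integral>s. u n s * indicator A s \<partial>M) \<longlonglongrightarrow> (\<integral>s. h s * indicator A s \<partial>M)" if A: "A \<in> sets M" for A
    unfolding tendsto_complex_iff integral_Re [OF int [OF A], symmetric] integral_Im [OF int [OF A], symmetric]
      integral_Re [OF hA [OF A], symmetric] integral_Im [OF hA [OF A], symmetric] Re_ind
    using v(2) [OF A] w(2) [OF A] by (simp add: h_def)
  have "AE s in M. h s \<in> cball 0 K"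
  proof (rule averaging_theorem [OF h_int closed_cball])
    fix A assume A: "A \<in> sets M" "0 < measure M A"
    have "cmod (\<integral>s. u n s * indicator A s \<partial>M) \<le> K * measure M A" for n
    proof -
      have "(\<integral>s. cmod (indicator A s) \<partial>M) = measure M A"
        using A by (simp add: cmod_ind Int_absorb2 sets.sets_into_space)
      then show ?thesis using integrable_bounded_mult(2) [OF u ind [OF A(1)], of n] by simp
    qed
    then have "cmod (\<integral>s. h s * indicator A s \<partial>M) \<le> K * measure M A"
      by (intro LIMSEQ_le_const2 [OF tendsto_norm [OF lim [OF A(1)]]]) auto
    moreover have "set_lebesgue_integral M A h = (\<integral>s. h s * indicator A s \<partial>M)"
      by (simp add: set_lebesgue_integral_def scaleR_conv_of_real of_real_indicator mult.commute)
    ultimately show "(1 / measure M A) *\<^sub>R set_lebesgue_integral M A h \<in> cball 0 K"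
      using A(2) by (simp add: divide_simps)
  qed
  then show ?thesis using h_int lim by (intro exI [of _ h]) auto
qed

lemma weak_star_sequentially_complete:
  fixes f :: "nat \<Rightarrow> 'm::finite linf"
  assumes bdd: "bounded (range f)" and Cauchy: "top_Cauchy weak_star f"
  shows "\<exists>x. limitin weak_star f x sequentially"
proof -
  obtain K where K: "\<And>n. norm (f n) \<le> K"
    using bdd by (auto simp: bounded_iff)
  have conv: "convergent (\<lambda>n. linf_pairing (f n) g)" if g: "integrable unit_leb g" for g
    unfolding Cauchy_convergent_iff [symmetric]
  proof (rule CauchyI)
    fix r :: real assume "0 < r"
    moreover have "openin weak_star (weak_star_ball {g} r (0 :: 'm linf))"
      using g by (intro openin_weak_star_ball) auto
    ultimately have "openin weak_star (weak_star_ball {g} r (0 :: 'm linf)) \<and> 0 \<in> weak_star_ball {g} r (0 :: 'm linf)"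
      by (simp add: weak_star_ball_def)
    then obtain N where "\<forall>m\<ge>N. \<forall>n\<ge>N. f m - f n \<in> weak_star_ball {g} r 0"
      using Cauchy unfolding top_Cauchy_def by meson
    then show "\<exists>N. \<forall>m\<ge>N. \<forall>n\<ge>N. norm (linf_pairing (f m) g - linf_pairing (f n) g) < r"
      using g by (auto simp: weak_star_ball_def linf_pairing_diff linf_pairing_zero)
  qed
  have "\<forall>j. \<exists>v. v \<in> borel_measurable unit_leb \<and> (AE s in unit_leb. cmod (v s) \<le> K) \<and>
    (\<forall>A\<in>sets unit_leb. (\<lambda>n. \<integral>s. rep_linf (f n) s $ j * indicator A s \<partial>unit_leb) \<longlonglongrightarrow>
       (\<integral>s. v s * indicator A s \<partial>unit_leb))"
  proof (intro allI, rule density_of_setwise_limit [OF finite_unit_leb rep_linf_nth_measurable])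
    fix j
    show "AE s in unit_leb. cmod (rep_linf (f n) s $ j) \<le> K" for n
      using cmod_rep_linf_le [of "f n" j] by eventually_elim (use K order_trans in blast)
    show "convergent (\<lambda>n. \<integral>s. rep_linf (f n) s $ j * indicator A s \<partial>unit_leb)"
      if "A \<in> sets unit_leb" for A
    proof -
      have "integrable unit_leb (indicator A :: real \<Rightarrow> complex)"
        using that by (intro finite_measure.integrable_const_bound [OF finite_unit_leb, where B = 1])
          (auto simp: indicator_def)
      from conv [OF integrable_axis [OF this, of j]] show ?thesis
        by (simp add: linf_pairing_axis)
    qed
  qed
  from choice [OF this] obtain v where v: "\<And>j. v j \<in> borel_measurable unit_leb" "\<And>j. AE s in unit_leb. cmod (v j s) \<le> K"
    "\<And>j A. A \<in> sets unit_leb \<Longrightarrow> (\<lambda>n. \<integral>s. rep_linf (f n) s $ j * indicator A s \<partial>unit_leb) \<longlonglongrightarrow>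
       (\<integral>s. v j s * indicator A s \<partial>unit_leb)" by auto
  define h :: "real \<Rightarrow> complex ^ 'm" where "h s = (\<chi> j. v j s)" for s
  have "ess_bounded h"
  proof (rule ess_boundedI)
    show "h \<in> borel_measurable unit_leb"
    proof (rule borel_measurable_vecI)
      show "(\<lambda>s. h s $ j) \<in> borel_measurable unit_leb" for j using v(1) [of j] by (simp add: h_def)
    qed
    have "AE s in unit_leb. \<forall>j\<in>UNIV. cmod (v j s) \<le> K"
      using v(2) by (intro AE_finite_allI) auto
    then show "AE s in unit_leb. l1norm (h s) \<le> (\<Sum>j\<in>(UNIV :: 'm set). K)"
      by eventually_elim (unfold l1norm_def h_def, intro sum_mono, simp)
  qed
  then have rep: "AE s in unit_leb. rep_linf (abs_linf h) s = h s"
    by (rule rep_abs_linf)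
  have "limitin weak_star f (abs_linf h) sequentially"
    unfolding limitin_weak_star_iff
  proof (intro allI impI linf_pairing_tendsto_intervals)
    show "\<forall>\<^sub>F n in sequentially. norm (f n) \<le> K" by (simp add: K)
    fix j and a b :: real assume ab: "0 \<le> a" "b \<le> 1"
    have "interval_integral (abs_linf h) j a b =
        (\<integral>s. v j s * indicator {a..b} s \<partial>unit_leb)"
    proof (rule integral_cong_AE)
      show "AE s in unit_leb. rep_linf (abs_linf h) s $ j * indicator {a..b} s = v j s * indicator {a..b} s"
        using rep by eventually_elim (simp add: h_def)
    qed (use Icc_sets_unit_leb [OF ab] v(1) [of j] in measurable)
    then show "(\<lambda>n. interval_integral (f n) j a b) \<longlonglongrightarrow>
        interval_integral (abs_linf h) j a b"
      using v(3) [OF Icc_sets_unit_leb [OF ab]] by simp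
  qed
  then show ?thesis ..
qed

section \<open>The weak-star dual is norming\<close>

text \<open>
  The norm of \<open>x\<close> is almost attained at the sign pattern of \<open>x\<close>, averaged over the set on which
  \<open>l1norm\<close> of \<open>x\<close> is close to its essential supremum.
\<close>

lemma norm_attained_up_to:
  fixes x :: "'m::finite linf"
  assumes e: "0 < e"
  obtains g where "integrable unit_leb g" "\<And>y :: 'm linf. cmod (linf_pairing y g) \<le> norm y"
    "norm x - e \<le> cmod (linf_pairing x g)"
proof -
  interpret finite_measure unit_leb by (rule finite_unit_leb)
  define E where "E = {s \<in> space unit_leb. norm x - e < l1norm (rep_linf x s)}"
  have [measurable]: "(\<lambda>s. l1norm (rep_linf x s)) \<in> borel_measurable unit_leb"
    by (rule measurable_compose [OF rep_linf_measurable l1norm_measurable])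
  have E [measurable]: "E \<in> sets unit_leb" unfolding E_def by measurable
  have pos: "0 < measure unit_leb E"
  proof (rule ccontr)
    assume "\<not> 0 < measure unit_leb E"
    then have "E \<in> null_sets unit_leb"
      using E by (intro null_setsI) (auto simp: emeasure_eq_measure not_less measure_le_0_iff)
    then have "AE s in unit_leb. s \<notin> E" by (rule AE_not_in)
    then have "AE s in unit_leb. l1norm (rep_linf x s) \<le> norm x - e"
      using AE_space by eventually_elim (auto simp: E_def)
    then have "norm x \<le> norm x - e" by (rule norm_linf_le)
    with e show False by simp
  qed
  define k :: complex where "k = 1 / of_real (measure unit_leb E)"
  have k: "cmod k = 1 / measure unit_leb E" "k = of_real (1 / measure unit_leb E)"
    using pos by (simp_all add: k_def norm_divide)
  define g :: "real \<Rightarrow> complex ^ 'm"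
    where "g s = (\<chi> j. k * indicator E s * cnj (sgn (rep_linf x s $ j)))" for s
  have cmod_g: "cmod (g s $ j) \<le> indicator E s / measure unit_leb E" for s j
    using pos by (auto simp: g_def norm_mult k(1) norm_sgn indicator_def)
  have [measurable]: "(\<lambda>z :: complex. cnj (sgn z)) \<in> borel_measurable borel"
  proof -
    have [measurable]: "cnj \<in> borel_measurable borel"
      by (intro borel_measurable_continuous_onI continuous_intros)
    show ?thesis unfolding sgn_div_norm by simp
  qed
  have g_meas: "g \<in> borel_measurable unit_leb"
  proof (rule borel_measurable_vecI)
    fix j
    have "(\<lambda>s. cnj (sgn (rep_linf x s $ j))) \<in> borel_measurable unit_leb"
      by (rule measurable_compose [OF rep_linf_nth_measurable]) measurable
    then show "(\<lambda>s. g s $ j) \<in> borel_measurable unit_leb" unfolding g_def by simp measurable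
  qed
  have g: "integrable unit_leb g"
  proof (rule integrable_const_bound [where B = "CARD('m) / measure unit_leb E", OF AE_I2 g_meas])
    fix s
    have "norm (g s) \<le> (\<Sum>j\<in>UNIV. cmod (g s $ j))"
      using norm_le_l1norm [of "g s"] by (simp add: l1norm_def)
    also have "\<dots> \<le> (\<Sum>j\<in>(UNIV :: 'm set). 1 / measure unit_leb E)"
      using pos by (intro sum_mono order_trans [OF cmod_g]) (auto simp: indicator_def)
    finally show "norm (g s) \<le> CARD('m) / measure unit_leb E" by simp
  qed
  have int_E: "integrable unit_leb (\<lambda>s. c * (indicator E s / measure unit_leb E))" for c :: real
    by (auto simp: less_top [symmetric])
  have integral_E: "(\<integral>s. c * (indicator E s / measure unit_leb E) \<partial>unit_leb) = c" for c :: real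
    using pos sets.sets_into_space [OF E] by (simp add: Int_absorb2)
  have bound: "cmod (linf_pairing y g) \<le> norm y" for y :: "'m linf"
  proof -
    have int: "integrable unit_leb (\<lambda>s. \<Sum>j\<in>UNIV. rep_linf y s $ j * g s $ j)"
      by (intro Bochner_Integration.integrable_sum integrable_pairing_component g)
    have "cmod (linf_pairing y g) \<le> (\<integral>s. cmod (\<Sum>j\<in>UNIV. rep_linf y s $ j * g s $ j) \<partial>unit_leb)"
      unfolding linf_pairing_def by (rule integral_norm_bound)
    also have "\<dots> \<le> (\<integral>s. norm y * (indicator E s / measure unit_leb E) \<partial>unit_leb)"
    proof (intro integral_mono_AE integrable_norm int int_E)
      show "AE s in unit_leb. cmod (\<Sum>j\<in>UNIV. rep_linf y s $ j * g s $ j) \<le>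
          norm y * (indicator E s / measure unit_leb E)"
        using norm_linf_AE [of y]
      proof eventually_elim
        case (elim s)
        have "cmod (\<Sum>j\<in>UNIV. rep_linf y s $ j * g s $ j) \<le>
            (\<Sum>j\<in>UNIV. cmod (rep_linf y s $ j) * (indicator E s / measure unit_leb E))"
          by (intro sum_norm_le) (simp only: norm_mult mult_left_mono [OF cmod_g norm_ge_zero])
        also have "\<dots> = l1norm (rep_linf y s) * (indicator E s / measure unit_leb E)"
          by (simp only: l1norm_def sum_distrib_right)
        also have "\<dots> \<le> norm y * (indicator E s / measure unit_leb E)"
          using elim pos by (intro mult_right_mono) (auto simp: indicator_def)
        finally show ?case .
      qed
    qed
    also have "\<dots> = norm y" by (rule integral_E)
    finally show ?thesis .
  qed
  have sgn: "z * cnj (sgn z) = of_real (cmod z)" for z :: complex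
  proof -
    have "z * cnj (sgn z) = (z * cnj z) / of_real (cmod z)"
      by (simp add: sgn_div_norm scaleR_conv_of_real divide_inverse)
    also have "z * cnj z = of_real (cmod z) * of_real (cmod z)"
      by (simp only: complex_norm_square [symmetric] power2_eq_square of_real_mult)
    finally show ?thesis by (cases "z = 0") simp_all
  qed
  have "linf_pairing x g =
      (\<integral>s. of_real (l1norm (rep_linf x s) * (indicator E s / measure unit_leb E)) \<partial>unit_leb)"
    unfolding linf_pairing_def
  proof (intro Bochner_Integration.integral_cong refl)
    fix s
    have "(\<Sum>j\<in>UNIV. rep_linf x s $ j * g s $ j) =
        (\<Sum>j\<in>UNIV. of_real (cmod (rep_linf x s $ j)) * (k * indicator E s))"
    proof (intro sum.cong refl)
      fix j
      have "rep_linf x s $ j * g s $ j = (rep_linf x s $ j * cnj (sgn (rep_linf x s $ j))) * (k * indicator E s)"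
        by (simp add: g_def)
      then show "rep_linf x s $ j * g s $ j = of_real (cmod (rep_linf x s $ j)) * (k * indicator E s)"
        by (simp only: sgn)
    qed
    then show "(\<Sum>j\<in>UNIV. rep_linf x s $ j * g s $ j) =
        of_real (l1norm (rep_linf x s) * (indicator E s / measure unit_leb E))"
      by (cases "s \<in> E") (simp_all add: l1norm_def k(2) sum_divide_distrib)
  qed
  then have pair: "linf_pairing x g =
      of_real (\<integral>s. l1norm (rep_linf x s) * (indicator E s / measure unit_leb E) \<partial>unit_leb)"
    by (simp only: integral_complex_of_real)
  have "norm x - e = (\<integral>s. (norm x - e) * (indicator E s / measure unit_leb E) \<partial>unit_leb)"
    by (simp only: integral_E)
  also have "\<dots> \<le> (\<integral>s. l1norm (rep_linf x s) * (indicator E s / measure unit_leb E) \<partial>unit_leb)"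
  proof (intro integral_mono_AE int_E AE_I2)
    show "(norm x - e) * (indicator E s / measure unit_leb E) \<le>
        l1norm (rep_linf x s) * (indicator E s / measure unit_leb E)" for s
      using pos by (auto simp: indicator_def E_def divide_right_mono)
    have "AE s in unit_leb. norm (l1norm (rep_linf x s) * (indicator E s / measure unit_leb E)) \<le>
        norm x / measure unit_leb E"
      using norm_linf_AE [of x] by eventually_elim
        (use pos in \<open>auto simp: indicator_def divide_right_mono\<close>)
    then show "integrable unit_leb (\<lambda>s. l1norm (rep_linf x s) * (indicator E s / measure unit_leb E))"
      by (rule integrable_const_bound) measurable
  qed
  finally have "norm x - e \<le> cmod (linf_pairing x g)"
    unfolding pair norm_of_real by simp
  with g bound show ?thesis using that by blast
qed

lemma norming_weak_star: "norming (top_dual (weak_star :: 'm::finite linf topology))"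
  unfolding norming_def
proof
  fix x :: "'m linf"
  let ?D = "{\<phi> \<in> top_dual (weak_star :: 'm linf topology). \<forall>y. cmod (\<phi> y) \<le> norm y}"
  have mem: "(\<lambda>y. linf_pairing y g) \<in> ?D"
    if "integrable unit_leb g" "\<And>y :: 'm linf. cmod (linf_pairing y g) \<le> norm y" for g
    using that by (simp add: top_dual_def linf_pairing_add linf_pairing_scaleC continuous_map_pairing)
  have bdd: "bdd_above ((\<lambda>\<phi>. cmod (\<phi> x)) ` ?D)"
    by (rule bdd_aboveI [of _ "norm x"]) auto
  show "norm x = (SUP \<phi>\<in>?D. cmod (\<phi> x))"
  proof (rule antisym)
    show "norm x \<le> (SUP \<phi>\<in>?D. cmod (\<phi> x))"
    proof (rule field_le_epsilon)
      fix e :: real assume "0 < e"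
      then obtain g where g: "integrable unit_leb g" "\<And>y :: 'm linf. cmod (linf_pairing y g) \<le> norm y"
        "norm x - e \<le> cmod (linf_pairing x g)"
        using norm_attained_up_to by blast
      have "cmod (linf_pairing x g) \<le> (SUP \<phi>\<in>?D. cmod (\<phi> x))"
        using cSUP_upper [OF mem [OF g(1,2)] bdd] by simp
      with g(3) show "norm x \<le> (SUP \<phi>\<in>?D. cmod (\<phi> x)) + e" by simp
    qed
    have "(\<lambda>y. linf_pairing y (\<lambda>s. 0)) \<in> ?D"
      by (rule mem) (simp_all add: linf_pairing_def)
    then have "?D \<noteq> {}" by blast
    then show "(SUP \<phi>\<in>?D. cmod (\<phi> x)) \<le> norm x" by (rule cSUP_least) auto
  qed
qed

lemma linf_zero_if_pairings_zero:
  assumes "\<And>g. integrable unit_leb g \<Longrightarrow> linf_pairing x g = 0" shows "x = 0"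
proof (rule ccontr)
  assume "x \<noteq> 0"
  then obtain g where "integrable unit_leb g" "norm x - norm x / 2 \<le> cmod (linf_pairing x g)"
    using norm_attained_up_to [of "norm x / 2" x] by auto
  with assms \<open>x \<noteq> 0\<close> show False by simp
qed

lemma linf_zero_if_intervals_zero:
  assumes "\<And>j a b. 0 \<le> a \<Longrightarrow> a \<le> b \<Longrightarrow> b \<le> 1 \<Longrightarrow>
    interval_integral x j a b = 0"
  shows "x = 0"
proof (rule linf_zero_if_pairings_zero)
  fix g :: "real \<Rightarrow> complex ^ 'a" assume g: "integrable unit_leb g"
  have zero: "interval_integral 0 j a b = 0"
    if "0 \<le> a" "b \<le> 1" for a b :: real and j :: 'a
    using linf_pairing_axis [of 0 j "indicator {a..b}"]
      linf_pairing_zero [OF integrable_axis [OF integrable_indicator_Icc [OF that], of j]] by simp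
  have "((\<lambda>n. linf_pairing x g) \<longlongrightarrow> linf_pairing 0 g) sequentially"
    using assms zero by (intro linf_pairing_tendsto_intervals [where K = "norm x"] g) auto
  then have "linf_pairing x g = linf_pairing 0 g"
    by (simp add: LIMSEQ_const_iff)
  then show "linf_pairing x g = 0" by (simp add: linf_pairing_zero g)
qed

lemma Hausdorff_weak_star: "Hausdorff_space (weak_star :: 'm::finite linf topology)"
  unfolding Hausdorff_space_def
proof (intro allI impI)
  fix x y :: "'m linf" assume "x \<in> topspace weak_star \<and> y \<in> topspace weak_star \<and> x \<noteq> y"
  then have "x - y \<noteq> 0" by simp
  then obtain g where g: "integrable unit_leb g" "linf_pairing (x - y) g \<noteq> 0"
    using linf_zero_if_pairings_zero by blast
  then have "linf_pairing x g \<noteq> linf_pairing y g" by (simp add: linf_pairing_diff)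
  then obtain U V where "open U" "open V" "linf_pairing x g \<in> U" "linf_pairing y g \<in> V" "U \<inter> V = {}"
    by (meson hausdorff)
  then show "\<exists>U V. openin weak_star U \<and> openin weak_star V \<and> x \<in> U \<and> y \<in> V \<and> disjnt U V"
    using g(1)
    by (intro exI [of _ "(\<lambda>f. linf_pairing f g) -` U"] exI [of _ "(\<lambda>f. linf_pairing f g) -` V"])
      (auto simp: disjnt_def intro: openin_weak_star_vimage)
qed

lemma bicontinuous_setting_weak_star:
  "bicontinuous_setting (weak_star :: 'm::finite linf topology)"
  unfolding bicontinuous_setting_def
  by (simp add: locally_convex_weak_star Hausdorff_weak_star weak_star_coarser norming_weak_star
      weak_star_sequentially_complete)

section \<open>Borel representatives\<close>

lemma AE_unit_leb_iff: "(AE s in unit_leb. P s) \<longleftrightarrow> (AE s in lborel. s \<in> {0..1} \<longrightarrow> P s)"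
  by (simp add: AE_restrict_space_iff AE_completion_iff)

lemma borel_measurable_unit_leb: "h \<in> borel_measurable borel \<Longrightarrow> h \<in> borel_measurable unit_leb"
  by (rule measurable_restrict_space1) (simp add: measurable_completion)

lemma ex_Borel_representative:
  fixes f :: "'m::finite linf"
  shows "\<exists>h. h \<in> borel_measurable borel \<and> (AE s in unit_leb. rep_linf f s = h s) \<and> (\<forall>s. l1norm (h s) \<le> norm f)"
proof -
  define u where "u s = (if s \<in> {0..1} then rep_linf f s else 0)" for s
  have u: "(\<lambda>s. u s $ j) \<in> borel_measurable (completion lborel)" for j
    unfolding u_def by (rule measurable_compose [OF borel_measurable_if_I vec_nth_measurable]) auto
  have "\<exists>a\<in>borel_measurable lborel. AE s in lborel. Re (u s $ j) = a s" for j
    by (intro completion_ex_borel_measurable_real measurable_compose [OF u]) measurable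
  then have "\<forall>j. \<exists>a. a \<in> borel_measurable borel \<and> (AE s in lborel. Re (u s $ j) = a s)" by auto
  from choice [OF this] obtain a where a:
    "\<And>j. a j \<in> borel_measurable borel" "\<And>j. AE s in lborel. Re (u s $ j) = a j s" by auto
  have "\<exists>b\<in>borel_measurable lborel. AE s in lborel. Im (u s $ j) = b s" for j
    by (intro completion_ex_borel_measurable_real measurable_compose [OF u]) measurable
  then have "\<forall>j. \<exists>b. b \<in> borel_measurable borel \<and> (AE s in lborel. Im (u s $ j) = b s)" by auto
  from choice [OF this] obtain b where b:
    "\<And>j. b j \<in> borel_measurable borel" "\<And>j. AE s in lborel. Im (u s $ j) = b j s" by auto
  define v :: "real \<Rightarrow> complex ^ 'm" where "v s = (\<chi> j. of_real (a j s) + \<i> * of_real (b j s))" for s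
  have v [measurable]: "v \<in> borel_measurable borel"
  proof (rule borel_measurable_vecI)
    fix j
    note [measurable] = a(1) [of j] b(1) [of j]
    show "(\<lambda>s. v s $ j) \<in> borel_measurable borel" unfolding v_def by simp measurable
  qed
  have [measurable]: "(\<lambda>s. l1norm (v s)) \<in> borel_measurable borel"
    by (rule measurable_compose [OF v l1norm_measurable])
  have "AE s in lborel. \<forall>j\<in>UNIV. Re (u s $ j) = a j s \<and> Im (u s $ j) = b j s"
    using a(2) b(2) by (intro AE_finite_allI AE_conjI) auto
  then have "AE s in lborel. u s = v s"
    by eventually_elim (simp add: vec_eq_iff v_def complex_eq_iff)
  then have ae: "AE s in unit_leb. rep_linf f s = v s"
    unfolding AE_unit_leb_iff by eventually_elim (auto simp: u_def)
  let ?h = "\<lambda>s. if l1norm (v s) \<le> norm f then v s else 0"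
  have "?h \<in> borel_measurable borel" by measurable
  moreover have "AE s in unit_leb. rep_linf f s = ?h s"
    using ae norm_linf_AE [of f] by eventually_elim auto
  ultimately show ?thesis by (intro exI [of _ ?h]) auto
qed

text \<open>
  A representative that is Borel measurable on the whole line, so that it can be composed with affine
  maps, and that is bounded everywhere by the norm.
\<close>

definition Borel_rep :: "'m::finite linf \<Rightarrow> real \<Rightarrow> complex ^ 'm" where
  "Borel_rep f = (SOME h. h \<in> borel_measurable borel \<and> (AE s in unit_leb. rep_linf f s = h s) \<and>
     (\<forall>s. l1norm (h s) \<le> norm f))"

lemma Borel_rep:
  shows Borel_rep_measurable [measurable]: "Borel_rep f \<in> borel_measurable borel"
    and rep_linf_eq_Borel_rep: "AE s in unit_leb. rep_linf f s = Borel_rep f s"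
    and Borel_rep_bound: "l1norm (Borel_rep f s) \<le> norm f"
  using someI_ex [OF ex_Borel_representative [of f]] by (auto simp: Borel_rep_def)

lemma cmod_Borel_rep: "cmod (Borel_rep f s $ j) \<le> norm f"
  by (rule order_trans [OF cmod_le_l1norm Borel_rep_bound])

section \<open>Arrivals at the left endpoints\<close>

text \<open>The edges are indexed by \<open>'m\<close>, the speeds are \<open>c\<close>, and \<open>K\<close> is the matrix of the boundary condition.\<close>

locale transport_network =
  fixes c :: "'m::finite \<Rightarrow> real" and K :: "complex ^ 'm ^ 'm"
  assumes c_pos: "c j > 0"
begin

definition c_max :: real where "c_max = Max (range c)"

lemma c_le_max: "c j \<le> c_max"
  unfolding c_max_def by (rule Max_ge) auto

lemma c_max_pos: "0 < c_max"
  using c_pos c_le_max by (rule order_less_le_trans)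

lemma delay_ge: "1 / c_max \<le> 1 / c j"
  using c_pos c_le_max by (intro divide_left_mono mult_pos_pos c_max_pos) auto

text \<open>
  The value that arrives at the endpoint \<open>0\<close> of the edge \<open>j\<close> at time \<open>t\<close>, for the initial state \<open>f\<close>.
  Only times \<open>t \<ge> 0\<close> and values of \<open>f\<close> on \<open>[0, 1]\<close> are meaningful; the recursion terminates because every
  delay \<open>1 / c j\<close> is at least \<open>1 / c_max\<close>.
\<close>

function arrival :: "(real \<Rightarrow> complex ^ 'm) \<Rightarrow> real \<Rightarrow> 'm \<Rightarrow> complex" where
  "arrival f t j = (if c j * t < 1 then f (c j * t) $ j
     else (\<Sum>k\<in>UNIV. K $ j $ k * arrival f (t - 1 / c j) k))"
  by pat_completeness auto
termination
proof (relation "Wellfounded.measure (\<lambda>(f, t, j). nat \<lfloor>c_max * t\<rfloor>)")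
  fix t j
  assume "\<not> c j * t < 1"
  then have t: "1 / c j \<le> t" using c_pos [of j] by (simp add: field_simps)
  then have "1 / c_max \<le> t" using delay_ge [of j] by simp
  then have 1: "1 \<le> c_max * t" using c_max_pos by (simp add: field_simps)
  have "1 \<le> c_max * (1 / c j)" using c_pos [of j] c_le_max [of j] by simp
  then have "c_max * (t - 1 / c j) \<le> c_max * t - 1" by (simp add: right_diff_distrib)
  then have "\<lfloor>c_max * (t - 1 / c j)\<rfloor> \<le> \<lfloor>c_max * t\<rfloor> - 1"
    by (metis floor_diff_one floor_mono)
  moreover have "1 \<le> \<lfloor>c_max * t\<rfloor>" using 1 by simp
  ultimately have "nat \<lfloor>c_max * (t - 1 / c j)\<rfloor> < nat \<lfloor>c_max * t\<rfloor>" by linarith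
  then show "((f, t - 1 / c j, k), f, t, j) \<in> Wellfounded.measure (\<lambda>(f, t, j). nat \<lfloor>c_max * t\<rfloor>)" for f k
    by simp
qed simp

declare arrival.simps [simp del]

lemma arrival_initial: "c j * t < 1 \<Longrightarrow> arrival f t j = f (c j * t) $ j"
  by (simp add: arrival.simps)

lemma arrival_delay: "1 \<le> c j * t \<Longrightarrow> arrival f t j = (\<Sum>k\<in>UNIV. K $ j $ k * arrival f (t - 1 / c j) k)"
  by (simp add: arrival.simps [of f t])

lemma delay_induct:
  assumes init: "\<And>t j. c j * t < 1 \<Longrightarrow> P t j"
    and step: "\<And>t j. 1 \<le> c j * t \<Longrightarrow> (\<And>k. P (t - 1 / c j) k) \<Longrightarrow> P t j"
  shows "P t j"
proof (induction "undefined :: real \<Rightarrow> complex ^ 'm" t j rule: arrival.induct)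
  case (1 t j)
  then show ?case using init step by (cases "c j * t < 1") auto
qed

text \<open>
  Statements about all arrivals up to time \<open>a\<close>, such as measurability or Lipschitz continuity, are
  proved in steps of the shortest delay.
\<close>

lemma delay_steps_induct:
  assumes zero: "P 0" and step: "\<And>a. 0 \<le> a \<Longrightarrow> P a \<Longrightarrow> P (a + 1 / c_max)"
  shows "P (real n * (1 / c_max))"
proof (induction n)
  case (Suc n)
  have "real (Suc n) * (1 / c_max) = real n * (1 / c_max) + 1 / c_max"
    by (simp add: algebra_simps add_divide_distrib)
  with Suc step [of "real n * (1 / c_max)"] c_max_pos show ?case by simp
qed (simp add: zero)

lemma ex_delay_steps: "\<exists>n. t \<le> real n * (1 / c_max)"
proof -
  obtain n where "c_max * t \<le> real n" using real_arch_simple by blast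
  then show ?thesis using c_max_pos by (intro exI [of _ n]) (simp add: field_simps)
qed

lemma arrival_measurable [measurable]:
  assumes [measurable]: "f \<in> borel_measurable borel"
  shows "(\<lambda>t. arrival f t j) \<in> borel_measurable borel"
proof -
  have [measurable]: "(\<lambda>t. f (c j * t) $ j) \<in> borel_measurable borel" for j
    by (rule measurable_compose [OF _ vec_nth_measurable]) measurable
  have cut: "\<forall>j. (\<lambda>t. arrival f t j * indicator {..real n * (1 / c_max)} t) \<in> borel_measurable borel" for n
  proof (rule delay_steps_induct [where P = "\<lambda>a. \<forall>j. (\<lambda>t. arrival f t j * indicator {..a} t) \<in> borel_measurable borel"])
    show "\<forall>j. (\<lambda>t. arrival f t j * indicator {..0} t) \<in> borel_measurable borel"
    proof
      fix j
      have "(\<lambda>t. f (c j * t) $ j * indicator {..0::real} t) \<in> borel_measurable borel" by measurable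
      also have "(\<lambda>t. f (c j * t) $ j * indicator {..0::real} t) = (\<lambda>t. arrival f t j * indicator {..0} t)"
      proof
        fix t :: real
        show "f (c j * t) $ j * indicator {..0} t = arrival f t j * indicator {..0} t"
        proof (cases "t \<le> 0")
          case True
          then have "c j * t \<le> 0" using c_pos [of j] by (simp add: mult_nonneg_nonpos)
          then show ?thesis by (simp add: arrival_initial)
        qed simp
      qed
      finally show "(\<lambda>t. arrival f t j * indicator {..0} t) \<in> borel_measurable borel" .
    qed
  next
    fix a :: real
    assume IH: "\<forall>j. (\<lambda>t. arrival f t j * indicator {..a} t) \<in> borel_measurable borel"
    show "\<forall>j. (\<lambda>t. arrival f t j * indicator {..a + 1 / c_max} t) \<in> borel_measurable borel"
    proof
      fix j
      have [measurable]: "(\<lambda>t. arrival f (t - 1 / c j) k * indicator {..a} (t - 1 / c j)) \<in> borel_measurable borel" for k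
        by (rule measurable_compose [OF _ spec [OF IH, of k]]) measurable
      have "(\<lambda>t. indicator {..a + 1 / c_max} t * (if c j * t < 1 then f (c j * t) $ j else
          (\<Sum>k\<in>UNIV. K $ j $ k * (arrival f (t - 1 / c j) k * indicator {..a} (t - 1 / c j)))))
          \<in> borel_measurable borel" by measurable
      also have "(\<lambda>t. indicator {..a + 1 / c_max} t * (if c j * t < 1 then f (c j * t) $ j else
          (\<Sum>k\<in>UNIV. K $ j $ k * (arrival f (t - 1 / c j) k * indicator {..a} (t - 1 / c j))))) =
          (\<lambda>t. arrival f t j * indicator {..a + 1 / c_max} t)"
      proof
        fix t
        have "t - 1 / c j \<le> a" if "t \<le> a + 1 / c_max" using that delay_ge [of j] by simp
        then show "indicator {..a + 1 / c_max} t * (if c j * t < 1 then f (c j * t) $ j else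
          (\<Sum>k\<in>UNIV. K $ j $ k * (arrival f (t - 1 / c j) k * indicator {..a} (t - 1 / c j)))) =
          arrival f t j * indicator {..a + 1 / c_max} t"
          by (cases "t \<le> a + 1 / c_max") (auto simp: arrival_initial arrival_delay)
      qed
      finally show "(\<lambda>t. arrival f t j * indicator {..a + 1 / c_max} t) \<in> borel_measurable borel" .
    qed
  qed
  show ?thesis
  proof (rule borel_measurable_LIMSEQ_metric)
    show "(\<lambda>t. arrival f t j * indicator {..real n * (1 / c_max)} t) \<in> borel_measurable borel" for n
      using cut by blast
    fix t
    obtain N where N: "t \<le> real N * (1 / c_max)" using ex_delay_steps by blast
    have "\<forall>\<^sub>F n in sequentially. arrival f t j * indicator {..real n * (1 / c_max)} t = arrival f t j"
      using eventually_ge_at_top [of N]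
    proof eventually_elim
      case (elim n)
      then have "real N * (1 / c_max) \<le> real n * (1 / c_max)"
        using c_max_pos by (intro mult_right_mono) auto
      with N show ?case by (auto simp: indicator_def)
    qed
    then show "(\<lambda>n. arrival f t j * indicator {..real n * (1 / c_max)} t) \<longlonglongrightarrow> arrival f t j"
      by (rule tendsto_eventually)
  qed
qed

text \<open>
  Each passage through a vertex multiplies the values by at most \<open>K_sum\<close> and takes at least the time
  \<open>1 / c_max\<close>. The exponential rate \<open>growth\<close> compensates this because \<open>K_sum \<le> exp K_sum\<close>.
\<close>

definition K_sum :: real where "K_sum = (\<Sum>j\<in>UNIV. \<Sum>k\<in>UNIV. cmod (K $ j $ k))"

definition growth :: real where "growth = K_sum * c_max"

lemma K_row_le: "(\<Sum>k\<in>UNIV. cmod (K $ j $ k)) \<le> K_sum"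
  unfolding K_sum_def by (rule member_le_sum) (auto intro: sum_nonneg)

lemma K_sum_nonneg: "0 \<le> K_sum"
  unfolding K_sum_def by (intro sum_nonneg) auto

lemma growth_nonneg: "0 \<le> growth"
  unfolding growth_def using K_sum_nonneg c_max_pos by simp

lemma arrival_bound:
  assumes f: "\<And>x j. x \<in> {0..1} \<Longrightarrow> cmod (f x $ j) \<le> S" and "0 \<le> t"
  shows "cmod (arrival f t j) \<le> S * exp (growth * t)"
proof -
  have S: "0 \<le> S" using order_trans [OF norm_ge_zero f [of 0]] by simp
  have "0 \<le> t \<longrightarrow> cmod (arrival f t j) \<le> S * exp (growth * t)"
  proof (induction t j rule: delay_induct)
    case (1 t j)
    show ?case
    proof
      assume t: "0 \<le> t"
      with 1 c_pos [of j] have "cmod (arrival f t j) \<le> S * 1"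
        using f [of "c j * t" j] by (simp add: arrival_initial)
      also have "\<dots> \<le> S * exp (growth * t)"
        using S t growth_nonneg by (intro mult_left_mono) auto
      finally show "cmod (arrival f t j) \<le> S * exp (growth * t)" .
    qed
  next
    case (2 t j)
    show ?case
    proof
      have t: "0 \<le> t - 1 / c j" using 2(1) c_pos [of j] by (simp add: field_simps)
      have "cmod (arrival f t j) \<le> (\<Sum>k\<in>UNIV. cmod (K $ j $ k) * (S * exp (growth * (t - 1 / c j))))"
        using 2 t by (auto simp: arrival_delay norm_mult intro!: sum_norm_le mult_left_mono)
      also have "\<dots> \<le> K_sum * (S * exp (growth * (t - 1 / c j)))"
        unfolding sum_distrib_right [symmetric] using S by (intro mult_right_mono K_row_le) auto
      also have "\<dots> \<le> exp (growth * (1 / c j)) * (S * exp (growth * (t - 1 / c j)))"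
      proof (intro mult_right_mono)
        have "1 \<le> c_max / c j" using c_pos [of j] c_le_max [of j] by simp
        then have "K_sum * 1 \<le> K_sum * (c_max / c j)"
          using K_sum_nonneg by (rule mult_left_mono)
        also have "\<dots> \<le> exp (K_sum * (c_max / c j))"
          by (rule order_trans [OF _ exp_ge_add_one_self]) simp
        finally show "K_sum \<le> exp (growth * (1 / c j))" by (simp add: growth_def)
      qed (use S in auto)
      also have "\<dots> = S * exp (growth * t)"
        by (simp add: exp_add [symmetric] algebra_simps)
      finally show "cmod (arrival f t j) \<le> S * exp (growth * t)" .
    qed
  qed
  with \<open>0 \<le> t\<close> show ?thesis by simp
qed

text \<open>Arrivals depend only on the equivalence class of the initial state, up to null sets of times.\<close>

lemma arrival_cong_AE:
  assumes [measurable]: "f \<in> borel_measurable borel" "g \<in> borel_measurable borel"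
    and eq: "AE s in unit_leb. f s = g s"
  shows "AE t in lborel. \<forall>j. 0 \<le> t \<longrightarrow> arrival f t j = arrival g t j"
proof -
  have init: "AE t in lborel. \<forall>j. 0 \<le> t \<longrightarrow> c j * t < 1 \<longrightarrow> arrival f t j = arrival g t j"
  proof -
    have "AE t in lborel. \<forall>j\<in>UNIV. 0 + c j * t \<in> {0..1} \<longrightarrow> f (0 + c j * t) = g (0 + c j * t)"
    proof (intro AE_finite_allI)
      fix j
      show "AE t in lborel. 0 + c j * t \<in> {0..1} \<longrightarrow> f (0 + c j * t) = g (0 + c j * t)"
        by (rule AE_borel_affine [where P = "\<lambda>s. s \<in> {0..1} \<longrightarrow> f s = g s"])
          (use c_pos [of j] eq in \<open>auto simp: AE_unit_leb_iff\<close>)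
    qed simp
    then show ?thesis
      by eventually_elim (auto simp: arrival_initial c_pos less_imp_le)
  qed
  have "AE t in lborel. \<forall>j. 0 \<le> t \<longrightarrow> t \<le> real n * (1 / c_max) \<longrightarrow> arrival f t j = arrival g t j" for n
  proof (rule delay_steps_induct [where P =
      "\<lambda>a. AE t in lborel. \<forall>j. 0 \<le> t \<longrightarrow> t \<le> a \<longrightarrow> arrival f t j = arrival g t j"])
    show "AE t in lborel. \<forall>j. 0 \<le> t \<longrightarrow> t \<le> 0 \<longrightarrow> arrival f t j = arrival g t j"
      using init
    proof eventually_elim
      case (elim t)
      show ?case
      proof (intro allI impI)
        fix j assume "0 \<le> t" "t \<le> 0"
        then have "t = 0" by simp
        with elim show "arrival f t j = arrival g t j" by simp
      qed
    qed
  next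
    fix a :: real
    assume IH: "AE t in lborel. \<forall>j. 0 \<le> t \<longrightarrow> t \<le> a \<longrightarrow> arrival f t j = arrival g t j"
    have "AE t in lborel. \<forall>j\<in>UNIV. (\<forall>k. 0 \<le> - (1 / c j) + 1 * t \<longrightarrow> - (1 / c j) + 1 * t \<le> a \<longrightarrow>
        arrival f (- (1 / c j) + 1 * t) k = arrival g (- (1 / c j) + 1 * t) k)"
      by (intro AE_finite_allI AE_borel_affine [OF _ _ IH]) auto
    with init show "AE t in lborel. \<forall>j. 0 \<le> t \<longrightarrow> t \<le> a + 1 / c_max \<longrightarrow> arrival f t j = arrival g t j"
    proof eventually_elim
      case (elim t)
      show ?case
      proof (intro allI impI)
        fix j assume t: "0 \<le> t" "t \<le> a + 1 / c_max"
        show "arrival f t j = arrival g t j"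
        proof (cases "c j * t < 1")
          case True
          with elim t show ?thesis by blast
        next
          case False
          then have "0 \<le> t - 1 / c j" using c_pos [of j] by (simp add: field_simps)
          moreover have "t - 1 / c j \<le> a" using t delay_ge [of j] by simp
          ultimately have "arrival f (t - 1 / c j) k = arrival g (t - 1 / c j) k" for k
            using elim(2) [rule_format, of j k] by simp
          with False show ?thesis by (simp add: arrival_delay)
        qed
      qed
    qed
  qed
  then have "AE t in lborel. \<forall>n. \<forall>j. 0 \<le> t \<longrightarrow> t \<le> real n * (1 / c_max) \<longrightarrow> arrival f t j = arrival g t j"
    by (subst AE_all_countable) blast
  then show ?thesis
    by eventually_elim (use ex_delay_steps in blast)
qed

lemma arrival_linear:
  "arrival (\<lambda>s. a *s f s + b *s g s) t j = a * arrival f t j + b * arrival g t j"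
proof (induction t j rule: delay_induct)
  case (1 t j)
  then show ?case by (simp add: arrival_initial)
next
  case (2 t j)
  then show ?case
    by (simp add: arrival_delay sum_distrib_left sum.distrib [symmetric] algebra_simps)
qed

section \<open>The semigroup\<close>

text \<open>
  The state of the network at time \<open>t\<close>: the value at the position \<open>x\<close> of edge \<open>j\<close> arrives at the
  endpoint \<open>0\<close> after the further time \<open>x / c j\<close>.
\<close>

definition flow :: "(real \<Rightarrow> complex ^ 'm) \<Rightarrow> real \<Rightarrow> real \<Rightarrow> complex ^ 'm" where
  "flow f t x = (\<chi> j. arrival f (t + x / c j) j)"

lemma flow_nth [simp]: "flow f t x $ j = arrival f (t + x / c j) j"
  by (simp add: flow_def)

lemma flow_measurable [measurable]:
  assumes [measurable]: "f \<in> borel_measurable borel"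
  shows "flow f t \<in> borel_measurable borel"
  by (rule borel_measurable_vecI) simp

text \<open>The semigroup law: both sides solve the same delay equations.\<close>

lemma arrival_flow:
  assumes "0 \<le> s" "0 \<le> t" shows "arrival (flow f s) t j = arrival f (s + t) j"
proof -
  have "0 \<le> t \<longrightarrow> arrival (flow f s) t j = arrival f (s + t) j"
  proof (induction t j rule: delay_induct)
    case (1 t j)
    then show ?case using c_pos [of j] by (simp add: arrival_initial)
  next
    case (2 t j)
    have "0 \<le> t - 1 / c j" using 2(1) c_pos [of j] by (simp add: field_simps)
    moreover have "0 \<le> c j * s" using assms c_pos [of j] by simp
    then have "1 \<le> c j * (s + t)" using 2(1) by (simp add: distrib_left)
    ultimately show ?case using 2 by (simp add: arrival_delay add_diff_eq)
  qed
  with assms show ?thesis by simp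
qed

lemma flow_flow: "0 \<le> s \<Longrightarrow> 0 \<le> t \<Longrightarrow> 0 \<le> x \<Longrightarrow> flow (flow f s) t x = flow f (s + t) x"
  by (simp add: vec_eq_iff arrival_flow add.assoc c_pos less_imp_le)

text \<open>The constant in the exponential bound for the semigroup; it accounts for the travel time along one edge.\<close>

definition growth_factor :: real where "growth_factor = (\<Sum>j\<in>UNIV. exp (growth / c j))"

lemma growth_factor_nonneg: "0 \<le> growth_factor"
  unfolding growth_factor_def by (intro sum_nonneg) simp

lemma flow_bound:
  assumes f: "\<And>x j. x \<in> {0..1} \<Longrightarrow> cmod (f x $ j) \<le> S" and t: "0 \<le> t" and x: "x \<in> {0..1}"
  shows "l1norm (flow f t x) \<le> growth_factor * exp (growth * t) * S"
proof -
  have S: "0 \<le> S" using order_trans [OF norm_ge_zero f [of 0]] by simp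
  have "cmod (arrival f (t + x / c j) j) \<le> exp (growth / c j) * exp (growth * t) * S" for j
  proof -
    have "cmod (arrival f (t + x / c j) j) \<le> S * exp (growth * (t + x / c j))"
      using f t x c_pos [of j] by (intro arrival_bound) auto
    also have "\<dots> \<le> S * exp (growth * (t + 1 / c j))"
      using S x growth_nonneg c_pos [of j]
      by (intro mult_left_mono iffD2 [OF exp_le_cancel_iff] add_left_mono divide_right_mono) auto
    finally show ?thesis by (simp add: exp_add distrib_left mult_ac)
  qed
  then show ?thesis
    unfolding l1norm_def growth_factor_def sum_distrib_right by (intro sum_mono) simp
qed

lemma ess_bounded_flow:
  assumes [measurable]: "f \<in> borel_measurable borel"
    and f: "\<And>x j. x \<in> {0..1} \<Longrightarrow> cmod (f x $ j) \<le> S" and t: "0 \<le> t"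
  shows "ess_bounded (flow f t)"
proof (rule ess_boundedI)
  show "flow f t \<in> borel_measurable unit_leb"
    by (rule borel_measurable_unit_leb) measurable
  show "AE x in unit_leb. l1norm (flow f t x) \<le> growth_factor * exp (growth * t) * S"
    by (rule AE_I2) (use flow_bound [OF f t] in auto)
qed

text \<open>
  The flow on equivalence classes, meaningful for \<open>t \<ge> 0\<close>. By \<open>rep_transport\<close> every Borel
  measurable representative of \<open>f\<close> may be used.
\<close>

definition transport :: "real \<Rightarrow> 'm linf \<Rightarrow> 'm linf" where
  "transport t f = abs_linf (flow (Borel_rep f) t)"

lemma rep_transport:
  assumes [measurable]: "f0 \<in> borel_measurable borel" and eq: "AE s in unit_leb. rep_linf f s = f0 s"
    and t: "0 \<le> t"
  shows "AE x in unit_leb. rep_linf (transport t f) x = flow f0 t x"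
proof -
  have "AE s in unit_leb. Borel_rep f s = f0 s"
    using eq rep_linf_eq_Borel_rep [of f] by eventually_elim simp
  then have "AE t in lborel. \<forall>j. 0 \<le> t \<longrightarrow> arrival (Borel_rep f) t j = arrival f0 t j"
    by (intro arrival_cong_AE) measurable
  then have "AE x in lborel. \<forall>j\<in>UNIV. 0 \<le> t + (1 / c j) * x \<longrightarrow>
      arrival (Borel_rep f) (t + (1 / c j) * x) j = arrival f0 (t + (1 / c j) * x) j"
  proof (intro AE_finite_allI)
    fix j
    assume "AE t in lborel. \<forall>j. 0 \<le> t \<longrightarrow> arrival (Borel_rep f) t j = arrival f0 t j"
    then have "AE t in lborel. 0 \<le> t \<longrightarrow> arrival (Borel_rep f) t j = arrival f0 t j"
      by eventually_elim blast
    then show "AE x in lborel. 0 \<le> t + (1 / c j) * x \<longrightarrow>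
        arrival (Borel_rep f) (t + (1 / c j) * x) j = arrival f0 (t + (1 / c j) * x) j"
      using c_pos [of j] by (intro AE_borel_affine [where P = "\<lambda>u. 0 \<le> u \<longrightarrow> arrival (Borel_rep f) u j = arrival f0 u j"])
        auto
  qed simp
  then have "AE x in unit_leb. flow (Borel_rep f) t x = flow f0 t x"
    unfolding AE_unit_leb_iff
    by eventually_elim (use t c_pos in \<open>auto simp: vec_eq_iff less_imp_le\<close>)
  moreover have "AE x in unit_leb. rep_linf (transport t f) x = flow (Borel_rep f) t x"
    unfolding transport_def
    by (intro rep_abs_linf ess_bounded_flow [OF Borel_rep_measurable cmod_Borel_rep t])
  ultimately show ?thesis by eventually_elim simp
qed

lemma norm_transport_le:
  assumes "0 \<le> t"
  shows "norm (transport t f) \<le> growth_factor * exp (growth * t) * norm f"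
proof (rule norm_linf_le)
  show "AE x in unit_leb. l1norm (rep_linf (transport t f) x) \<le>
      growth_factor * exp (growth * t) * norm f"
    using rep_transport [OF Borel_rep_measurable rep_linf_eq_Borel_rep assms, of f] AE_space
    by eventually_elim (use flow_bound [OF cmod_Borel_rep assms] in auto)
qed

lemma transport_linear:
  assumes t: "0 \<le> t"
  shows "transport t (a *\<^sub>C f + b *\<^sub>C g) = a *\<^sub>C transport t f + b *\<^sub>C transport t g"
proof -
  let ?h = "\<lambda>s. a *s Borel_rep f s + b *s Borel_rep g s"
  have [measurable]: "(\<lambda>s. a *s Borel_rep f s) \<in> borel_measurable borel" for a f
    by (rule measurable_compose [OF Borel_rep_measurable scaleC_measurable])
  have "AE s in unit_leb. rep_linf (a *\<^sub>C f + b *\<^sub>C g) s = ?h s"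
    using rep_linf_add [of "a *\<^sub>C f" "b *\<^sub>C g"] rep_linf_scaleC [of a f] rep_linf_scaleC [of b g]
      rep_linf_eq_Borel_rep [of f] rep_linf_eq_Borel_rep [of g]
    by eventually_elim simp
  then have 1: "AE x in unit_leb. rep_linf (transport t (a *\<^sub>C f + b *\<^sub>C g)) x = flow ?h t x"
    by (intro rep_transport t) measurable
  have "flow ?h t x = a *s flow (Borel_rep f) t x + b *s flow (Borel_rep g) t x" for x
    by (simp add: vec_eq_iff arrival_linear)
  with 1 have "AE x in unit_leb. rep_linf (transport t (a *\<^sub>C f + b *\<^sub>C g)) x =
      rep_linf (a *\<^sub>C transport t f + b *\<^sub>C transport t g) x"
    using rep_linf_add [of "a *\<^sub>C transport t f" "b *\<^sub>C transport t g"]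
      rep_linf_scaleC [of a "transport t f"] rep_linf_scaleC [of b "transport t g"]
      rep_transport [OF Borel_rep_measurable rep_linf_eq_Borel_rep t, of f]
      rep_transport [OF Borel_rep_measurable rep_linf_eq_Borel_rep t, of g]
    by (auto elim!: eventually_elim2 AE_mp)
  then show ?thesis by (simp add: rep_linf_AE_eq)
qed

lemma scaleC_one: "1 *\<^sub>C (f :: 'm linf) = f"
  using scaleC_of_real [of 1 f] by simp

lemma transport_add: "0 \<le> t \<Longrightarrow> transport t (f + g) = transport t f + transport t g"
  using transport_linear [of t 1 f 1 g] by (simp add: scaleC_one)

lemma transport_scaleC: "0 \<le> t \<Longrightarrow> transport t (a *\<^sub>C f) = a *\<^sub>C transport t f"
  using transport_linear [of t a f 0 f] scaleC_of_real [of 0, where 'a = "'m linf"] by simp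

lemma bounded_clinear_transport:
  assumes "0 \<le> t" shows "bounded_clinear_op (transport t)"
  unfolding bounded_clinear_op_def
proof (intro conjI allI)
  show "bounded_linear (transport t)"
    by (rule bounded_linear_intro [where K = "growth_factor * exp (growth * t)"])
      (use assms norm_transport_le [OF assms] in \<open>simp_all add: transport_add transport_scaleC scaleR_linf_eq_scaleC mult.commute\<close>)
qed (use assms transport_scaleC in auto)

lemma onorm_transport_le:
  "0 \<le> t \<Longrightarrow> onorm (transport t) \<le> growth_factor * exp (growth * t)"
  by (rule onorm_bound) (auto simp: growth_factor_nonneg norm_transport_le)

lemma growth_factor_ge_1: "1 \<le> growth_factor"
proof -
  fix j :: 'm
  have "1 \<le> exp (growth / c j)" using growth_nonneg c_pos [of j] by simp
  also have "\<dots> \<le> growth_factor"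
    unfolding growth_factor_def by (rule member_le_sum) auto
  finally show ?thesis .
qed

lemma transport_0: "transport 0 f = f"
proof -
  have "AE x in lborel. x \<noteq> (1 :: real)" by (rule AE_lborel_singleton)
  then have "AE x in unit_leb. x \<noteq> 1" unfolding AE_unit_leb_iff by eventually_elim simp
  then have "AE x in unit_leb. rep_linf (transport 0 f) x = rep_linf f x"
    using rep_transport [OF Borel_rep_measurable rep_linf_eq_Borel_rep order_refl, of f]
      rep_linf_eq_Borel_rep [of f] AE_space
  proof eventually_elim
    case (elim x)
    have "arrival (Borel_rep f) (x / c j) j = Borel_rep f x $ j" for j
      using elim c_pos [of j] by (simp add: arrival_initial)
    then have "flow (Borel_rep f) 0 x = Borel_rep f x" by (simp add: vec_eq_iff)
    with elim show ?case by simp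
  qed
  then show ?thesis by (simp add: rep_linf_AE_eq)
qed

lemma transport_compose:
  assumes "0 \<le> s" "0 \<le> t" shows "transport (t + s) f = transport t (transport s f)"
proof -
  have 1: "AE x in unit_leb. rep_linf (transport s f) x = flow (Borel_rep f) s x"
    by (rule rep_transport [OF Borel_rep_measurable rep_linf_eq_Borel_rep assms(1)])
  have "AE x in unit_leb. rep_linf (transport (t + s) f) x = rep_linf (transport t (transport s f)) x"
    using rep_transport [OF flow_measurable [OF Borel_rep_measurable] 1 assms(2)]
      rep_transport [OF Borel_rep_measurable rep_linf_eq_Borel_rep add_nonneg_nonneg [OF assms(2,1)], of f]
      AE_space
    by eventually_elim (use assms in \<open>auto simp: flow_flow add.commute\<close>)
  then show ?thesis by (simp add: rep_linf_AE_eq)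
qed

end

section \<open>Integrals over intervals\<close>

lemma bounded_Borel_interval:
  fixes u :: "real \<Rightarrow> complex"
  assumes [measurable]: "u \<in> borel_measurable borel" and S: "\<And>x. x \<in> {a..b} \<Longrightarrow> cmod (u x) \<le> S"
  shows "set_integrable lborel {a..b} u"
  unfolding set_integrable_def
proof (rule integrableI_bounded_set_indicator)
  show "AE x in lborel. x \<in> {a..b} \<longrightarrow> norm (u x) \<le> S" using S by auto
qed (auto simp: emeasure_lborel_Icc_eq)

lemmas integrable_on_bounded_Borel = set_borel_integral_eq_integral(1) [OF bounded_Borel_interval]

lemma integral_unit_leb_interval:
  fixes u :: "real \<Rightarrow> complex"
  assumes [measurable]: "u \<in> borel_measurable borel" and S: "\<And>x. x \<in> {a..b} \<Longrightarrow> cmod (u x) \<le> S"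
    and ab: "0 \<le> a" "b \<le> 1"
  shows "(\<integral>s. u s * indicator {a..b} s \<partial>unit_leb) = integral {a..b} u"
proof -
  have "(\<integral>s. u s * indicator {a..b} s \<partial>unit_leb) =
      (\<integral>s. indicator {0..1} s *\<^sub>R (u s * indicator {a..b} s) \<partial>lebesgue)"
    by (rule integral_restrict_space) simp
  also have "(\<lambda>s. indicator {0..1} s *\<^sub>R (u s * indicator {a..b} s)) = (\<lambda>s. indicator {a..b} s *\<^sub>R u s)"
    using ab by (auto simp: indicator_def)
  also have "(\<integral>s. indicator {a..b} s *\<^sub>R u s \<partial>lebesgue) = (\<integral>s. indicator {a..b} s *\<^sub>R u s \<partial>lborel)"
    by (rule integral_completion) measurable
  also have "\<dots> = integral {a..b} u"
    using set_borel_integral_eq_integral(2) [OF bounded_Borel_interval [OF assms(1) S]]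
    by (simp add: set_lebesgue_integral_def)
  finally show ?thesis .
qed

lemma integral_rep_linf_interval:
  fixes f :: "'m::finite linf"
  assumes u: "u \<in> borel_measurable borel" "\<And>x. x \<in> {a..b} \<Longrightarrow> cmod (u x) \<le> S"
    and eq: "AE s in unit_leb. rep_linf f s $ j = u s" and ab: "0 \<le> a" "b \<le> 1"
  shows "interval_integral f j a b = integral {a..b} u"
proof -
  have "interval_integral f j a b = (\<integral>s. u s * indicator {a..b} s \<partial>unit_leb)"
  proof (rule integral_cong_AE)
    show "AE s in unit_leb. rep_linf f s $ j * indicator {a..b} s = u s * indicator {a..b} s"
      using eq by eventually_elim simp
  qed (use Icc_sets_unit_leb [OF ab] borel_measurable_unit_leb [OF u(1)] in measurable)
  then show ?thesis using integral_unit_leb_interval [OF u ab] by simp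
qed

text \<open>Equi-Lipschitz functions that tend to zero pointwise do so uniformly on compact intervals.\<close>

lemma uniform_limit_zero_lipschitz:
  fixes p :: "nat \<Rightarrow> real \<Rightarrow> complex"
  assumes lip: "\<And>n. L-lipschitz_on {0..R} (p n)"
    and lim: "\<And>x. x \<in> {0..R} \<Longrightarrow> (\<lambda>n. p n x) \<longlonglongrightarrow> 0" and e: "0 < e"
  shows "\<forall>\<^sub>F n in sequentially. \<forall>x\<in>{0..R}. cmod (p n x) < e"
proof -
  have L: "0 \<le> L" using lip lipschitz_on_nonneg by blast
  \<comment> \<open>\<open>L + 1\<close> instead of \<open>L\<close>, which may vanish\<close>
  define d where "d = e / (2 * (L + 1))"
  have d: "0 < d" using e L by (simp add: d_def)
  have cover: "{0..R} \<subseteq> (\<Union>x\<in>{0..R}. ball x d)" using d by auto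
  obtain k where k: "k \<subseteq> {0..R}" "finite k" "{0..R} \<subseteq> (\<Union>x\<in>k. ball x d)"
    by (rule compactE_image [OF compact_Icc _ cover]) auto
  have "\<forall>\<^sub>F n in sequentially. \<forall>x\<in>k. cmod (p n x) < e / 2"
  proof (intro eventually_ball_finite k ballI)
    fix x assume "x \<in> k"
    then show "\<forall>\<^sub>F n in sequentially. cmod (p n x) < e / 2"
      using tendstoD [OF lim, of x "e / 2"] k(1) e by auto
  qed
  then show ?thesis
  proof eventually_elim
    case (elim n)
    show ?case
    proof
      fix y assume y: "y \<in> {0..R}"
      then obtain x where x: "x \<in> k" "dist x y < d" using k(3) by auto
      have "cmod (p n y - p n x) \<le> L * dist x y"
        using lipschitz_onD [OF lip y, of x n] x(1) k(1) by (auto simp: dist_norm abs_minus_commute)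
      also have "\<dots> \<le> (L + 1) * d" using x(2) L by (intro mult_mono) auto
      also have "\<dots> = e / 2" using L by (simp add: d_def field_simps)
      finally show "cmod (p n y) < e"
        using bspec [OF elim x(1)] norm_triangle_sub [of "p n y" "p n x"] by linarith
    qed
  qed
qed

section \<open>Bi-continuity\<close>

context transport_network
begin

text \<open>The primitive of \<open>arrival f\<close>, as a gauge integral.\<close>

definition arrival_integral :: "(real \<Rightarrow> complex ^ 'm) \<Rightarrow> 'm \<Rightarrow> real \<Rightarrow> complex" where
  "arrival_integral f j y = integral {0..y} (\<lambda>u. arrival f u j)"

text \<open>Admissible initial states: Borel measurable on the line and bounded by \<open>S\<close> on \<open>[0, 1]\<close>.\<close>

definition bounded_Borel :: "real \<Rightarrow> (real \<Rightarrow> complex ^ 'm) \<Rightarrow> bool" where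
  "bounded_Borel S f \<longleftrightarrow> f \<in> borel_measurable borel \<and> (\<forall>x\<in>{0..1}. \<forall>j. cmod (f x $ j) \<le> S)"

lemma bounded_Borel_measurable: "bounded_Borel S f \<Longrightarrow> f \<in> borel_measurable borel"
  by (simp add: bounded_Borel_def)

lemma bounded_Borel_le: "bounded_Borel S f \<Longrightarrow> x \<in> {0..1} \<Longrightarrow> cmod (f x $ j) \<le> S"
  by (simp add: bounded_Borel_def)

lemma bounded_Borel_nonneg: "bounded_Borel S f \<Longrightarrow> 0 \<le> S"
  using order_trans [OF norm_ge_zero bounded_Borel_le [of S f 0]] by simp

lemma bounded_Borel_Borel_rep: "norm f \<le> S \<Longrightarrow> bounded_Borel S (Borel_rep f)"
  by (auto simp: bounded_Borel_def intro: order_trans [OF cmod_Borel_rep])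

lemma arrival_le:
  assumes "bounded_Borel S f" "0 \<le> t" "t \<le> R"
  shows "cmod (arrival f t j) \<le> S * exp (growth * R)"
proof -
  have "cmod (arrival f t j) \<le> S * exp (growth * t)"
    by (rule arrival_bound [OF bounded_Borel_le [OF assms(1)] assms(2)])
  also have "\<dots> \<le> S * exp (growth * R)"
    using assms growth_nonneg bounded_Borel_nonneg [OF assms(1)] by (simp add: mult_left_mono)
  finally show ?thesis .
qed

lemma arrival_integrable:
  assumes f: "bounded_Borel S f" and "0 \<le> a"
  shows "(\<lambda>u. arrival f u j) integrable_on {a..b}"
  by (rule integrable_on_bounded_Borel [where S = "S * exp (growth * b)"])
    (use assms in \<open>auto intro!: arrival_measurable bounded_Borel_measurable arrival_le\<close>)

lemma arrival_integral_diff: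
  assumes f: "bounded_Borel S f" and "0 \<le> x" "x \<le> y"
  shows "arrival_integral f j y - arrival_integral f j x = integral {x..y} (\<lambda>u. arrival f u j)"
  unfolding arrival_integral_def
  using Henstock_Kurzweil_Integration.integral_combine [OF assms(2,3) arrival_integrable [OF f order_refl, of j y]]
  by (simp add: algebra_simps)

lemma arrival_integral_lipschitz:
  assumes f: "bounded_Borel S f"
  shows "(S * exp (growth * R))-lipschitz_on {0..R} (arrival_integral f j)"
proof (rule lipschitz_onI)
  show "0 \<le> S * exp (growth * R)" using bounded_Borel_nonneg [OF f] by simp
  have *: "dist (arrival_integral f j x) (arrival_integral f j y) \<le> S * exp (growth * R) * dist x y"
    if "x \<in> {0..R}" "y \<in> {0..R}" "x \<le> y" for x y
  proof -
    have "cmod (integral {x..y} (\<lambda>u. arrival f u j)) \<le> S * exp (growth * R) * (y - x)"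
    proof -
      have "((\<lambda>u. arrival f u j) has_integral integral {x..y} (\<lambda>u. arrival f u j)) (cbox x y)"
        using that by (auto intro!: integrable_integral arrival_integrable [OF f])
      then have "cmod (integral {x..y} (\<lambda>u. arrival f u j)) \<le> S * exp (growth * R) * measure lborel (cbox x y)"
        using that bounded_Borel_nonneg [OF f] by (intro has_integral_bound) (auto intro: arrival_le [OF f])
      then show ?thesis using that by simp
    qed
    then show ?thesis
      using arrival_integral_diff [OF f, of x y j] that
      by (simp add: dist_norm norm_minus_commute [of "arrival_integral f j x"] abs_minus_commute [of x])
  qed
  show "dist (arrival_integral f j x) (arrival_integral f j y) \<le> S * exp (growth * R) * dist x y"
    if "x \<in> {0..R}" "y \<in> {0..R}" for x y
    using that * [of x y] * [of y x] by (cases "x \<le> y") (auto simp: dist_commute)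
qed

lemma arrival_integral_continuous:
  assumes f: "bounded_Borel S f" shows "continuous_on {0..} (arrival_integral f j)"
  unfolding continuous_on_eq_continuous_within
proof
  fix x :: real assume x: "x \<in> {0..}"
  have "continuous (at x within {0..x + 1}) (arrival_integral f j)"
    using lipschitz_on_continuous_on [OF arrival_integral_lipschitz [OF f, of "x + 1" j]] x
    by (simp add: continuous_on_eq_continuous_within)
  moreover have "at x within {0..x + 1} = at x within {0..}"
    by (rule at_within_nhd [where S = "{..<x + 1}"]) auto
  ultimately show "continuous (at x within {0..}) (arrival_integral f j)"
    by (simp add: continuous_within)
qed

lemma arrival_integral_initial:
  assumes f: "bounded_Borel S f" and y: "0 \<le> y" "c j * y \<le> 1"
  shows "arrival_integral f j y = integral {0..c j * y} (\<lambda>x. f x $ j) / c j"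
proof -
  have "(\<lambda>x. f x $ j) integrable_on {0..c j * y}"
    using y by (intro integrable_on_bounded_Borel [where S = S] bounded_Borel_le [OF f]
        measurable_compose [OF bounded_Borel_measurable [OF f] vec_nth_measurable]) auto
  then have "((\<lambda>x. f x $ j) has_integral integral {0..c j * y} (\<lambda>x. f x $ j)) (cbox 0 (c j * y))"
    by (simp add: integrable_integral)
  note * = has_integral_affinity' [OF this c_pos [of j], of 0]
  have box: "cbox ((0 - 0) /\<^sub>R c j) ((c j * y - 0) /\<^sub>R c j) = {0..y}"
    using c_pos [of j] by (simp add: field_simps)
  have "((\<lambda>u. f (c j * u) $ j) has_integral integral {0..c j * y} (\<lambda>x. f x $ j) / c j) {0..y}"
    using * unfolding box by (simp add: scaleR_conv_of_real divide_inverse mult.commute)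
  moreover have "((\<lambda>u. f (c j * u) $ j) has_integral i) {0..y} \<longleftrightarrow> ((\<lambda>u. arrival f u j) has_integral i) {0..y}" for i
  proof (rule has_integral_spike_eq [of "{1 / c j}"])
    fix u assume "u \<in> {0..y} - {1 / c j}"
    then have "c j * u \<le> c j * y" "c j * u \<noteq> 1" using c_pos [of j] by (auto simp: field_simps)
    then have "c j * u < 1" using y by simp
    then show "arrival f u j = f (c j * u) $ j" by (rule arrival_initial)
  qed simp
  ultimately show ?thesis unfolding arrival_integral_def by (simp add: integral_unique)
qed

lemma arrival_integral_delay:
  assumes f: "bounded_Borel S f" and y: "1 \<le> c j * y"
  shows "arrival_integral f j y = arrival_integral f j (1 / c j) +
    (\<Sum>k\<in>UNIV. K $ j $ k * arrival_integral f k (y - 1 / c j))"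
proof -
  have y': "1 / c j \<le> y" using y c_pos [of j] by (simp add: field_simps)
  have "arrival_integral f j y - arrival_integral f j (1 / c j) = integral {1 / c j..y} (\<lambda>u. arrival f u j)"
    using c_pos [of j] y' by (intro arrival_integral_diff [OF f]) auto
  also have "((\<lambda>u. arrival f u j) has_integral
      (\<Sum>k\<in>UNIV. K $ j $ k * arrival_integral f k (y - 1 / c j))) {1 / c j..y}"
  proof (rule has_integral_eq)
    show "((\<lambda>u. \<Sum>k\<in>UNIV. K $ j $ k * arrival f (u - 1 / c j) k) has_integral
      (\<Sum>k\<in>UNIV. K $ j $ k * arrival_integral f k (y - 1 / c j))) {1 / c j..y}"
    proof (intro has_integral_sum has_integral_mult_right)
      fix k
      have "((\<lambda>u. arrival f u k) has_integral arrival_integral f k (y - 1 / c j)) {0..y - 1 / c j}"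
        unfolding arrival_integral_def by (intro integrable_integral arrival_integrable [OF f]) simp
      then show "((\<lambda>u. arrival f (u - 1 / c j) k) has_integral arrival_integral f k (y - 1 / c j)) {1 / c j..y}"
        by (subst has_integral_shift_real_ivl_iff [of _ _ _ _ "1 / c j"]) simp
    qed simp
    show "(\<Sum>k\<in>UNIV. K $ j $ k * arrival f (u - 1 / c j) k) = arrival f u j" if "u \<in> {1 / c j..y}" for u
      using that c_pos [of j] by (subst arrival_delay) (auto simp: field_simps)
  qed
  then have "integral {1 / c j..y} (\<lambda>u. arrival f u j) =
      (\<Sum>k\<in>UNIV. K $ j $ k * arrival_integral f k (y - 1 / c j))"
    by (rule integral_unique)
  finally show ?thesis by (simp add: algebra_simps)
qed

text \<open>The integral of the flow over an interval is a difference of values of the primitive.\<close>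

lemma transport_interval:
  assumes f: "bounded_Borel S f0" and eq: "AE s in unit_leb. rep_linf f s = f0 s" and t: "0 \<le> t"
    and ab: "0 \<le> a" "a \<le> b" "b \<le> 1"
  shows "interval_integral (transport t f) j a b =
    c j * (arrival_integral f0 j (t + b / c j) - arrival_integral f0 j (t + a / c j))"
proof -
  have "interval_integral (transport t f) j a b =
      integral {a..b} (\<lambda>x. arrival f0 (t + x / c j) j)"
  proof (rule integral_rep_linf_interval)
    show "(\<lambda>x. arrival f0 (t + x / c j) j) \<in> borel_measurable borel"
      by (rule measurable_compose [OF _ arrival_measurable [OF bounded_Borel_measurable [OF f]]]) measurable
    show "cmod (arrival f0 (t + x / c j) j) \<le> S * exp (growth * (t + b / c j))" if "x \<in> {a..b}" for x
      using that t ab c_pos [of j] by (intro arrival_le [OF f]) (auto simp: divide_right_mono)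
    show "AE s in unit_leb. rep_linf (transport t f) s $ j = arrival f0 (t + s / c j) j"
      using rep_transport [OF bounded_Borel_measurable [OF f] eq t] by eventually_elim simp
  qed (use ab in auto)
  also have "((\<lambda>u. arrival f0 u j) has_integral
      arrival_integral f0 j (t + b / c j) - arrival_integral f0 j (t + a / c j)) (cbox (t + a / c j) (t + b / c j))"
    using c_pos [of j] t ab
    by (subst arrival_integral_diff [OF f]) (auto intro!: integrable_integral arrival_integrable [OF f] simp: divide_right_mono)
  note * = has_integral_affinity' [OF this, of "1 / c j" t]
  have box: "cbox ((t + a / c j - t) /\<^sub>R (1 / c j)) ((t + b / c j - t) /\<^sub>R (1 / c j)) = {a..b}"
    using c_pos [of j] by simp
  have "(\<lambda>x. arrival f0 ((1 / c j) *\<^sub>R x + t) j) = (\<lambda>x. arrival f0 (t + x / c j) j)"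
    by (simp add: add.commute [of t])
  with * have "((\<lambda>x. arrival f0 (t + x / c j) j) has_integral
      c j * (arrival_integral f0 j (t + b / c j) - arrival_integral f0 j (t + a / c j))) {a..b}"
    unfolding box using c_pos [of j] by (simp add: scaleR_conv_of_real)
  then have "integral {a..b} (\<lambda>x. arrival f0 (t + x / c j) j) =
      c j * (arrival_integral f0 j (t + b / c j) - arrival_integral f0 j (t + a / c j))"
    by (rule integral_unique)
  finally show ?thesis .
qed

lemma transport_norm_le:
  assumes "0 \<le> t" "t \<le> R" "norm f \<le> S"
  shows "norm (transport t f) \<le> growth_factor * exp (growth * R) * S"
proof -
  have "norm (transport t f) \<le> growth_factor * exp (growth * t) * norm f"
    by (rule norm_transport_le [OF assms(1)])
  also have "\<dots> \<le> growth_factor * exp (growth * R) * S"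
    using assms growth_nonneg by (intro mult_mono mult_nonneg_nonneg growth_factor_nonneg) (auto simp: mult_left_mono)
  finally show ?thesis .
qed

lemma transport_continuous: "continuous_map (top_of_set {0..}) weak_star (\<lambda>t. transport t f)"
proof (rule continuous_map_into_weak_star)
  fix g :: "real \<Rightarrow> complex ^ 'm" assume g: "integrable unit_leb g"
  note rep = bounded_Borel_Borel_rep [OF order_refl, of f]
  have "continuous_on {0..} (\<lambda>t. linf_pairing (transport t f) g)"
    unfolding continuous_on_def
  proof
    fix t0 :: real assume t0: "t0 \<in> {0..}"
    have ge: "\<forall>\<^sub>F t in at t0 within {0..}. 0 \<le> t"
      by (simp add: eventually_at_filter)
    show "((\<lambda>t. linf_pairing (transport t f) g) \<longlongrightarrow> linf_pairing (transport t0 f) g) (at t0 within {0..})"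
    proof (rule linf_pairing_tendsto_intervals [OF _ _ g])
      have "((\<lambda>t. t) \<longlongrightarrow> t0) (at t0 within {0..})" by (rule tendsto_ident_at)
      then have "\<forall>\<^sub>F t in at t0 within {0..}. t < t0 + 1"
        by (rule order_tendstoD) simp
      with ge show "\<forall>\<^sub>F t in at t0 within {0..}. norm (transport t f) \<le>
          growth_factor * exp (growth * (t0 + 1)) * norm f"
        by eventually_elim (rule transport_norm_le, auto)
      fix j and a b :: real assume ab: "0 \<le> a" "a \<le> b" "b \<le> 1"
      let ?p = "arrival_integral (Borel_rep f) j"
      have lim: "((\<lambda>t. ?p (t + x)) \<longlongrightarrow> ?p (t0 + x)) (at t0 within {0..})" if "0 \<le> x" for x
      proof -
        have "continuous_on {0..} (\<lambda>t. ?p (t + x))"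
          using that by (intro continuous_on_compose2 [OF arrival_integral_continuous [OF rep]] continuous_intros) auto
        with t0 show ?thesis by (simp add: continuous_on_def)
      qed
      have "((\<lambda>t. c j * (?p (t + b / c j) - ?p (t + a / c j))) \<longlongrightarrow>
          c j * (?p (t0 + b / c j) - ?p (t0 + a / c j))) (at t0 within {0..})"
        using ab c_pos [of j] by (intro tendsto_intros lim) auto
      then have "((\<lambda>t. c j * (?p (t + b / c j) - ?p (t + a / c j))) \<longlongrightarrow>
          interval_integral (transport t0 f) j a b) (at t0 within {0..})"
        using t0 by (subst transport_interval [OF rep rep_linf_eq_Borel_rep _ ab]) auto
      then show "((\<lambda>t. interval_integral (transport t f) j a b) \<longlongrightarrow>
          interval_integral (transport t0 f) j a b) (at t0 within {0..})"
        by (rule Lim_transform_eventually)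
          (use ge in eventually_elim, simp add: transport_interval [OF rep rep_linf_eq_Borel_rep _ ab])
    qed
  qed
  then show "continuous_map (top_of_set {0..}) euclidean (\<lambda>t. linf_pairing (transport t f) g)"
    by simp
qed

text \<open>Weak-star convergence of the initial states gives the claim before the first delay; the delay equation propagates it.\<close>

lemma arrival_integral_tendsto_zero:
  fixes f :: "nat \<Rightarrow> 'm linf"
  assumes lim: "limitin weak_star f 0 sequentially" and bdd: "\<And>n. norm (f n) \<le> S" and "0 \<le> y"
  shows "(\<lambda>n. arrival_integral (Borel_rep (f n)) j y) \<longlonglongrightarrow> 0"
proof -
  note rep = bounded_Borel_Borel_rep [OF bdd]
  have init: "(\<lambda>n. arrival_integral (Borel_rep (f n)) j y) \<longlonglongrightarrow> 0" if y: "0 \<le> y" "c j * y \<le> 1" for y j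
  proof -
    have cy: "0 \<le> c j * y" using c_pos [of j] y by simp
    let ?g = "\<lambda>s. axis j (indicator {0..c j * y} s) :: complex ^ 'm"
    have g: "integrable unit_leb ?g"
      using y by (intro integrable_axis integrable_indicator_Icc) auto
    have "arrival_integral (Borel_rep (f n)) j y = linf_pairing (f n) ?g / c j" for n
    proof -
      have "linf_pairing (f n) ?g = integral {0..c j * y} (\<lambda>x. Borel_rep (f n) x $ j)"
        unfolding linf_pairing_axis
      proof (rule integral_rep_linf_interval)
        show "(\<lambda>x. Borel_rep (f n) x $ j) \<in> borel_measurable borel"
          by (rule measurable_compose [OF Borel_rep_measurable vec_nth_measurable])
        show "AE s in unit_leb. rep_linf (f n) s $ j = Borel_rep (f n) s $ j"
          using rep_linf_eq_Borel_rep [of "f n"] by eventually_elim simp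
      qed (use cmod_Borel_rep y in auto)
      then show ?thesis by (simp add: arrival_integral_initial [OF rep y])
    qed
    moreover have "(\<lambda>n. linf_pairing (f n) ?g) \<longlonglongrightarrow> linf_pairing 0 ?g"
      using lim g by (simp add: limitin_weak_star_iff)
    then have "(\<lambda>n. linf_pairing (f n) ?g / c j) \<longlonglongrightarrow> linf_pairing 0 ?g / c j"
      by (intro tendsto_divide tendsto_const) (use c_pos [of j] in auto)
    ultimately show ?thesis by (simp add: linf_pairing_zero g)
  qed
  have "0 \<le> y \<longrightarrow> (\<lambda>n. arrival_integral (Borel_rep (f n)) j y) \<longlonglongrightarrow> 0"
  proof (induction y j rule: delay_induct)
    case (1 y j)
    then show ?case using init by simp
  next
    case (2 y j)
    have y: "0 \<le> y - 1 / c j" using 2(1) c_pos [of j] by (simp add: field_simps)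
    have "(\<lambda>n. arrival_integral (Borel_rep (f n)) j (1 / c j) +
        (\<Sum>k\<in>UNIV. K $ j $ k * arrival_integral (Borel_rep (f n)) k (y - 1 / c j))) \<longlonglongrightarrow>
        0 + (\<Sum>k\<in>(UNIV :: 'm set). 0)"
    proof (intro tendsto_add tendsto_sum tendsto_mult_right_zero)
      show "(\<lambda>n. arrival_integral (Borel_rep (f n)) j (1 / c j)) \<longlonglongrightarrow> 0"
        using c_pos [of j] by (intro init) auto
    qed (use 2(2) y in auto)
    then show ?case by (simp add: arrival_integral_delay [OF rep 2(1)])
  qed
  with \<open>0 \<le> y\<close> show ?thesis by simp
qed

lemma transport_equicontinuous:
  fixes f :: "nat \<Rightarrow> 'm linf"
  assumes bdd: "bounded (range f)" and lim: "limitin weak_star f 0 sequentially"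
    and U: "openin weak_star U" "0 \<in> U"
  shows "\<forall>\<^sub>F n in sequentially. \<forall>s\<in>{0..t0}. transport s (f n) \<in> U"
proof -
  obtain S where S: "\<And>n. norm (f n) \<le> S" using bdd by (auto simp: bounded_iff)
  note rep = bounded_Borel_Borel_rep [OF S]
  \<comment> \<open>convergence along this filter is convergence that is uniform in the time\<close>
  define F where "F = sequentially \<times>\<^sub>F principal {0..t0}"
  have ev: "(\<forall>\<^sub>F x in F. P (fst x) (snd x)) \<longleftrightarrow> (\<forall>\<^sub>F n in sequentially. \<forall>s\<in>{0..t0}. P n s)"
    for P :: "nat \<Rightarrow> real \<Rightarrow> bool"
    unfolding F_def eventually_prod_filter eventually_principal
  proof
    assume "\<exists>Pf Pg. eventually Pf sequentially \<and> (\<forall>s\<in>{0..t0}. Pg s) \<and>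
        (\<forall>n s. Pf n \<longrightarrow> Pg s \<longrightarrow> P (fst (n, s)) (snd (n, s)))"
    then show "\<forall>\<^sub>F n in sequentially. \<forall>s\<in>{0..t0}. P n s" by (auto elim: eventually_mono)
  next
    assume "\<forall>\<^sub>F n in sequentially. \<forall>s\<in>{0..t0}. P n s"
    then show "\<exists>Pf Pg. eventually Pf sequentially \<and> (\<forall>s\<in>{0..t0}. Pg s) \<and>
        (\<forall>n s. Pf n \<longrightarrow> Pg s \<longrightarrow> P (fst (n, s)) (snd (n, s)))"
      by (intro exI [of _ "\<lambda>n. \<forall>s\<in>{0..t0}. P n s"] exI [of _ "\<lambda>s. s \<in> {0..t0}"]) auto
  qed
  have "((\<lambda>x. linf_pairing (transport (snd x) (f (fst x))) g) \<longlongrightarrow> linf_pairing 0 g) F"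
    if g: "integrable unit_leb g" for g
  proof (rule linf_pairing_tendsto_intervals [OF _ _ g])
    show "\<forall>\<^sub>F x in F. norm (transport (snd x) (f (fst x))) \<le>
        growth_factor * exp (growth * t0) * S"
      by (subst ev) (use S in \<open>auto intro!: always_eventually transport_norm_le\<close>)
    fix j and a b :: real assume ab: "0 \<le> a" "a \<le> b" "b \<le> 1"
    let ?p = "\<lambda>n. arrival_integral (Borel_rep (f n)) j"
    let ?R = "t0 + 1 / c j"
    have "((\<lambda>x. interval_integral (transport (snd x) (f (fst x))) j a b) \<longlongrightarrow> 0) F"
    proof (rule tendstoI)
      fix e :: real assume e: "0 < e"
      have "\<forall>\<^sub>F n in sequentially. \<forall>x\<in>{0..?R}. cmod (?p n x) < e / (2 * c j)"
        using e c_pos [of j]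
        by (intro uniform_limit_zero_lipschitz [OF arrival_integral_lipschitz [OF rep]]
            arrival_integral_tendsto_zero [OF lim S]) auto
      then have "\<forall>\<^sub>F n in sequentially. \<forall>s\<in>{0..t0}.
          dist (interval_integral (transport s (f n)) j a b) 0 < e"
      proof eventually_elim
        case (elim n)
        show ?case
        proof
          fix s assume s: "s \<in> {0..t0}"
          have "s + a / c j \<in> {0..?R}" "s + b / c j \<in> {0..?R}"
            using s ab c_pos [of j] by (auto intro!: add_mono divide_right_mono)
          with elim have "cmod (?p n (s + a / c j)) < e / (2 * c j)" "cmod (?p n (s + b / c j)) < e / (2 * c j)"
            by blast+
          then have "cmod (?p n (s + b / c j) - ?p n (s + a / c j)) < e / (2 * c j) + e / (2 * c j)"
            using norm_triangle_ineq4 [of "?p n (s + b / c j)" "?p n (s + a / c j)"] by simp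
          then have "c j * cmod (?p n (s + b / c j) - ?p n (s + a / c j)) < e"
            using c_pos [of j] by (simp add: field_simps)
          then show "dist (interval_integral (transport s (f n)) j a b) 0 < e"
            using s c_pos [of j]
            by (simp add: transport_interval [OF rep rep_linf_eq_Borel_rep _ ab] norm_mult)
        qed
      qed
      then show "\<forall>\<^sub>F x in F. dist (interval_integral (transport (snd x) (f (fst x))) j a b) 0 < e"
        by (subst ev)
    qed
    moreover have "interval_integral 0 j a b = 0"
      using linf_pairing_axis [of 0 j "indicator {a..b}"] ab
        linf_pairing_zero [OF integrable_axis [OF integrable_indicator_Icc, of a b j]] by simp
    ultimately show "((\<lambda>x. interval_integral (transport (snd x) (f (fst x))) j a b) \<longlongrightarrow>
        interval_integral 0 j a b) F" by simp
  qed
  then have "limitin weak_star (\<lambda>x. transport (snd x) (f (fst x))) 0 F"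
    by (simp add: limitin_weak_star_iff)
  then have "\<forall>\<^sub>F x in F. transport (snd x) (f (fst x)) \<in> U"
    using U by (simp add: limitin_def)
  then show ?thesis by (subst (asm) ev)
qed

lemma bicontinuous_transport: "bicontinuous_semigroup weak_star transport"
  unfolding bicontinuous_semigroup_def
proof (intro conjI allI impI)
  show "transport 0 = id" by (auto simp: transport_0)
  show "transport (t + s) = transport t \<circ> transport s" if "0 \<le> s" "0 \<le> t" for s t
    by (rule ext) (simp add: transport_compose that)
  show "\<exists>M\<ge>1. \<exists>\<omega>. \<forall>t\<ge>0. onorm (transport t) \<le> M * exp (\<omega> * t)"
    using growth_factor_ge_1 onorm_transport_le by blast
  show "bicontinuous_setting (weak_star :: 'm linf topology)"
    by (rule bicontinuous_setting_weak_star)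
  show "bounded_clinear_op (transport t)" if "0 \<le> t" for t
    by (rule bounded_clinear_transport [OF that])
  show "continuous_map (top_of_set {0..}) weak_star (\<lambda>t. transport t f)" for f
    by (rule transport_continuous)
  show "\<forall>\<^sub>F n in sequentially. \<forall>s\<in>{0..t0}. transport s (f n) \<in> U"
    if "bounded (range f) \<and> limitin weak_star f 0 sequentially" "openin weak_star U \<and> 0 \<in> U" for f t0 U
    using that transport_equicontinuous by blast
qed

end

section \<open>Smooth functions\<close>

text \<open>
  \<open>times_differentiable n f\<close> says that \<open>f\<close> can be differentiated \<open>n + 1\<close> times; the recursion from the
  inside suits proofs by induction that generalise over \<open>f\<close>.
\<close>

primrec times_differentiable :: "nat \<Rightarrow> (real \<Rightarrow> real) \<Rightarrow> bool" where
  "times_differentiable 0 f \<longleftrightarrow> (\<forall>x. f differentiable at x)"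
| "times_differentiable (Suc n) f \<longleftrightarrow> (\<forall>x. f differentiable at x) \<and> times_differentiable n (deriv f)"

definition smooth :: "(real \<Rightarrow> real) \<Rightarrow> bool" where
  "smooth f \<longleftrightarrow> (\<forall>n. times_differentiable n f)"

lemma smooth_iff_funpow: "smooth f \<longleftrightarrow> (\<forall>n x. (deriv ^^ n) f differentiable at x)"
proof
  have "times_differentiable n f \<Longrightarrow> (deriv ^^ n) f differentiable at x" for n x
    by (induction n arbitrary: f) (auto simp: funpow_Suc_right simp del: funpow.simps(2))
  then show "smooth f \<Longrightarrow> \<forall>n x. (deriv ^^ n) f differentiable at x"
    by (simp add: smooth_def)
next
  have "(\<forall>n x. (deriv ^^ n) f differentiable at x) \<Longrightarrow> times_differentiable k f" for k
  proof (induction k arbitrary: f)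
    case 0
    then show ?case by (auto dest: spec [of _ 0])
  next
    case (Suc k)
    have "\<forall>n x. (deriv ^^ n) (deriv f) differentiable at x"
      using Suc.prems by (metis comp_apply funpow_Suc_right)
    with Suc show ?case by (auto dest: spec [of _ 0])
  qed
  then show "\<forall>n x. (deriv ^^ n) f differentiable at x \<Longrightarrow> smooth f"
    by (simp add: smooth_def)
qed

lemma smooth_differentiable: "smooth f \<Longrightarrow> f differentiable at x"
  unfolding smooth_def by (metis times_differentiable.simps(1))

lemma smooth_DERIV: "smooth f \<Longrightarrow> (f has_real_derivative deriv f x) (at x)"
  by (simp add: DERIV_deriv_iff_real_differentiable smooth_differentiable)

lemma smooth_deriv: "smooth f \<Longrightarrow> smooth (deriv f)"
  unfolding smooth_def by (metis times_differentiable.simps(2))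

lemma smooth_of_deriv:
  assumes "\<And>x. (f has_real_derivative g x) (at x)" "smooth g" shows "smooth f"
  unfolding smooth_def
proof
  have "deriv f = g" using assms(1) DERIV_imp_deriv by blast
  moreover have "f differentiable at x" for x
    using assms(1) real_differentiable_def by blast
  ultimately show "times_differentiable n f" for n
    using assms(2) by (cases n) (auto simp: smooth_def)
qed

text \<open>A class of functions that is closed under differentiation consists of smooth functions.\<close>

lemma smooth_coinduct:
  assumes "f \<in> F" and step: "\<And>f. f \<in> F \<Longrightarrow> \<exists>g\<in>F. \<forall>x. (f has_real_derivative g x) (at x)"
  shows "smooth f"
  unfolding smooth_def
proof
  fix n
  show "times_differentiable n f"
    using assms(1)
  proof (induction n arbitrary: f)
    case 0
    then show ?case using step real_differentiable_def by (metis times_differentiable.simps(1))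
  next
    case (Suc n)
    then obtain g where g: "g \<in> F" "\<And>x. (f has_real_derivative g x) (at x)" using step by blast
    then have "deriv f = g" using DERIV_imp_deriv by blast
    with g Suc show ?case using real_differentiable_def by auto
  qed
qed

lemma smooth_lincomb:
  assumes "smooth f" "smooth g" shows "smooth (\<lambda>x. a * f x + b * g x)"
proof (rule smooth_coinduct [of _ "{\<lambda>x. a * f x + b * g x | f g. smooth f \<and> smooth g}"])
  fix h assume "h \<in> {\<lambda>x. a * f x + b * g x | f g. smooth f \<and> smooth g}"
  then obtain f g where h: "h = (\<lambda>x. a * f x + b * g x)" "smooth f" "smooth g" by blast
  then show "\<exists>k\<in>{\<lambda>x. a * f x + b * g x | f g. smooth f \<and> smooth g}. \<forall>x. (h has_real_derivative k x) (at x)"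
    by (intro bexI [of _ "\<lambda>x. a * deriv f x + b * deriv g x"])
      (auto intro!: smooth_deriv DERIV_add DERIV_cmult smooth_DERIV)
qed (use assms in blast)

lemma smooth_affine:
  assumes "smooth f" shows "smooth (\<lambda>x. f (m * x + k))"
proof -
  have "smooth (\<lambda>x. 1 * f (m * x + k))"
  proof (rule smooth_coinduct [of _ "{\<lambda>x. r * f (m * x + k) | f r. smooth f}"])
    fix h assume "h \<in> {\<lambda>x. r * f (m * x + k) | f r. smooth f}"
    then obtain f r where h: "h = (\<lambda>x. r * f (m * x + k))" "smooth f" by blast
    have "(h has_real_derivative (r * m) * deriv f (m * x + k)) (at x)" for x
    proof -
      have "((\<lambda>x. m * x + k) has_real_derivative m) (at x)"
        by (auto intro!: derivative_eq_intros)
      from DERIV_cmult [OF DERIV_chain2 [OF smooth_DERIV [OF h(2)] this], of r] show ?thesis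
        by (simp add: h(1) mult_ac)
    qed
    with h(2) smooth_deriv show "\<exists>k\<in>{\<lambda>x. r * f (m * x + k) | f r. smooth f}. \<forall>x. (h has_real_derivative k x) (at x)"
      by (intro bexI [of _ "\<lambda>x. (r * m) * deriv f (m * x + k)"]) blast+
  qed (use assms in blast)
  then show ?thesis by simp
qed

lemma smooth_mult:
  assumes "smooth f" "smooth g" shows "smooth (\<lambda>x. f x * g x)"
proof -
  have add: "times_differentiable n (\<lambda>x. f x + g x)"
    if "times_differentiable n f" "times_differentiable n g" for n f g
    using that
  proof (induction n arbitrary: f g)
    case (Suc n)
    then have "deriv (\<lambda>x. f x + g x) = (\<lambda>x. deriv f x + deriv g x)"
      by (intro ext DERIV_imp_deriv DERIV_add) (auto simp: DERIV_deriv_iff_real_differentiable)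
    with Suc show ?case by auto
  qed auto
  have less: "times_differentiable n f" if "times_differentiable (Suc n) f" for n f
    using that by (induction n arbitrary: f) auto
  have "times_differentiable n (\<lambda>x. f x * g x)"
    if "times_differentiable n f" "times_differentiable n g" for n
    using that
  proof (induction n arbitrary: f g)
    case (Suc n)
    then have "deriv (\<lambda>x. f x * g x) = (\<lambda>x. deriv f x * g x + deriv g x * f x)"
      by (intro ext DERIV_imp_deriv DERIV_mult) (auto simp: DERIV_deriv_iff_real_differentiable)
    moreover have "times_differentiable n (\<lambda>x. deriv f x * g x + deriv g x * f x)"
      using Suc less by (intro add) auto
    ultimately show ?case using Suc.prems by auto
  qed auto
  with assms show ?thesis by (simp add: smooth_def)
qed

text \<open>
  The function \<open>exp (- 1 / x)\<close>, extended by \<open>0\<close>, is smooth: its derivatives have the form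
  \<open>p (1 / x) * exp (- 1 / x)\<close> with polynomials \<open>p\<close>.
\<close>

definition flat_poly :: "real poly \<Rightarrow> real \<Rightarrow> real" where
  "flat_poly p x = (if 0 < x then poly p (1 / x) * exp (- (1 / x)) else 0)"

lemma poly_exp_tendsto_0: "((\<lambda>y :: real. poly p y * exp (- y)) \<longlongrightarrow> 0) at_top"
proof -
  have "((\<lambda>y :: real. \<Sum>i\<le>degree p. coeff p i * (y ^ i / exp y)) \<longlongrightarrow> (\<Sum>i\<le>degree p. coeff p i * 0)) at_top"
    by (intro tendsto_sum tendsto_mult tendsto_const tendsto_power_div_exp_0)
  then show ?thesis
    by (simp add: poly_altdef sum_distrib_right exp_minus divide_inverse mult.assoc)
qed

lemma flat_poly_tendsto_0: "(flat_poly p \<longlongrightarrow> 0) (at_right 0)"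
proof (rule Lim_transform_eventually)
  show "((\<lambda>x. poly p (inverse x) * exp (- inverse x)) \<longlongrightarrow> 0) (at_right 0)"
    by (rule filterlim_compose [OF poly_exp_tendsto_0 filterlim_inverse_at_top_right])
  show "\<forall>\<^sub>F x in at_right 0. poly p (inverse x) * exp (- inverse x) = flat_poly p x"
    by (auto simp: eventually_at_filter flat_poly_def inverse_eq_divide)
qed

lemma flat_poly_DERIV:
  "(flat_poly p has_real_derivative flat_poly ([:0, 0, 1:] * (p - pderiv p)) x) (at x)"
proof -
  consider "x < 0" | "x = 0" | "0 < x" by linarith
  then show ?thesis
  proof cases
    case 1
    have "((\<lambda>x. 0 :: real) has_real_derivative 0) (at x)" by simp
    then have "(flat_poly p has_real_derivative 0) (at x)"
      by (rule has_field_derivative_transform_within_open [where S = "{..<0}"])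
        (use 1 in \<open>auto simp: flat_poly_def\<close>)
    with 1 show ?thesis by (simp add: flat_poly_def)
  next
    case 2
    have "((\<lambda>h. (flat_poly p (0 + h) - flat_poly p 0) / h) \<longlongrightarrow> 0) (at 0)"
    proof (rule filterlim_split_at)
      have "\<forall>\<^sub>F h in at_left 0. 0 = (flat_poly p (0 + h) - flat_poly p 0) / h"
        by (auto simp: eventually_at_filter flat_poly_def)
      then show "((\<lambda>h. (flat_poly p (0 + h) - flat_poly p 0) / h) \<longlongrightarrow> 0) (at_left 0)"
        by (rule Lim_transform_eventually [OF tendsto_const])
      have "\<forall>\<^sub>F h in at_right 0. flat_poly ([:0, 1:] * p) h = (flat_poly p (0 + h) - flat_poly p 0) / h"
        by (auto simp: eventually_at_filter flat_poly_def)
      then show "((\<lambda>h. (flat_poly p (0 + h) - flat_poly p 0) / h) \<longlongrightarrow> 0) (at_right 0)"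
        by (rule Lim_transform_eventually [OF flat_poly_tendsto_0])
    qed
    with 2 show ?thesis by (simp add: DERIV_def flat_poly_def)
  next
    case 3
    have "((\<lambda>x. poly p (1 / x) * exp (- (1 / x))) has_real_derivative
        flat_poly ([:0, 0, 1:] * (p - pderiv p)) x) (at x)"
      using 3 by (auto intro!: derivative_eq_intros DERIV_chain2 [OF poly_DERIV]
          simp: flat_poly_def field_simps power2_eq_square)
    then show ?thesis
      by (rule has_field_derivative_transform_within_open [where S = "{0<..}"])
        (use 3 in \<open>auto simp: flat_poly_def\<close>)
  qed
qed

lemma smooth_flat_poly: "smooth (flat_poly p)"
  by (rule smooth_coinduct [of _ "range flat_poly"]) (use flat_poly_DERIV in blast)+

section \<open>Test functions\<close>

lemma test_function_iff: "test_function \<phi> \<longleftrightarrow> smooth \<phi> \<and> closure {x. \<phi> x \<noteq> 0} \<subseteq> {0<..<1}"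
  by (simp add: test_function_def smooth_iff_funpow)

lemma test_functionI:
  assumes "smooth \<phi>" "0 < a" "b < 1" "\<And>x. x \<notin> {a..b} \<Longrightarrow> \<phi> x = 0"
  shows "test_function \<phi>"
proof -
  have "closure {x. \<phi> x \<noteq> 0} \<subseteq> {a..b}"
    using assms(4) by (intro closure_minimal) (blast, simp)
  with assms show ?thesis by (force simp: test_function_iff)
qed

lemma test_function_supportE:
  assumes "test_function \<phi>"
  obtains a b where "0 < a" "a < b" "b < 1" "\<And>x. x \<notin> {a..b} \<Longrightarrow> \<phi> x = 0"
proof -
  let ?S = "closure {x. \<phi> x \<noteq> 0}"
  have S: "?S \<subseteq> {0<..<1}" using assms by (simp add: test_function_iff)
  then have "compact ?S"
    by (intro compact_eq_bounded_closed [THEN iffD2] conjI bounded_subset [OF bounded_closed_interval [of 0 1]])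
      (auto simp: subset_eq)
  have ex: "\<exists>a b. 0 < a \<and> a < b \<and> b < 1 \<and> ?S \<subseteq> {a..b}"
  proof (cases "?S = {}")
    case True
    then show ?thesis by (intro exI [of _ "1/3"] exI [of _ "1/2"]) simp
  next
    case False
    obtain l where l: "l \<in> ?S" "\<forall>x\<in>?S. l \<le> x"
      using compact_attains_inf [OF \<open>compact ?S\<close> False] by blast
    obtain u where u: "u \<in> ?S" "\<forall>x\<in>?S. x \<le> u"
      using compact_attains_sup [OF \<open>compact ?S\<close> False] by blast
    have "0 < l" "u < 1" using l(1) u(1) S by auto
    moreover have "l \<le> u" using l u by blast
    ultimately show ?thesis using l(2) u(2)
      by (intro exI [of _ l] exI [of _ "(u + 1) / 2"]) force
  qed
  then obtain a b where "0 < a" "a < b" "b < 1" "?S \<subseteq> {a..b}" by blast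
  moreover have "\<phi> x = 0" if "x \<notin> {a..b}" for x
    using that \<open>?S \<subseteq> {a..b}\<close> closure_subset [of "{x. \<phi> x \<noteq> 0}"] by blast
  ultimately show ?thesis using that by blast
qed

lemma test_function_smooth: "test_function \<phi> \<Longrightarrow> smooth \<phi>"
  by (simp add: test_function_iff)

lemma smooth_continuous: "smooth \<phi> \<Longrightarrow> continuous_on A \<phi>"
  by (meson continuous_at_imp_continuous_on differentiable_imp_continuous_within smooth_differentiable)

lemma smooth_measurable: "smooth \<phi> \<Longrightarrow> \<phi> \<in> borel_measurable borel"
  by (intro borel_measurable_continuous_onI smooth_continuous)

lemma smooth_bounded_unit:
  assumes "smooth \<phi>" obtains B where "\<And>x. x \<in> {0..1} \<Longrightarrow> \<bar>\<phi> x\<bar> \<le> B"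
proof -
  have "bounded (\<phi> ` {0..1})"
    by (intro compact_imp_bounded compact_continuous_image smooth_continuous assms) simp
  then obtain B where "\<forall>x\<in>{0..1}. \<bar>\<phi> x\<bar> \<le> B" by (auto simp: bounded_iff)
  with that show ?thesis by blast
qed

text \<open>
  Test functions with values in \<open>[0, 1]\<close> that converge to the indicator of the open interval
  from \<open>a\<close> to \<open>b\<close>. The shift by \<open>- 1\<close> keeps the support at the distance \<open>1 / Suc n\<close> from \<open>a\<close> and \<open>b\<close>.
\<close>

definition bump :: "real \<Rightarrow> real \<Rightarrow> nat \<Rightarrow> real \<Rightarrow> real" where
  "bump a b n x = flat_poly 1 (real (Suc n) * (x - a) - 1) * flat_poly 1 (real (Suc n) * (b - x) - 1)"

lemma flat_poly_1_bounds: "0 \<le> flat_poly 1 x" "flat_poly 1 x \<le> 1"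
  by (auto simp: flat_poly_def)

lemma bump_bounds: "0 \<le> bump a b n x" "bump a b n x \<le> 1"
  unfolding bump_def using flat_poly_1_bounds by (auto intro: mult_le_one)

lemma smooth_bump: "smooth (bump a b n)"
proof -
  have "smooth (\<lambda>x. flat_poly 1 (real (Suc n) * x + (- real (Suc n) * a - 1)) *
      flat_poly 1 (- real (Suc n) * x + (real (Suc n) * b - 1)))"
    by (intro smooth_mult smooth_affine smooth_flat_poly)
  also have "(\<lambda>x. flat_poly 1 (real (Suc n) * x + (- real (Suc n) * a - 1)) *
      flat_poly 1 (- real (Suc n) * x + (real (Suc n) * b - 1))) = bump a b n"
    by (rule ext) (simp add: bump_def algebra_simps)
  finally show ?thesis .
qed

lemma test_function_bump:
  assumes "0 \<le> a" "b \<le> 1" shows "test_function (bump a b n)"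
proof (rule test_functionI [OF smooth_bump])
  have "0 < 1 / real (Suc n)" by simp
  with assms show "0 < a + 1 / real (Suc n)" "b - 1 / real (Suc n) < 1" by linarith+
  show "bump a b n x = 0" if "x \<notin> {a + 1 / real (Suc n)..b - 1 / real (Suc n)}" for x
  proof -
    have "real (Suc n) * (x - a) - 1 \<le> 0 \<or> real (Suc n) * (b - x) - 1 \<le> 0"
      using that by (auto simp: field_simps)
    then show ?thesis by (auto simp: bump_def flat_poly_def)
  qed
qed

lemma bump_tendsto: "(\<lambda>n. bump a b n x) \<longlonglongrightarrow> indicator {a<..<b} x"
proof (cases "x \<in> {a<..<b}")
  case True
  have lim: "(\<lambda>n. flat_poly 1 (real (Suc n) * d - 1)) \<longlonglongrightarrow> 1" if "0 < d" for d
  proof -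
    have top: "filterlim (\<lambda>n. real (Suc n) * d - 1) at_top sequentially"
    proof -
      have "filterlim (\<lambda>n. - 1 + d * real (Suc n)) at_top sequentially"
        by (intro filterlim_tendsto_add_at_top [OF tendsto_const]
            filterlim_tendsto_pos_mult_at_top [OF tendsto_const that]
            filterlim_compose [OF filterlim_real_sequentially filterlim_Suc])
      then show ?thesis by (simp add: algebra_simps)
    qed
    have "((\<lambda>y :: real. exp (- inverse y)) \<longlongrightarrow> exp (- 0)) at_top"
      by (intro tendsto_intros tendsto_inverse_0_at_top filterlim_ident)
    moreover have "\<forall>\<^sub>F y :: real in at_top. exp (- inverse y) = flat_poly 1 y"
      using eventually_gt_at_top [of 0] by eventually_elim (simp add: flat_poly_def inverse_eq_divide)
    ultimately have "((\<lambda>y. flat_poly 1 y) \<longlongrightarrow> 1) at_top"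
      using Lim_transform_eventually by fastforce
    then show ?thesis by (rule filterlim_compose [OF _ top])
  qed
  have "(\<lambda>n. bump a b n x) \<longlonglongrightarrow> 1 * 1"
    unfolding bump_def using True by (intro tendsto_mult lim) auto
  with True show ?thesis by simp
next
  case False
  have "bump a b n x = 0" for n
  proof -
    have "real (Suc n) * (x - a) \<le> 0 \<or> real (Suc n) * (b - x) \<le> 0"
      using False by (auto simp: mult_nonneg_nonpos)
    then show ?thesis by (auto simp: bump_def flat_poly_def)
  qed
  with False show ?thesis by simp
qed

text \<open>The component \<open>j\<close> of \<open>f\<close> tested against a real function.\<close>

abbreviation test_integral :: "'m::finite linf \<Rightarrow> 'm \<Rightarrow> (real \<Rightarrow> real) \<Rightarrow> complex" where
  "test_integral f j r \<equiv> \<integral>s. rep_linf f s $ j * of_real (r s) \<partial>unit_leb"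

lemma integral_scaleR_nth:
  assumes "integrable unit_leb (\<lambda>s. r s *\<^sub>R rep_linf f s)"
  shows "(\<integral>s. r s *\<^sub>R rep_linf f s \<partial>unit_leb) $ j = test_integral f j r"
  using integral_bounded_linear [OF bounded_linear_vec_nth assms, of j]
  by (simp add: scaleR_conv_of_real [where 'a = complex] mult.commute)

lemma integrable_bounded_unit:
  assumes r: "r \<in> borel_measurable borel" "\<And>x. x \<in> {0..1} \<Longrightarrow> \<bar>r x\<bar> \<le> B"
  shows "integrable unit_leb (r :: real \<Rightarrow> real)"
    and "integrable unit_leb (\<lambda>s. r s *\<^sub>R rep_linf f s)"
proof -
  have B: "0 \<le> B" using r(2) [of 0] by simp
  have [measurable]: "r \<in> borel_measurable unit_leb" by (rule borel_measurable_unit_leb [OF r(1)])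
  show "integrable unit_leb r"
    by (rule finite_measure.integrable_const_bound [OF finite_unit_leb, where B = B, OF AE_I2])
      (use r(2) in auto)
  show "integrable unit_leb (\<lambda>s. r s *\<^sub>R rep_linf f s)"
  proof (rule finite_measure.integrable_const_bound [OF finite_unit_leb, where B = "B * norm f"])
    show "AE s in unit_leb. norm (r s *\<^sub>R rep_linf f s) \<le> B * norm f"
      using norm_linf_AE [of f] AE_space
    proof eventually_elim
      case (elim s)
      then have "\<bar>r s\<bar> \<le> B" "norm (rep_linf f s) \<le> norm f"
        using r(2) [of s] norm_le_l1norm [of "rep_linf f s"] by auto
      then show ?case using B by (auto intro: mult_mono)
    qed
  qed measurable
qed

lemma smooth_integrable_unit:
  assumes "smooth r"
  shows "integrable unit_leb r" "integrable unit_leb (\<lambda>s. r s *\<^sub>R rep_linf f s)"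
proof -
  obtain B where "\<And>x. x \<in> {0..1} \<Longrightarrow> \<bar>r x\<bar> \<le> B"
    by (rule smooth_bounded_unit [OF assms]) blast
  from integrable_bounded_unit [OF smooth_measurable [OF assms] this]
  show "integrable unit_leb r" "integrable unit_leb (\<lambda>s. r s *\<^sub>R rep_linf f s)" by blast+
qed

text \<open>The fundamental lemma of the calculus of variations.\<close>

lemma linf_zero_if_test_zero:
  assumes zero: "\<And>\<phi>. test_function \<phi> \<Longrightarrow> (\<integral>s. \<phi> s *\<^sub>R rep_linf f s \<partial>unit_leb) = 0"
  shows "f = 0"
proof (rule linf_zero_if_intervals_zero)
  fix j and a b :: real assume ab: "0 \<le> a" "a \<le> b" "b \<le> 1"
  let ?u = "\<lambda>s. rep_linf f s $ j"
  have [measurable]: "bump a b n \<in> borel_measurable unit_leb" for n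
    by (intro borel_measurable_unit_leb smooth_measurable smooth_bump)
  have "(\<lambda>n. \<integral>s. ?u s * of_real (bump a b n s) \<partial>unit_leb) \<longlonglongrightarrow> (\<integral>s. ?u s * indicator {a..b} s \<partial>unit_leb)"
  proof (rule integral_dominated_convergence [where w = "\<lambda>s. norm f"])
    show "AE s in unit_leb. norm (?u s * of_real (bump a b n s)) \<le> norm f" for n
      using cmod_rep_linf_le [of f j]
    proof eventually_elim
      case (elim s)
      have "norm (?u s * of_real (bump a b n s)) \<le> norm f * 1"
        unfolding norm_mult using elim bump_bounds [of a b n s] by (intro mult_mono) auto
      then show ?case by simp
    qed
    have "AE s in lborel. s \<notin> {a, b}"
      by (rule AE_not_in) (auto intro: finite_imp_null_set_lborel)
    then have "AE s in unit_leb. s \<notin> {a, b}"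
      unfolding AE_unit_leb_iff by eventually_elim simp
    then show "AE s in unit_leb. (\<lambda>n. ?u s * of_real (bump a b n s)) \<longlonglongrightarrow> ?u s * indicator {a..b} s"
    proof eventually_elim
      case (elim s)
      have "(\<lambda>n. complex_of_real (bump a b n s)) \<longlonglongrightarrow> of_real (indicator {a<..<b} s)"
        by (intro tendsto_of_real bump_tendsto)
      moreover have "complex_of_real (indicator {a<..<b} s) = indicator {a..b} s"
        using elim by (auto simp: indicator_def)
      ultimately show ?case by (intro tendsto_mult tendsto_const) simp
    qed
    show "(\<lambda>s. ?u s * indicator {a..b} s) \<in> borel_measurable unit_leb"
      using Icc_sets_unit_leb [OF ab(1,3)] by measurable
    show "integrable unit_leb (\<lambda>s. norm f)"
      by (rule finite_measure.integrable_const [OF finite_unit_leb])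
  qed measurable
  moreover have "(\<integral>s. ?u s * of_real (bump a b n s) \<partial>unit_leb) = 0" for n
    using integral_scaleR_nth [OF smooth_integrable_unit(2) [OF smooth_bump], of a b n f j]
      zero [OF test_function_bump [OF ab(1,3), of n]] by simp
  ultimately show "(\<integral>s. ?u s * indicator {a..b} s \<partial>unit_leb) = 0"
    by (simp add: LIMSEQ_const_iff)
qed

section \<open>Weak derivatives\<close>

lemma integral_unit_leb_smooth:
  assumes "smooth \<psi>" shows "(\<integral>s. \<psi> s \<partial>unit_leb) = integral {0..1} \<psi>"
  by (rule lebesgue_integral_eq_integral [OF smooth_integrable_unit(1) [OF assms]]) simp

lemma test_function_antiderivative:
  assumes \<psi>: "test_function \<psi>" and zero: "(\<integral>s. \<psi> s \<partial>unit_leb) = 0"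
  shows "\<exists>\<phi>. test_function \<phi> \<and> deriv \<phi> = \<psi>"
proof -
  obtain a b where ab: "0 < a" "a < b" "b < 1" "\<And>x. x \<notin> {a..b} \<Longrightarrow> \<psi> x = 0"
    using test_function_supportE [OF \<psi>] by blast
  define \<phi> where "\<phi> x = integral {0..x} \<psi>" for x
  have int: "\<psi> integrable_on {x..y}" for x y
    by (intro integrable_continuous_interval smooth_continuous test_function_smooth \<psi>)
  have left: "\<phi> x = 0" if "x < a" for x
  proof -
    have "integral {0..x} \<psi> = integral {0..x} (\<lambda>x. 0)"
      using that by (intro integral_cong ab) auto
    then show ?thesis by (simp add: \<phi>_def)
  qed
  have zero': "integral {x..y} \<psi> = 0" if "b < x" for x y
  proof -
    have "integral {x..y} \<psi> = integral {x..y} (\<lambda>x. 0)"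
      using that by (intro integral_cong ab) auto
    then show ?thesis by simp
  qed
  have total: "integral {0..1} \<psi> = 0"
    using zero integral_unit_leb_smooth [OF test_function_smooth [OF \<psi>]] by simp
  have right: "\<phi> x = 0" if "b < x" for x
  proof (cases "x \<le> 1")
    case True
    have "integral {0..x} \<psi> + integral {x..1} \<psi> = integral {0..1} \<psi>"
      using that ab True by (intro Henstock_Kurzweil_Integration.integral_combine int) auto
    with total zero' [OF that] show ?thesis by (simp add: \<phi>_def)
  next
    case False
    have "integral {0..1} \<psi> + integral {1..x} \<psi> = integral {0..x} \<psi>"
      using False by (intro Henstock_Kurzweil_Integration.integral_combine int) auto
    with total zero' [OF ab(3)] show ?thesis by (simp add: \<phi>_def)
  qed
  have der: "(\<phi> has_real_derivative \<psi> x) (at x)" for x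
  proof (cases "0 < x")
    case True
    have "((\<lambda>y. integral {0..y} \<psi>) has_real_derivative \<psi> x) (at x within {0..x + 1})"
      using True by (intro integral_has_real_derivative smooth_continuous test_function_smooth \<psi>) auto
    moreover have "at x within {0..x + 1} = at x"
      using True by (intro at_within_Icc_at) auto
    ultimately show ?thesis by (simp add: \<phi>_def [abs_def])
  next
    case False
    have "((\<lambda>x. 0 :: real) has_real_derivative 0) (at x)" by simp
    then have "(\<phi> has_real_derivative 0) (at x)"
      by (rule has_field_derivative_transform_within_open [where S = "{..<a}"])
        (use False ab left in auto)
    moreover have "\<psi> x = 0" using False ab by (intro ab(4)) auto
    ultimately show ?thesis by simp
  qed
  have "test_function \<phi>"
  proof (rule test_functionI [of _ a b])
    show "smooth \<phi>" by (rule smooth_of_deriv [OF der test_function_smooth [OF \<psi>]])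
    show "\<phi> x = 0" if "x \<notin> {a..b}" for x using that left right by (cases "x < a") auto
  qed (use ab in auto)
  moreover have "deriv \<phi> = \<psi>" using der DERIV_imp_deriv by blast
  ultimately show ?thesis by blast
qed

lemma ess_bounded_const: "ess_bounded (\<lambda>s. v)"
  by (rule ess_boundedI [where K = "l1norm v"]) auto

lemma rep_const_linf: "AE s in unit_leb. rep_linf (abs_linf (\<lambda>s. v)) s = v"
  by (rule rep_abs_linf [OF ess_bounded_const])

lemma integral_scaleR_const_linf:
  assumes "smooth r"
  shows "(\<integral>s. r s *\<^sub>R rep_linf (abs_linf (\<lambda>s. v)) s \<partial>unit_leb) = (\<integral>s. r s \<partial>unit_leb) *\<^sub>R v"
proof -
  have [measurable]: "r \<in> borel_measurable unit_leb"
    by (intro borel_measurable_unit_leb smooth_measurable assms)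
  have "(\<integral>s. r s *\<^sub>R rep_linf (abs_linf (\<lambda>s. v)) s \<partial>unit_leb) = (\<integral>s. r s *\<^sub>R v \<partial>unit_leb)"
  proof (rule integral_cong_AE)
    show "AE s in unit_leb. r s *\<^sub>R rep_linf (abs_linf (\<lambda>s. v)) s = r s *\<^sub>R v"
      using rep_const_linf [of v] by eventually_elim simp
  qed measurable
  also have "\<dots> = (\<integral>s. r s \<partial>unit_leb) *\<^sub>R v"
    by (rule integral_scaleR_left) (use smooth_integrable_unit(1) [OF assms] in simp)
  finally show ?thesis .
qed

lemma integral_scaleR_diff_linf:
  assumes r: "smooth r"
  shows "(\<integral>s. r s *\<^sub>R rep_linf (f - g) s \<partial>unit_leb) =
    (\<integral>s. r s *\<^sub>R rep_linf f s \<partial>unit_leb) - (\<integral>s. r s *\<^sub>R rep_linf g s \<partial>unit_leb)"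
proof -
  have [measurable]: "r \<in> borel_measurable unit_leb"
    by (intro borel_measurable_unit_leb smooth_measurable r)
  have "(\<integral>s. r s *\<^sub>R rep_linf (f - g) s \<partial>unit_leb) =
      (\<integral>s. r s *\<^sub>R rep_linf f s - r s *\<^sub>R rep_linf g s \<partial>unit_leb)"
  proof (rule integral_cong_AE)
    show "AE s in unit_leb. r s *\<^sub>R rep_linf (f - g) s = r s *\<^sub>R rep_linf f s - r s *\<^sub>R rep_linf g s"
      using rep_linf_diff [of f g] by eventually_elim (simp add: scaleR_diff_right)
  qed measurable
  then show ?thesis
    by (simp add: Bochner_Integration.integral_diff smooth_integrable_unit(2) [OF r])
qed

lemma has_weak_deriv_unique:
  assumes "has_weak_deriv f g" "has_weak_deriv f h" shows "g = h"
proof -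
  have "g - h = 0"
  proof (rule linf_zero_if_test_zero)
    fix \<phi> assume \<phi>: "test_function \<phi>"
    have "- (\<integral>s. \<phi> s *\<^sub>R rep_linf g s \<partial>unit_leb) = - (\<integral>s. \<phi> s *\<^sub>R rep_linf h s \<partial>unit_leb)"
      using assms(1) [unfolded has_weak_deriv_def, rule_format, OF \<phi>]
        assms(2) [unfolded has_weak_deriv_def, rule_format, OF \<phi>] by (rule trans [OF sym])
    then show "(\<integral>s. \<phi> s *\<^sub>R rep_linf (g - h) s \<partial>unit_leb) = 0"
      by (simp add: integral_scaleR_diff_linf test_function_smooth \<phi>)
  qed
  then show ?thesis by simp
qed

lemma weak_deriv_eq: "has_weak_deriv f g \<Longrightarrow> weak_deriv f = g"
  unfolding weak_deriv_def by (rule the_equality) (auto intro: has_weak_deriv_unique)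

text \<open>
  The lemma of du Bois-Reymond: a test function of integral zero is the derivative of a test function,
  and any test function becomes one of integral zero after subtraction of a multiple of a fixed \<open>\<rho>\<close>.
\<close>

lemma const_if_weak_deriv_zero:
  fixes f :: "'m::finite linf"
  assumes zero: "\<And>\<phi>. test_function \<phi> \<Longrightarrow> (\<integral>s. deriv \<phi> s *\<^sub>R rep_linf f s \<partial>unit_leb) = 0"
  shows "\<exists>v. f = abs_linf (\<lambda>s. v)"
proof -
  have "\<exists>\<rho>. test_function \<rho> \<and> (\<integral>s. \<rho> s \<partial>unit_leb) \<noteq> 0"
  proof (rule ccontr)
    assume none: "\<not> ?thesis"
    let ?one = "abs_linf (\<lambda>s. \<chi> j. 1) :: 'm linf"
    have "?one = 0"
    proof (rule linf_zero_if_test_zero)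
      fix \<phi> assume "test_function \<phi>"
      with none show "(\<integral>s. \<phi> s *\<^sub>R rep_linf ?one s \<partial>unit_leb) = 0"
        by (simp add: integral_scaleR_const_linf test_function_smooth)
    qed
    then have "AE s in unit_leb. rep_linf ?one s = 0"
      using rep_linf_zero [where 'a = 'm] by (simp only:)
    then have "AE s in unit_leb. (\<chi> j. 1) = (0 :: complex ^ 'm)"
      using rep_const_linf [of "(\<chi> j. 1) :: complex ^ 'm"] by eventually_elim simp
    then have "(\<chi> j. 1) = (0 :: complex ^ 'm)" by (rule unit_leb_AE_const)
    then show False by (simp add: vec_eq_iff)
  qed
  then obtain \<rho> where \<rho>: "test_function \<rho>" "(\<integral>s. \<rho> s \<partial>unit_leb) \<noteq> 0" by blast
  define I where "I = (\<integral>s. \<rho> s \<partial>unit_leb)"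
  define v where "v = (1 / I) *\<^sub>R (\<integral>s. \<rho> s *\<^sub>R rep_linf f s \<partial>unit_leb)"
  have "f - abs_linf (\<lambda>s. v) = 0"
  proof (rule linf_zero_if_test_zero)
    fix \<psi> assume \<psi>: "test_function \<psi>"
    define r where "r = (\<integral>s. \<psi> s \<partial>unit_leb) / I"
    let ?h = "\<lambda>s. 1 * \<psi> s + (- r) * \<rho> s"
    note sm = test_function_smooth [OF \<psi>] test_function_smooth [OF \<rho>(1)]
    note int = smooth_integrable_unit [OF sm(1)] smooth_integrable_unit [OF sm(2)]
    have "test_function ?h"
    proof -
      obtain a b where ab: "0 < a" "a < b" "b < 1" "\<And>x. x \<notin> {a..b} \<Longrightarrow> \<psi> x = 0"
        using test_function_supportE [OF \<psi>] by blast
      obtain a' b' where ab': "0 < a'" "a' < b'" "b' < 1" "\<And>x. x \<notin> {a'..b'} \<Longrightarrow> \<rho> x = 0"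
        using test_function_supportE [OF \<rho>(1)] by blast
      show ?thesis
      proof (rule test_functionI [of _ "min a a'" "max b b'"])
        show "smooth ?h" by (rule smooth_lincomb [OF sm])
        show "?h x = 0" if "x \<notin> {min a a'..max b b'}" for x
        proof -
          have "x \<notin> {a..b}" "x \<notin> {a'..b'}" using that by auto
          then have "\<psi> x = 0" "\<rho> x = 0" using ab(4) ab'(4) by blast+
          then show ?thesis by simp
        qed
      qed (use ab ab' in auto)
    qed
    moreover have "(\<integral>s. ?h s \<partial>unit_leb) = 0"
      using int \<rho>(2) by (simp add: r_def I_def)
    ultimately obtain \<phi> where \<phi>: "test_function \<phi>" "deriv \<phi> = ?h"
      using test_function_antiderivative by blast
    have "0 = (\<integral>s. ?h s *\<^sub>R rep_linf f s \<partial>unit_leb)"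
      using zero [OF \<phi>(1)] unfolding \<phi>(2) by simp
    also have "\<dots> = (\<integral>s. \<psi> s *\<^sub>R rep_linf f s - r *\<^sub>R (\<rho> s *\<^sub>R rep_linf f s) \<partial>unit_leb)"
      by (simp add: scaleR_diff_left)
    also have "\<dots> = (\<integral>s. \<psi> s *\<^sub>R rep_linf f s \<partial>unit_leb) - r *\<^sub>R (\<integral>s. \<rho> s *\<^sub>R rep_linf f s \<partial>unit_leb)"
      using int(2) [of f] int(4) [of f] by (simp add: Bochner_Integration.integral_diff del: scaleR_scaleR)
    also have "r *\<^sub>R (\<integral>s. \<rho> s *\<^sub>R rep_linf f s \<partial>unit_leb) = (\<integral>s. \<psi> s \<partial>unit_leb) *\<^sub>R v"
      by (simp add: r_def v_def)
    finally show "(\<integral>s. \<psi> s *\<^sub>R rep_linf (f - abs_linf (\<lambda>s. v)) s \<partial>unit_leb) = 0"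
      by (simp add: integral_scaleR_diff_linf integral_scaleR_const_linf sm)
  qed
  then show ?thesis by (intro exI [of _ v]) simp
qed

text \<open>Integration by parts against an indefinite Lebesgue integral, by Fubini's theorem.\<close>

lemma integral_deriv_test_indefinite:
  fixes u :: "real \<Rightarrow> complex"
  assumes \<phi>: "test_function \<phi>" and u [measurable]: "u \<in> borel_measurable borel"
    and S: "\<And>x. cmod (u x) \<le> S"
  shows "(\<integral>s. integral {0..s} u * of_real (deriv \<phi> s) \<partial>unit_leb) = - (\<integral>s. u s * of_real (\<phi> s) \<partial>unit_leb)"
proof -
  have sm: "smooth (deriv \<phi>)" by (intro smooth_deriv test_function_smooth \<phi>)
  have [measurable]: "deriv \<phi> \<in> borel_measurable borel" "\<phi> \<in> borel_measurable borel"
    using sm test_function_smooth [OF \<phi>] by (auto intro: smooth_measurable)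
  obtain B where B: "\<And>x. x \<in> {0..1} \<Longrightarrow> \<bar>deriv \<phi> x\<bar> \<le> B"
    by (rule smooth_bounded_unit [OF sm]) blast
  have \<phi>1: "\<phi> 1 = 0"
  proof -
    obtain a b where "0 < a" "a < b" "b < 1" and 0: "\<And>x. x \<notin> {a..b} \<Longrightarrow> \<phi> x = 0"
      using test_function_supportE [OF \<phi>] by blast
    then show ?thesis by (intro 0) auto
  qed
  define k where "k s r = (if 0 \<le> r \<and> r \<le> s \<and> s \<le> 1 then u r * of_real (deriv \<phi> s) else 0)" for s r :: real
  have "integrable (lborel \<Otimes>\<^sub>M lborel) (case_prod k)"
  proof (rule integrableI_bounded_set [where A = "{0..1} \<times> {0..1}" and B = "S * B"])
    show "case_prod k \<in> borel_measurable (lborel \<Otimes>\<^sub>M lborel)"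
      unfolding k_def by measurable
    show "emeasure (lborel \<Otimes>\<^sub>M lborel) ({0..1 :: real} \<times> {0..1 :: real}) < \<infinity>"
      by (subst lborel.emeasure_pair_measure_Times) (simp_all add: ennreal_mult_less_top)
    show "AE x in lborel \<Otimes>\<^sub>M lborel. x \<in> {0..1} \<times> {0..1} \<longrightarrow> norm (case_prod k x) \<le> S * B"
    proof (intro AE_I2 impI)
      fix x :: "real \<times> real" assume "x \<in> {0..1} \<times> {0..1}"
      then obtain s r where x: "x = (s, r)" "s \<in> {0..1}" by auto
      have "0 \<le> S" "0 \<le> B" using order_trans [OF norm_ge_zero S] order_trans [OF abs_ge_zero B [of 0]] by auto
      then have "cmod (u r * of_real (deriv \<phi> s)) \<le> S * B"
        unfolding norm_mult norm_of_real using S B [OF x(2)] by (intro mult_mono) auto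
      with x \<open>0 \<le> S\<close> \<open>0 \<le> B\<close> show "norm (case_prod k x) \<le> S * B" by (simp add: k_def)
    qed
    show "AE x in lborel \<Otimes>\<^sub>M lborel. x \<notin> {0..1} \<times> {0..1} \<longrightarrow> case_prod k x = 0"
      by (intro AE_I2) (auto simp: k_def split: if_splits)
  qed measurable
  then have Fubini: "(\<integral>r. (\<integral>s. k s r \<partial>lborel) \<partial>lborel) = (\<integral>s. (\<integral>r. k s r \<partial>lborel) \<partial>lborel)"
    by (rule lborel_pair.Fubini_integral)
  have inner1: "(\<integral>r. k s r \<partial>lborel) = indicator {0..1} s *\<^sub>R (integral {0..s} u * of_real (deriv \<phi> s))" for s
  proof (cases "s \<in> {0..1}")
    case True
    then have "(\<integral>r. k s r \<partial>lborel) = (\<integral>r. (indicator {0..s} r *\<^sub>R u r) * of_real (deriv \<phi> s) \<partial>lborel)"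
      by (intro Bochner_Integration.integral_cong refl) (auto simp: k_def indicator_def)
    also have "\<dots> = (\<integral>r. indicator {0..s} r *\<^sub>R u r \<partial>lborel) * of_real (deriv \<phi> s)"
      by (rule integral_mult_left_zero)
    also have "(\<integral>r. indicator {0..s} r *\<^sub>R u r \<partial>lborel) = integral {0..s} u"
      using set_borel_integral_eq_integral(2) [OF bounded_Borel_interval [OF u S]]
      by (simp add: set_lebesgue_integral_def)
    finally show ?thesis using True by simp
  next
    case False
    then have "k s r = 0" for r by (auto simp: k_def)
    with False show ?thesis by simp
  qed
  have inner2: "(\<integral>s. k s r \<partial>lborel) = - (indicator {0..1} r *\<^sub>R (u r * of_real (\<phi> r)))" for r
  proof (cases "r \<in> {0..1}")
    case True
    then have "(\<integral>s. k s r \<partial>lborel) = (\<integral>s. u r * of_real (indicator {r..1} s *\<^sub>R deriv \<phi> s) \<partial>lborel)"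
      by (intro Bochner_Integration.integral_cong refl) (auto simp: k_def indicator_def)
    also have "\<dots> = u r * of_real (\<integral>s. indicator {r..1} s *\<^sub>R deriv \<phi> s \<partial>lborel)"
      by (simp only: integral_mult_right_zero integral_complex_of_real)
    also have "(\<integral>s. indicator {r..1} s *\<^sub>R deriv \<phi> s \<partial>lborel) = integral {r..1} (deriv \<phi>)"
    proof -
      have "set_integrable lborel {r..1} (deriv \<phi>)"
        by (rule borel_integrable_atLeastAtMost') (rule smooth_continuous [OF sm])
      from set_borel_integral_eq_integral(2) [OF this] show ?thesis
        by (simp add: set_lebesgue_integral_def)
    qed
    also have "integral {r..1} (deriv \<phi>) = \<phi> 1 - \<phi> r"
      using True
      by (intro integral_unique fundamental_theorem_of_calculus)
        (auto intro!: has_field_derivative_at_within smooth_DERIV test_function_smooth \<phi>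
          simp: has_real_derivative_iff_has_vector_derivative [symmetric])
    finally show ?thesis using True by (simp add: \<phi>1)
  next
    case False
    then have "k s r = 0" for s by (auto simp: k_def)
    with False show ?thesis by simp
  qed
  have "(\<integral>s. integral {0..s} u * of_real (deriv \<phi> s) \<partial>unit_leb) =
      (\<integral>s. indicator {0..1} s *\<^sub>R (integral {0..s} u * of_real (deriv \<phi> s)) \<partial>lebesgue)"
    by (rule integral_restrict_space) simp
  also have "\<dots> = (\<integral>s. (\<integral>r. k s r \<partial>lborel) \<partial>lborel)"
    unfolding inner1 [symmetric]
  proof (rule integral_completion)
    have [measurable]: "case_prod k \<in> borel_measurable (lborel \<Otimes>\<^sub>M lborel)"
      unfolding k_def by measurable
    show "(\<lambda>s. \<integral>r. k s r \<partial>lborel) \<in> borel_measurable lborel"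
      by (intro lborel.borel_measurable_lebesgue_integral) simp
  qed
  also have "\<dots> = (\<integral>r. - (indicator {0..1} r *\<^sub>R (u r * of_real (\<phi> r))) \<partial>lborel)"
    unfolding Fubini [symmetric] inner2 ..
  also have "\<dots> = - (\<integral>r. indicator {0..1} r *\<^sub>R (u r * of_real (\<phi> r)) \<partial>lborel)"
    by (rule Bochner_Integration.integral_minus)
  also have "(\<integral>r. indicator {0..1} r *\<^sub>R (u r * of_real (\<phi> r)) \<partial>lborel) =
      (\<integral>r. indicator {0..1} r *\<^sub>R (u r * of_real (\<phi> r)) \<partial>lebesgue)"
    by (rule integral_completion [symmetric]) measurable
  also have "\<dots> = (\<integral>s. u s * of_real (\<phi> s) \<partial>unit_leb)"
    by (rule integral_restrict_space [symmetric]) simp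
  finally show ?thesis .
qed

text \<open>The componentwise primitive of \<open>g\<close> that vanishes at \<open>0\<close>; only its values on \<open>[0, 1]\<close> are used.\<close>

definition indefinite_integral :: "'m::finite linf \<Rightarrow> real \<Rightarrow> complex ^ 'm" where
  "indefinite_integral g x = (\<chi> j. integral {0..x} (\<lambda>r. Borel_rep g r $ j))"

lemma Borel_rep_nth_measurable: "(\<lambda>r. Borel_rep g r $ j) \<in> borel_measurable borel"
  by (rule measurable_compose [OF Borel_rep_measurable vec_nth_measurable])

lemma Borel_rep_integrable_on: "(\<lambda>r. Borel_rep g r $ j) integrable_on {a..b}"
  by (rule integrable_on_bounded_Borel [OF Borel_rep_nth_measurable cmod_Borel_rep])

lemma indefinite_integral_diff:
  assumes "0 \<le> x" "x \<le> y"
  shows "(indefinite_integral g y - indefinite_integral g x) $ j = integral {x..y} (\<lambda>r. Borel_rep g r $ j)"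
  using Henstock_Kurzweil_Integration.integral_combine [OF assms Borel_rep_integrable_on, of g j]
  by (simp add: indefinite_integral_def algebra_simps)

lemma indefinite_integral_lipschitz:
  assumes "x \<in> {0..1}" "y \<in> {0..1}"
  shows "cmod (indefinite_integral g x $ j - indefinite_integral g y $ j) \<le> norm g * \<bar>x - y\<bar>"
proof -
  have *: "cmod (indefinite_integral g y $ j - indefinite_integral g x $ j) \<le> norm g * (y - x)"
    if "0 \<le> x" "x \<le> y" for x y
  proof -
    have "((\<lambda>r. Borel_rep g r $ j) has_integral integral {x..y} (\<lambda>r. Borel_rep g r $ j)) (cbox x y)"
      by (simp add: integrable_integral [OF Borel_rep_integrable_on])
    then have "cmod (integral {x..y} (\<lambda>r. Borel_rep g r $ j)) \<le> norm g * measure lborel (cbox x y)"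
      by (intro has_integral_bound) (auto intro: cmod_Borel_rep)
    then show ?thesis
      using indefinite_integral_diff [OF that, of g j] that by simp
  qed
  show ?thesis
    using * [of x y] * [of y x] assms by (cases "x \<le> y") (auto simp: norm_minus_commute abs_if)
qed

lemma continuous_on_indefinite_integral: "continuous_on {0..1} (indefinite_integral g)"
  unfolding indefinite_integral_def
  by (intro continuous_on_vec_lambda indefinite_integral_continuous_1 Borel_rep_integrable_on)

lemma ess_bounded_indefinite_integral: "ess_bounded (indefinite_integral (g :: 'm::finite linf))"
proof (rule ess_boundedI)
  show "indefinite_integral g \<in> borel_measurable unit_leb"
    by (rule continuous_imp_measurable_on_sets_lebesgue [OF continuous_on_indefinite_integral]) simp
  show "AE s in unit_leb. l1norm (indefinite_integral g s) \<le> (\<Sum>j\<in>(UNIV :: 'm set). norm g)"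
  proof (rule AE_I2)
    fix s assume "s \<in> space unit_leb"
    then have s: "s \<in> {0..1}" by simp
    have "cmod (indefinite_integral g s $ j) \<le> norm g" for j
    proof -
      have "cmod (indefinite_integral g s $ j - indefinite_integral g 0 $ j) \<le> norm g * \<bar>s - 0\<bar>"
        using s by (intro indefinite_integral_lipschitz) auto
      also have "\<dots> \<le> norm g * 1" using s by (intro mult_left_mono) auto
      finally show ?thesis by (simp add: indefinite_integral_def)
    qed
    then show "l1norm (indefinite_integral g s) \<le> (\<Sum>j\<in>(UNIV :: 'm set). norm g)"
      unfolding l1norm_def by (intro sum_mono)
  qed
qed

lemma weakly_differentiable_indefinite_integral:
  fixes f g :: "'m::finite linf"
  assumes wd: "has_weak_deriv f g"
  shows "\<exists>v. AE s in unit_leb. rep_linf f s = v + indefinite_integral g s"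
proof -
  let ?U = "abs_linf (indefinite_integral g)"
  have repU: "AE s in unit_leb. rep_linf ?U s = indefinite_integral g s"
    by (rule rep_abs_linf [OF ess_bounded_indefinite_integral])
  have "\<exists>v. f - ?U = abs_linf (\<lambda>s. v)"
  proof (rule const_if_weak_deriv_zero)
    fix \<phi> assume \<phi>: "test_function \<phi>"
    have sm: "smooth \<phi>" "smooth (deriv \<phi>)"
      using test_function_smooth [OF \<phi>] smooth_deriv by auto
    have [measurable]: "deriv \<phi> \<in> borel_measurable unit_leb" "\<phi> \<in> borel_measurable unit_leb"
      using sm by (auto intro: borel_measurable_unit_leb smooth_measurable)
    have "(\<integral>s. deriv \<phi> s *\<^sub>R rep_linf ?U s \<partial>unit_leb) $ j = (- (\<integral>s. \<phi> s *\<^sub>R rep_linf g s \<partial>unit_leb)) $ j" for j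
    proof -
      have "(\<integral>s. deriv \<phi> s *\<^sub>R rep_linf ?U s \<partial>unit_leb) $ j =
          (\<integral>s. rep_linf ?U s $ j * of_real (deriv \<phi> s) \<partial>unit_leb)"
        by (rule integral_scaleR_nth [OF smooth_integrable_unit(2) [OF sm(2)]])
      also have "\<dots> = (\<integral>s. integral {0..s} (\<lambda>r. Borel_rep g r $ j) * of_real (deriv \<phi> s) \<partial>unit_leb)"
      proof (rule integral_cong_AE)
        have "continuous_on {0..1} (\<lambda>s. integral {0..s} (\<lambda>r. Borel_rep g r $ j))"
          by (rule indefinite_integral_continuous_1 [OF Borel_rep_integrable_on])
        then have [measurable]: "(\<lambda>s. integral {0..s} (\<lambda>r. Borel_rep g r $ j)) \<in> borel_measurable unit_leb"
          by (rule continuous_imp_measurable_on_sets_lebesgue) simp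
        show "(\<lambda>s. integral {0..s} (\<lambda>r. Borel_rep g r $ j) * of_real (deriv \<phi> s)) \<in> borel_measurable unit_leb"
          by measurable
        show "AE s in unit_leb. rep_linf ?U s $ j * of_real (deriv \<phi> s) =
            integral {0..s} (\<lambda>r. Borel_rep g r $ j) * of_real (deriv \<phi> s)"
          using repU by eventually_elim (simp add: indefinite_integral_def)
      qed measurable
      also have "\<dots> = - (\<integral>s. Borel_rep g s $ j * of_real (\<phi> s) \<partial>unit_leb)"
        by (rule integral_deriv_test_indefinite [OF \<phi> Borel_rep_nth_measurable cmod_Borel_rep])
      also have "(\<integral>s. Borel_rep g s $ j * of_real (\<phi> s) \<partial>unit_leb) = test_integral g j \<phi>"
      proof (rule integral_cong_AE)
        have [measurable]: "(\<lambda>s. Borel_rep g s $ j) \<in> borel_measurable unit_leb"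
          by (rule borel_measurable_unit_leb [OF Borel_rep_nth_measurable])
        show "(\<lambda>s. Borel_rep g s $ j * of_real (\<phi> s)) \<in> borel_measurable unit_leb" by measurable
        show "AE s in unit_leb. Borel_rep g s $ j * of_real (\<phi> s) = rep_linf g s $ j * of_real (\<phi> s)"
          using rep_linf_eq_Borel_rep [of g] by eventually_elim simp
      qed measurable
      also have "\<dots> = (\<integral>s. \<phi> s *\<^sub>R rep_linf g s \<partial>unit_leb) $ j"
        by (rule integral_scaleR_nth [OF smooth_integrable_unit(2) [OF sm(1)], symmetric])
      finally show ?thesis by simp
    qed
    then have "(\<integral>s. deriv \<phi> s *\<^sub>R rep_linf ?U s \<partial>unit_leb) = - (\<integral>s. \<phi> s *\<^sub>R rep_linf g s \<partial>unit_leb)"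
      unfolding vec_eq_iff by (rule allI)
    moreover have "(\<integral>s. deriv \<phi> s *\<^sub>R rep_linf f s \<partial>unit_leb) = - (\<integral>s. \<phi> s *\<^sub>R rep_linf g s \<partial>unit_leb)"
      using wd \<phi> unfolding has_weak_deriv_def by blast
    ultimately show "(\<integral>s. deriv \<phi> s *\<^sub>R rep_linf (f - ?U) s \<partial>unit_leb) = 0"
      by (simp add: integral_scaleR_diff_linf [OF sm(2)])
  qed
  then obtain v where v: "f - ?U = abs_linf (\<lambda>s. v)" ..
  have "AE s in unit_leb. rep_linf f s = v + indefinite_integral g s"
    using repU rep_linf_diff [of f ?U] rep_const_linf [of v] unfolding v [symmetric]
    by eventually_elim (simp add: eq_diff_eq)
  then show ?thesis ..
qed

section \<open>Lipschitz representatives\<close>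

lemma rep_matrix_app: "AE s in unit_leb. rep_linf (matrix_app A f) s = A *v rep_linf f s"
  unfolding matrix_app_def by (simp add: rep_abs_linf ess_bounded_matrix ess_bounded_rep)

lemma diag_matrix_vector_nth: "(diag_matrix d *v v) $ j = of_real (d j) * v $ j"
  by (simp add: diag_matrix_def matrix_vector_mult_def if_distrib [of "\<lambda>x. x * _"] cong: if_cong)

lemma integral_rep_linf_lborel:
  fixes u :: "real \<Rightarrow> complex"
  assumes [measurable]: "u \<in> borel_measurable borel" "r \<in> borel_measurable borel"
    and eq: "AE s in unit_leb. rep_linf h s $ j = u s" and zero: "\<And>x. x \<notin> {0..1} \<Longrightarrow> r x = 0"
  shows "test_integral h j r = (\<integral>s. u s * of_real (r s) \<partial>lborel)"
proof -
  have [measurable]: "u \<in> borel_measurable unit_leb" "r \<in> borel_measurable unit_leb"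
    by (auto intro: borel_measurable_unit_leb)
  have "test_integral h j r = (\<integral>s. u s * of_real (r s) \<partial>unit_leb)"
  proof (rule integral_cong_AE)
    show "AE s in unit_leb. rep_linf h s $ j * of_real (r s) = u s * of_real (r s)"
      using eq by eventually_elim simp
  qed measurable
  also have "\<dots> = (\<integral>s. indicator {0..1} s *\<^sub>R (u s * of_real (r s)) \<partial>lebesgue)"
    by (rule integral_restrict_space) simp
  also have "(\<lambda>s. indicator {0..1} s *\<^sub>R (u s * of_real (r s))) = (\<lambda>s. u s * of_real (r s))"
    using zero by (auto simp: indicator_def)
  also have "(\<integral>s. u s * of_real (r s) \<partial>lebesgue) = (\<integral>s. u s * of_real (r s) \<partial>lborel)"
    by (rule integral_completion) measurable
  finally show ?thesis .
qed

lemma AE_unit_leb_ex_between: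
  assumes P: "AE x in unit_leb. P x" and ab: "0 \<le> a" "a < b" "b \<le> 1"
  shows "\<exists>x\<in>{a<..<b}. P x"
proof (rule ccontr)
  assume none: "\<not> ?thesis"
  have "AE x in lborel. x \<notin> {a<..<b}"
    using P unfolding AE_unit_leb_iff by eventually_elim (use none ab in auto)
  then have "{a<..<b} \<in> null_sets lborel"
    by (subst (asm) AE_iff_null_sets [symmetric]) auto
  then show False using ab by auto
qed

lemma continuous_eq_if_AE_eq:
  fixes F G :: "real \<Rightarrow> 'b::real_normed_vector"
  assumes F: "continuous_on {0..1} F" and G: "continuous_on {0..1} G"
    and eq: "AE x in unit_leb. F x = G x" and x: "x \<in> {0..1}"
  shows "F x = G x"
proof (rule ccontr)
  assume "F x \<noteq> G x"
  then have pos: "0 < norm (F x - G x)" by simp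
  have "continuous_on {0..1} (\<lambda>y. F y - G y)" using F G by (intro continuous_intros)
  from this [unfolded continuous_on_iff, rule_format, OF x pos] obtain d where d: "0 < d"
    "\<And>y. y \<in> {0..1} \<Longrightarrow> dist y x < d \<Longrightarrow> dist (F y - G y) (F x - G x) < norm (F x - G x)"
    by blast
  have ne: "F y \<noteq> G y" if "y \<in> {0..1}" "dist y x < d" for y
    using d(2) [OF that] by (auto simp: dist_norm norm_minus_commute)
  show False
  proof (cases "x < 1")
    case True
    have "\<exists>y\<in>{x<..<min 1 (x + d)}. F y = G y"
      by (rule AE_unit_leb_ex_between [OF eq]) (use True x d(1) in auto)
    then obtain y where "y \<in> {x<..<min 1 (x + d)}" "F y = G y" by blast
    with ne [of y] x show False by (auto simp: dist_real_def)
  next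
    case False
    have "\<exists>y\<in>{max 0 (x - d)<..<x}. F y = G y"
      by (rule AE_unit_leb_ex_between [OF eq]) (use False x d(1) in auto)
    then obtain y where "y \<in> {max 0 (x - d)<..<x}" "F y = G y" by blast
    with ne [of y] x show False by (auto simp: dist_real_def)
  qed
qed

text \<open>The Lipschitz representative of a weakly differentiable function, extended constantly to the line.\<close>

definition clamped_primitive :: "complex ^ 'm \<Rightarrow> 'm::finite linf \<Rightarrow> real \<Rightarrow> complex ^ 'm" where
  "clamped_primitive v g x = v + indefinite_integral g (max 0 (min 1 x))"

lemma clamped_primitive_eq: "x \<in> {0..1} \<Longrightarrow> clamped_primitive v g x = v + indefinite_integral g x"
  by (simp add: clamped_primitive_def)

lemma clamped_primitive_measurable: "clamped_primitive v g \<in> borel_measurable borel"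
  unfolding clamped_primitive_def
  by (intro borel_measurable_continuous_onI continuous_intros
      continuous_on_compose2 [OF continuous_on_indefinite_integral]) auto

lemma clamped_primitive_lipschitz:
  assumes "x \<in> {0..1}" "y \<in> {0..1}"
  shows "cmod (clamped_primitive v g x $ j - clamped_primitive v g y $ j) \<le> norm g * \<bar>x - y\<bar>"
  using indefinite_integral_lipschitz [OF assms, of g j] assms by (simp add: clamped_primitive_eq)

lemma clamped_primitive_diff:
  assumes "0 \<le> x" "x \<le> y" "y \<le> 1"
  shows "clamped_primitive v g y $ j - clamped_primitive v g x $ j = integral {x..y} (\<lambda>r. Borel_rep g r $ j)"
  using indefinite_integral_diff [OF assms(1,2), of g j] assms by (simp add: clamped_primitive_eq)

context transport_network
begin

lemma bounded_Borel_clamped_primitive: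
  "bounded_Borel (l1norm v + norm g) (clamped_primitive v g)"
  unfolding bounded_Borel_def
proof (intro conjI ballI allI clamped_primitive_measurable)
  fix x :: real and j assume x: "x \<in> {0..1}"
  have "cmod (clamped_primitive v g x $ j - clamped_primitive v g 0 $ j) \<le> norm g * \<bar>x - 0\<bar>"
    using x by (intro clamped_primitive_lipschitz) auto
  also have "\<dots> \<le> norm g * 1" using x by (intro mult_left_mono) auto
  finally have "cmod (clamped_primitive v g x $ j - v $ j) \<le> norm g"
    by (simp add: clamped_primitive_def indefinite_integral_def)
  then show "cmod (clamped_primitive v g x $ j) \<le> l1norm v + norm g"
    using cmod_le_l1norm [of v j] norm_triangle_sub [of "clamped_primitive v g x $ j" "v $ j"] by simp
qed

section \<open>The domain of the generator: necessity\<close>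

text \<open>
  The difference quotients of the flow at an interior test function are carried over to the test
  function by translation.
\<close>

lemma difference_quotient_test:
  assumes \<phi>: "test_function \<phi>" and lim: "limitin weak_star (\<lambda>t. (transport t f - f) /\<^sub>R t) g (at_right 0)"
  shows "test_integral g j \<phi> =
    - of_real (c j) * test_integral f j (deriv \<phi>)"
proof -
  obtain a b where ab: "0 < a" "a < b" "b < 1" "\<And>x. x \<notin> {a..b} \<Longrightarrow> \<phi> x = 0"
    using test_function_supportE [OF \<phi>] by blast
  have sm: "smooth \<phi>" "smooth (deriv \<phi>)"
    using test_function_smooth [OF \<phi>] smooth_deriv by auto
  have [measurable]: "\<phi> \<in> borel_measurable borel" "deriv \<phi> \<in> borel_measurable borel"
    using sm by (auto intro: smooth_measurable)
  obtain B where B: "\<And>x. x \<in> {0..1} \<Longrightarrow> \<bar>deriv \<phi> x\<bar> \<le> B"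
    by (rule smooth_bounded_unit [OF sm(2)]) blast
  have d0: "deriv \<phi> x = 0" if "x \<notin> {a..b}" for x
  proof -
    have "((\<lambda>x. 0 :: real) has_real_derivative 0) (at x)" by simp
    then have "(\<phi> has_real_derivative 0) (at x)"
      by (rule has_field_derivative_transform_within_open [where S = "- {a..b}"])
        (use that ab(4) in auto)
    then show ?thesis by (rule DERIV_imp_deriv)
  qed
  have B0: "0 \<le> B" using order_trans [OF abs_ge_zero B [of 0]] by simp
  have B': "\<bar>deriv \<phi> x\<bar> \<le> B" for x
    using B [of x] d0 [of x] B0 ab by (cases "x \<in> {a..b}") auto
  have lip: "\<bar>\<phi> x - \<phi> y\<bar> \<le> B * \<bar>x - y\<bar>" for x y
    using field_differentiable_bound [of UNIV \<phi> "deriv \<phi>" B x y] smooth_DERIV [OF sm(1)] B' by simp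
  let ?u = "\<lambda>y. Borel_rep f y $ j"
  have [measurable]: "?u \<in> borel_measurable borel" by (rule Borel_rep_nth_measurable)
  define t where "t n = 1 / real (Suc n)" for n
  have t_pos: "0 < t n" "t n \<le> 1" for n by (simp_all add: t_def)
  have t_lim: "t \<longlonglongrightarrow> 0" unfolding t_def by (rule LIMSEQ_Suc [OF lim_1_over_n])
  have t_right: "filterlim t (at_right 0) sequentially"
    using t_lim t_pos by (auto simp: filterlim_at less_imp_neq [symmetric])
  have t_at: "filterlim t (at 0) sequentially"
    using t_right by (rule filterlim_mono) (auto simp: at_le)
  \<comment> \<open>up to this time the support of \<open>\<phi>\<close> does not feel the boundary\<close>
  define e where "e = (1 - b) / c j"
  have e: "0 < e" using ab c_pos [of j] by (simp add: e_def)
  have int: "integrable lborel (\<lambda>y. ?u y * of_real (\<phi> (y - k)))" if "0 \<le> k" "b + k \<le> 1" for k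
  proof (rule integrableI_bounded_set [where A = "{0..1}" and B = "norm f * B"])
    have "\<bar>\<phi> x\<bar> \<le> B" if "x \<in> {0..1}" for x
    proof -
      have "\<bar>\<phi> x - \<phi> 0\<bar> \<le> B * \<bar>x - 0\<bar>" by (rule lip)
      also have "\<dots> \<le> B * 1" using that B0 by (intro mult_left_mono) auto
      finally show ?thesis using ab(1) ab(4) [of 0] by simp
    qed
    moreover have "\<phi> x = 0" if "x \<notin> {0..1}" for x using that ab by auto
    ultimately have "\<bar>\<phi> x\<bar> \<le> B" for x using B0 by (cases "x \<in> {0..1}") auto
    then show "AE y in lborel. y \<in> {0..1} \<longrightarrow> norm (?u y * of_real (\<phi> (y - k))) \<le> norm f * B"
      by (intro AE_I2 impI) (auto simp: norm_mult intro!: mult_mono cmod_Borel_rep)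
    show "AE y in lborel. y \<notin> {0..1} \<longrightarrow> ?u y * of_real (\<phi> (y - k)) = 0"
      using that ab by (intro AE_I2) auto
  qed auto
  have \<phi>_out: "\<phi> x = 0" if "x \<notin> {0..1}" for x using that ab by auto
  have rep_u: "AE s in unit_leb. rep_linf f s $ j = ?u s"
    using rep_linf_eq_Borel_rep [of f] by eventually_elim simp
  have unit_f: "test_integral f j \<phi> = (\<integral>y. ?u y * of_real (\<phi> y) \<partial>lborel)"
    by (rule integral_rep_linf_lborel [OF _ _ rep_u \<phi>_out]) measurable
  have unit_f': "test_integral f j (deriv \<phi>) =
      (\<integral>y. ?u y * of_real (deriv \<phi> y) \<partial>lborel)"
    by (rule integral_rep_linf_lborel [OF _ _ rep_u]) (use d0 ab in auto)
  have unit_T: "test_integral (transport r f) j \<phi> =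
      (\<integral>y. ?u y * of_real (\<phi> (y - c j * r)) \<partial>lborel)" if r: "0 < r" "r < e" for r
  proof -
    have "test_integral (transport r f) j \<phi> =
        (\<integral>x. arrival (Borel_rep f) (r + x / c j) j * of_real (\<phi> x) \<partial>lborel)"
    proof (rule integral_rep_linf_lborel [OF _ _ _ \<phi>_out])
      show "AE s in unit_leb. rep_linf (transport r f) s $ j = arrival (Borel_rep f) (r + s / c j) j"
        using rep_transport [OF Borel_rep_measurable rep_linf_eq_Borel_rep less_imp_le [OF r(1)], of f]
        by eventually_elim simp
      show "(\<lambda>x. arrival (Borel_rep f) (r + x / c j) j) \<in> borel_measurable borel"
        by (rule measurable_compose [OF _ arrival_measurable [OF Borel_rep_measurable]]) measurable
    qed measurable
    also have "\<dots> = (\<integral>x. ?u (c j * r + 1 * x) * of_real (\<phi> (c j * r + 1 * x - c j * r)) \<partial>lborel)"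
    proof (intro Bochner_Integration.integral_cong refl)
      fix x
      show "arrival (Borel_rep f) (r + x / c j) j * of_real (\<phi> x) =
          ?u (c j * r + 1 * x) * of_real (\<phi> (c j * r + 1 * x - c j * r))"
      proof (cases "x \<in> {a..b}")
        case True
        have "c j * r < 1 - b" using r c_pos [of j] by (simp add: e_def field_simps)
        moreover have "c j * (r + x / c j) = c j * r + x" using c_pos [of j] by (simp add: field_simps)
        ultimately show ?thesis using True by (simp add: arrival_initial)
      qed (simp add: ab(4))
    qed
    also have "\<dots> = (\<integral>y. ?u y * of_real (\<phi> (y - c j * r)) \<partial>lborel)"
      using lborel_integral_real_affine [of 1 "\<lambda>y. ?u y * of_real (\<phi> (y - c j * r))" "c j * r"] by simp
    finally show ?thesis .
  qed
  let ?q = "\<lambda>n y. ?u y * of_real ((\<phi> (y - c j * t n) - \<phi> y) / t n)"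
  let ?g = "\<lambda>s. axis j (complex_of_real (\<phi> s)) :: complex ^ 'm"
  have g: "integrable unit_leb ?g"
    by (intro integrable_axis integrable_of_real smooth_integrable_unit sm)
  have ev: "\<forall>\<^sub>F n in sequentially. t n < e"
    using order_tendstoD(2) [OF t_lim e] .
  have "\<forall>\<^sub>F n in sequentially. linf_pairing ((transport (t n) f - f) /\<^sub>R t n) ?g = (\<integral>y. ?q n y \<partial>lborel)"
    using ev
  proof eventually_elim
    case (elim n)
    have k: "0 \<le> c j * t n" "b + c j * t n \<le> 1"
      using elim t_pos [of n] c_pos [of j] by (auto simp: e_def field_simps)
    have "linf_pairing ((transport (t n) f - f) /\<^sub>R t n) ?g =
        of_real (inverse (t n)) * (linf_pairing (transport (t n) f) ?g - linf_pairing f ?g)"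
      by (simp only: linf_pairing_scaleR [OF g] linf_pairing_diff [OF g])
    also have "\<dots> = of_real (inverse (t n)) *
        ((\<integral>y. ?u y * of_real (\<phi> (y - c j * t n)) \<partial>lborel) - (\<integral>y. ?u y * of_real (\<phi> y) \<partial>lborel))"
      by (simp only: linf_pairing_axis unit_T [OF t_pos(1) elim] unit_f)
    also have "\<dots> = (\<integral>y. of_real (inverse (t n)) * (?u y * of_real (\<phi> (y - c j * t n)) - ?u y * of_real (\<phi> y)) \<partial>lborel)"
      using int [OF k] int [of 0] ab
      by (simp add: Bochner_Integration.integral_diff)
    also have "(\<lambda>y. of_real (inverse (t n)) * (?u y * of_real (\<phi> (y - c j * t n)) - ?u y * of_real (\<phi> y))) = ?q n"
      by (rule ext) (simp add: divide_inverse algebra_simps)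
    finally show ?case .
  qed
  moreover have "(\<lambda>n. linf_pairing ((transport (t n) f - f) /\<^sub>R t n) ?g) \<longlonglongrightarrow> linf_pairing g ?g"
    by (rule filterlim_compose [OF lim [unfolded limitin_weak_star_iff, rule_format, OF g] t_right])
  ultimately have 1: "(\<lambda>n. \<integral>y. ?q n y \<partial>lborel) \<longlonglongrightarrow> linf_pairing g ?g"
    by (rule Lim_transform_eventually [rotated])
  \<comment> \<open>the translated quotients vanish outside \<open>[0, 1 + c j]\<close>, since all times \<open>t n\<close> are at most \<open>1\<close>\<close>
  have "(\<lambda>n. \<integral>y. ?q n y \<partial>lborel) \<longlonglongrightarrow> (\<integral>y. ?u y * of_real (- c j * deriv \<phi> y) \<partial>lborel)"
  proof (rule integral_dominated_convergence [where w = "\<lambda>y. (norm f * (B * c j)) * indicator {0..1 + c j} y"])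
    show "integrable lborel (\<lambda>y. (norm f * (B * c j)) * indicator {0..1 + c j} y)"
      by (auto intro!: integrable_mult_right integrable_real_indicator simp: emeasure_lborel_Icc_eq)
    show "AE y in lborel. norm (?q n y) \<le> (norm f * (B * c j)) * indicator {0..1 + c j} y" for n
    proof (rule AE_I2)
      fix y
      have ct: "0 \<le> c j * t n" "c j * t n \<le> c j" using t_pos [of n] c_pos [of j] by auto
      show "norm (?q n y) \<le> (norm f * (B * c j)) * indicator {0..1 + c j} y"
      proof (cases "y \<in> {0..1 + c j}")
        case True
        have "\<bar>\<phi> (y - c j * t n) - \<phi> y\<bar> \<le> B * (c j * t n)"
          using lip [of "y - c j * t n" y] ct by simp
        then have "\<bar>(\<phi> (y - c j * t n) - \<phi> y) / t n\<bar> \<le> B * c j"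
          using t_pos [of n] by (simp add: field_simps)
        then have "norm (?q n y) \<le> norm f * (B * c j)"
          unfolding norm_mult norm_of_real by (intro mult_mono cmod_Borel_rep) auto
        with True show ?thesis by simp
      next
        case False
        then have "y < 0 \<or> 1 + c j < y" by auto
        then have "y - c j * t n < a \<or> b < y - c j * t n" "y < a \<or> b < y"
          using ct ab c_pos [of j] by linarith+
        then have "y - c j * t n \<notin> {a..b}" "y \<notin> {a..b}"
          by (simp_all only: atLeastAtMost_iff de_Morgan_conj not_le)
        then have "\<phi> (y - c j * t n) = 0" "\<phi> y = 0" using ab(4) by blast+
        with False show ?thesis by simp
      qed
    qed
    show "AE y in lborel. (\<lambda>n. ?q n y) \<longlonglongrightarrow> ?u y * of_real (- c j * deriv \<phi> y)"
    proof (rule AE_I2)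
      fix y
      have "((\<lambda>r. y - c j * r) has_real_derivative - c j) (at 0)"
        by (auto intro!: derivative_eq_intros)
      from DERIV_chain2 [OF smooth_DERIV [OF sm(1)] this]
      have "((\<lambda>r. \<phi> (y - c j * r)) has_real_derivative deriv \<phi> y * (- c j)) (at 0)" by simp
      then have "((\<lambda>h. (\<phi> (y - c j * h) - \<phi> y) / h) \<longlongrightarrow> - c j * deriv \<phi> y) (at 0)"
        by (simp add: DERIV_def mult.commute)
      then have "(\<lambda>n. (\<phi> (y - c j * t n) - \<phi> y) / t n) \<longlonglongrightarrow> - c j * deriv \<phi> y"
        by (rule filterlim_compose [OF _ t_at])
      then show "(\<lambda>n. ?q n y) \<longlonglongrightarrow> ?u y * of_real (- c j * deriv \<phi> y)"
        by (intro tendsto_mult tendsto_const tendsto_of_real)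
    qed
  qed measurable
  from LIMSEQ_unique [OF 1 this]
  have "linf_pairing g ?g = (\<integral>y. of_real (- c j) * (?u y * of_real (deriv \<phi> y)) \<partial>lborel)"
    by (simp add: mult_ac)
  also have "\<dots> = of_real (- c j) * (\<integral>y. ?u y * of_real (deriv \<phi> y) \<partial>lborel)"
    by (rule integral_mult_right_zero)
  finally show ?thesis by (simp add: linf_pairing_axis unit_f')
qed

lemma weakly_differentiable_if_difference_quotient:
  assumes lim: "limitin weak_star (\<lambda>t. (transport t f - f) /\<^sub>R t) g (at_right 0)"
  shows "has_weak_deriv f (matrix_app (diag_matrix (\<lambda>j. 1 / c j)) g)"
  unfolding has_weak_deriv_def
proof (intro allI impI)
  fix \<phi> assume \<phi>: "test_function \<phi>"
  let ?h = "matrix_app (diag_matrix (\<lambda>j. 1 / c j)) g"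
  have sm: "smooth \<phi>" "smooth (deriv \<phi>)"
    using test_function_smooth [OF \<phi>] smooth_deriv by auto
  have [measurable]: "\<phi> \<in> borel_measurable unit_leb"
    by (intro borel_measurable_unit_leb smooth_measurable sm)
  have "(\<integral>s. deriv \<phi> s *\<^sub>R rep_linf f s \<partial>unit_leb) $ j = (- (\<integral>s. \<phi> s *\<^sub>R rep_linf ?h s \<partial>unit_leb)) $ j" for j
  proof -
    have "(\<integral>s. \<phi> s *\<^sub>R rep_linf ?h s \<partial>unit_leb) $ j = (\<integral>s. rep_linf ?h s $ j * of_real (\<phi> s) \<partial>unit_leb)"
      by (rule integral_scaleR_nth [OF smooth_integrable_unit(2) [OF sm(1)]])
    also have "\<dots> = (\<integral>s. of_real (1 / c j) * (rep_linf g s $ j * of_real (\<phi> s)) \<partial>unit_leb)"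
    proof (rule integral_cong_AE)
      show "AE s in unit_leb. rep_linf ?h s $ j * of_real (\<phi> s) = of_real (1 / c j) * (rep_linf g s $ j * of_real (\<phi> s))"
        using rep_matrix_app [of "diag_matrix (\<lambda>j. 1 / c j)" g]
        by eventually_elim (simp add: diag_matrix_vector_nth)
    qed measurable
    also have "\<dots> = of_real (1 / c j) * test_integral g j \<phi>"
      by (rule integral_mult_right_zero)
    also have "\<dots> = - test_integral f j (deriv \<phi>)"
      using c_pos [of j] by (simp add: difference_quotient_test [OF \<phi> lim] less_imp_neq [symmetric])
    also have "test_integral f j (deriv \<phi>) = (\<integral>s. deriv \<phi> s *\<^sub>R rep_linf f s \<partial>unit_leb) $ j"
      by (rule integral_scaleR_nth [OF smooth_integrable_unit(2) [OF sm(2)], symmetric])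
    finally show ?thesis by simp
  qed
  then show "(\<integral>s. deriv \<phi> s *\<^sub>R rep_linf f s \<partial>unit_leb) = - (\<integral>s. \<phi> s *\<^sub>R rep_linf ?h s \<partial>unit_leb)"
    unfolding vec_eq_iff by (rule allI)
qed

text \<open>
  If the difference quotients are bounded, then the values arriving right after the time \<open>1 / c j\<close>
  join up with those before, which is the boundary condition.
\<close>

lemma boundary_condition_if_bounded:
  assumes rep: "AE s in unit_leb. rep_linf f s = clamped_primitive v h s"
    and bdd: "bdd_above ((\<lambda>t. norm (transport t f - f) / t) ` {0<..1})"
  shows "clamped_primitive v h 1 = K *v clamped_primitive v h 0"
proof -
  let ?G = "clamped_primitive v h"
  obtain M where "\<forall>t\<in>{0<..1}. norm (transport t f - f) / t \<le> M"
    using bdd by (auto simp: bdd_above_def)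
  then have M: "norm (transport t f - f) \<le> M * t" if "0 < t" "t \<le> 1" for t
    using that by (simp add: pos_divide_le_eq)
  define N where "N = norm h * c_max"
  have N: "0 \<le> N" using c_max_pos by (simp add: N_def)
  have est: "cmod ((K *v ?G 0) $ j - ?G 1 $ j) \<le> (M + K_sum * N + N) * t"
    if t: "0 < t" "t \<le> 1" "t < 1 / c_max" for t j
  proof -
    have ct: "c k * t < 1" for k
    proof -
      have "c k * t \<le> c_max * t" using c_le_max t by (intro mult_right_mono) auto
      also have "\<dots> < 1" using t c_max_pos by (simp add: field_simps)
      finally show ?thesis .
    qed
    have near: "AE x in unit_leb. cmod (arrival ?G (t + x / c j) j - ?G x $ j) \<le> M * t"
      using rep_transport [OF clamped_primitive_measurable rep less_imp_le [OF t(1)]] rep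
        norm_linf_AE [of "transport t f - f"] rep_linf_diff [of "transport t f" f]
    proof eventually_elim
      case (elim x)
      have "cmod (arrival ?G (t + x / c j) j - ?G x $ j) \<le> l1norm (flow ?G t x - ?G x)"
        using cmod_le_l1norm [of "flow ?G t x - ?G x" j] by simp
      also have "\<dots> \<le> norm (transport t f - f)" using elim by simp
      also have "\<dots> \<le> M * t" by (rule M [OF t(1,2)])
      finally show ?case .
    qed
    have "\<exists>x\<in>{1 - c j * t<..<1}. cmod (arrival ?G (t + x / c j) j - ?G x $ j) \<le> M * t"
      by (rule AE_unit_leb_ex_between [OF near]) (use ct [of j] t c_pos [of j] in auto)
    then obtain x where x: "1 - c j * t < x" "x < 1" "cmod (arrival ?G (t + x / c j) j - ?G x $ j) \<le> M * t"
      by auto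
    \<comment> \<open>the time at which the value seen at \<open>x\<close> has entered the edge \<open>j\<close>\<close>
    define y where "y = t + x / c j - 1 / c j"
    have cx: "c j * (t + x / c j) = c j * t + x"
      using c_pos [of j] by (simp add: distrib_left)
    have "c j * y = c j * t + x - 1"
      using c_pos [of j] by (simp add: y_def right_diff_distrib cx)
    then have "0 < c j * y" "c j * y < c j * t" using x by linarith+
    then have y: "0 < y" "y < t"
      using c_pos [of j] by (simp_all add: zero_less_mult_iff)
    have "1 \<le> c j * (t + x / c j)" using x cx by simp
    then have "arrival ?G (t + x / c j) j = (\<Sum>k\<in>UNIV. K $ j $ k * arrival ?G y k)"
      unfolding y_def by (rule arrival_delay)
    also have "\<dots> = (\<Sum>k\<in>UNIV. K $ j $ k * ?G (c k * y) $ k)"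
    proof (intro sum.cong refl arg_cong2 [where f = "(*)"] arrival_initial)
      fix k
      have "c k * y \<le> c k * t" using y c_pos [of k] by simp
      with ct [of k] show "c k * y < 1" by simp
    qed
    finally have arr: "arrival ?G (t + x / c j) j = (\<Sum>k\<in>UNIV. K $ j $ k * ?G (c k * y) $ k)" .
    have lip: "cmod (?G r $ k - ?G s $ k) \<le> N * t"
      if "r \<in> {0..1}" "s \<in> {0..1}" "\<bar>r - s\<bar> \<le> c_max * t" for r s k
    proof -
      have "cmod (?G r $ k - ?G s $ k) \<le> norm h * \<bar>r - s\<bar>"
        by (rule clamped_primitive_lipschitz [OF that(1,2)])
      also have "\<dots> \<le> norm h * (c_max * t)" using that(3) by (intro mult_left_mono) auto
      finally show ?thesis by (simp add: N_def)
    qed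
    have cy: "0 \<le> c k * y" "c k * y \<le> 1" "c k * y \<le> c_max * t" for k
    proof -
      show "0 \<le> c k * y" using y c_pos [of k] by simp
      have "c k * y \<le> c k * t" using y c_pos [of k] by simp
      then show "c k * y \<le> 1" using ct [of k] by simp
      show "c k * y \<le> c_max * t" using y c_le_max [of k] c_max_pos by (intro mult_mono) auto
    qed
    have "cmod ((K *v ?G 0) $ j - arrival ?G (t + x / c j) j) =
        cmod (\<Sum>k\<in>UNIV. K $ j $ k * (?G 0 $ k - ?G (c k * y) $ k))"
      unfolding arr matrix_vector_mult_def by (simp add: sum_subtractf right_diff_distrib)
    also have "\<dots> \<le> (\<Sum>k\<in>UNIV. cmod (K $ j $ k) * (N * t))"
      using cy by (intro sum_norm_le) (auto simp: norm_mult intro!: mult_left_mono lip)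
    also have "\<dots> \<le> K_sum * (N * t)"
      unfolding sum_distrib_right [symmetric] using N t by (intro mult_right_mono K_row_le) auto
    finally have 1: "cmod ((K *v ?G 0) $ j - arrival ?G (t + x / c j) j) \<le> K_sum * (N * t)" .
    have 2: "cmod (?G x $ j - ?G 1 $ j) \<le> N * t"
    proof (rule lip)
      have "c j * t \<le> c_max * t" using c_le_max t by (intro mult_right_mono) auto
      then show "\<bar>x - 1\<bar> \<le> c_max * t" using x by simp
    qed (use x ct [of j] in auto)
    have "cmod ((K *v ?G 0) $ j - ?G 1 $ j) \<le> cmod ((K *v ?G 0) $ j - arrival ?G (t + x / c j) j) +
        (cmod (arrival ?G (t + x / c j) j - ?G x $ j) + cmod (?G x $ j - ?G 1 $ j))"
      using norm_triangle_ineq [of "(K *v ?G 0) $ j - arrival ?G (t + x / c j) j" "arrival ?G (t + x / c j) j - ?G 1 $ j"]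
        norm_triangle_ineq [of "arrival ?G (t + x / c j) j - ?G x $ j" "?G x $ j - ?G 1 $ j"] by simp
    also have "\<dots> \<le> K_sum * (N * t) + (M * t + N * t)"
      by (intro add_mono 1 2 x)
    finally show ?thesis by (simp add: algebra_simps)
  qed
  have "(K *v ?G 0) $ j - ?G 1 $ j = 0" for j
  proof -
    define t1 where "t1 = min 1 (1 / (2 * c_max))"
    have t1: "0 < t1" "t1 \<le> 1" "t1 < 1 / c_max"
      using c_max_pos by (auto simp: t1_def min_less_iff_disj divide_strict_left_mono)
    have "((\<lambda>t. (M + K_sum * N + N) * t) \<longlongrightarrow> (M + K_sum * N + N) * 0) (at_right 0)"
      by (intro tendsto_mult tendsto_const tendsto_ident_at)
    moreover have "\<forall>\<^sub>F t in at_right 0. cmod ((K *v ?G 0) $ j - ?G 1 $ j) \<le> (M + K_sum * N + N) * t"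
      using eventually_at_right_less [of 0] eventually_at_right_real [OF t1(1)]
      by eventually_elim (use t1 in \<open>auto intro!: est\<close>)
    ultimately have "cmod ((K *v ?G 0) $ j - ?G 1 $ j) \<le> (M + K_sum * N + N) * 0"
      by (rule tendsto_lowerbound) simp
    then show ?thesis by simp
  qed
  then show ?thesis by (simp add: vec_eq_iff)
qed

section \<open>The domain of the generator: sufficiency\<close>

text \<open>Under the boundary condition the arriving values form a locally Lipschitz function of time.\<close>

lemma arrival_lipschitz:
  assumes bc: "clamped_primitive v h 1 = K *v clamped_primitive v h 0"
  shows "\<exists>L. \<forall>j. L-lipschitz_on {0..R} (\<lambda>t. arrival (clamped_primitive v h) t j)"
proof -
  let ?G = "clamped_primitive v h"
  \<comment> \<open>the boundary condition makes this true at the endpoint \<open>t = 1 / c j\<close> as well\<close>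
  have first: "arrival ?G t j = ?G (c j * t) $ j" if t: "0 \<le> t" "t \<le> 1 / c j" for t j
  proof (cases "c j * t < 1")
    case True
    then show ?thesis by (rule arrival_initial)
  next
    case False
    then have "t = 1 / c j" using t c_pos [of j] by (simp add: field_simps)
    then have "arrival ?G t j = (\<Sum>k\<in>UNIV. K $ j $ k * ?G 0 $ k)"
      using c_pos [of j] by (simp add: arrival_delay arrival_initial)
    also have "\<dots> = ?G 1 $ j" unfolding bc by (simp add: matrix_vector_mult_def)
    finally show ?thesis using \<open>t = 1 / c j\<close> c_pos [of j] by simp
  qed
  have lip1: "(norm h * c_max)-lipschitz_on {0..1 / c j} (\<lambda>t. arrival ?G t j)" for j
  proof (rule lipschitz_onI)
    fix s t assume st: "s \<in> {0..1 / c j}" "t \<in> {0..1 / c j}"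
    then have "c j * s \<in> {0..1}" "c j * t \<in> {0..1}" using c_pos [of j] by (auto simp: field_simps)
    then have "cmod (arrival ?G s j - arrival ?G t j) \<le> norm h * \<bar>c j * s - c j * t\<bar>"
      using clamped_primitive_lipschitz [of "c j * s" "c j * t" v h j] st by (simp add: first)
    also have "\<dots> = norm h * (c j * \<bar>s - t\<bar>)"
      using c_pos [of j] by (simp add: abs_mult right_diff_distrib [symmetric])
    also have "\<dots> \<le> norm h * (c_max * \<bar>s - t\<bar>)"
      using c_le_max [of j] by (intro mult_left_mono mult_right_mono) auto
    finally show "dist (arrival ?G s j) (arrival ?G t j) \<le> norm h * c_max * dist s t"
      by (simp add: dist_norm)
  qed (use c_max_pos in simp)
  have steps: "\<exists>L. \<forall>j. L-lipschitz_on {0..real n * (1 / c_max)} (\<lambda>t. arrival ?G t j)" for n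
  proof (rule delay_steps_induct [where P = "\<lambda>a. \<exists>L. \<forall>j. L-lipschitz_on {0..a} (\<lambda>t. arrival ?G t j)"])
    show "\<exists>L. \<forall>j. L-lipschitz_on {0..0} (\<lambda>t. arrival ?G t j)"
      by (intro exI [of _ 0] allI lipschitz_onI) auto
  next
    fix a :: real
    assume "\<exists>L. \<forall>j. L-lipschitz_on {0..a} (\<lambda>t. arrival ?G t j)" and a: "0 \<le> a"
    then obtain L where L: "\<And>j. L-lipschitz_on {0..a} (\<lambda>t. arrival ?G t j)" by blast
    have L0: "0 \<le> L" using L lipschitz_on_nonneg by blast
    define L' where "L' = norm h * c_max + K_sum * L"
    have L': "norm h * c_max \<le> L'" "K_sum * L \<le> L'" "0 \<le> L'"
      using L0 K_sum_nonneg c_max_pos by (auto simp: L'_def)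
    have "L'-lipschitz_on {0..a + 1 / c_max} (\<lambda>t. arrival ?G t j)" for j
    proof (cases "a + 1 / c_max \<le> 1 / c j")
      case True
      then show ?thesis
        by (intro lipschitz_on_subset [OF lipschitz_on_le [OF lip1 L'(1)]]) auto
    next
      case False
      have "L'-lipschitz_on {1 / c j..a + 1 / c_max} (\<lambda>t. arrival ?G t j)"
      proof (rule lipschitz_onI [OF _ L'(3)])
        fix s t assume st: "s \<in> {1 / c j..a + 1 / c_max}" "t \<in> {1 / c j..a + 1 / c_max}"
        have "1 \<le> c j * s" "1 \<le> c j * t" using st c_pos [of j] by (auto simp: field_simps)
        then have "arrival ?G s j - arrival ?G t j =
            (\<Sum>k\<in>UNIV. K $ j $ k * (arrival ?G (s - 1 / c j) k - arrival ?G (t - 1 / c j) k))"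
          by (simp add: arrival_delay sum_subtractf right_diff_distrib)
        also have "cmod \<dots> \<le> (\<Sum>k\<in>UNIV. cmod (K $ j $ k) * (L * \<bar>s - t\<bar>))"
        proof (intro sum_norm_le)
          fix k
          have "s - 1 / c j \<in> {0..a}" "t - 1 / c j \<in> {0..a}" using st delay_ge [of j] by auto
          from lipschitz_onD [OF L this]
          have "cmod (arrival ?G (s - 1 / c j) k - arrival ?G (t - 1 / c j) k) \<le> L * \<bar>s - t\<bar>"
            by (simp add: dist_norm)
          then show "cmod (K $ j $ k * (arrival ?G (s - 1 / c j) k - arrival ?G (t - 1 / c j) k)) \<le>
              cmod (K $ j $ k) * (L * \<bar>s - t\<bar>)"
            unfolding norm_mult by (rule mult_left_mono) simp
        qed
        also have "\<dots> \<le> K_sum * (L * \<bar>s - t\<bar>)"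
          unfolding sum_distrib_right [symmetric] using L0 by (intro mult_right_mono K_row_le) auto
        also have "\<dots> \<le> L' * \<bar>s - t\<bar>"
          using mult_right_mono [OF L'(2), of "\<bar>s - t\<bar>"] by (simp add: mult.assoc)
        finally show "dist (arrival ?G s j) (arrival ?G t j) \<le> L' * dist s t"
          by (simp add: dist_norm)
      qed
      from lipschitz_on_concat [OF lipschitz_on_le [OF lip1 L'(1)] this refl]
      show ?thesis by simp
    qed
    then show "\<exists>L. \<forall>j. L-lipschitz_on {0..a + 1 / c_max} (\<lambda>t. arrival ?G t j)" by blast
  qed
  obtain n where n: "R \<le> real n * (1 / c_max)" using ex_delay_steps by blast
  from steps [of n] obtain L where "\<forall>j. L-lipschitz_on {0..real n * (1 / c_max)} (\<lambda>t. arrival ?G t j)" ..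
  then have "\<forall>j. L-lipschitz_on {0..R} (\<lambda>t. arrival ?G t j)"
    using n by (auto intro: lipschitz_on_subset)
  then show ?thesis ..
qed

end

context transport_network
begin

text \<open>The fundamental theorem of calculus for the primitive of the arrivals, from the right.\<close>

lemma arrival_integral_quotient:
  assumes f: "bounded_Borel S f" and lip: "L-lipschitz_on {0..R} (\<lambda>u. arrival f u j)" and x: "0 \<le> x" "x < R"
  shows "((\<lambda>t. (arrival_integral f j (t + x) - arrival_integral f j x) /\<^sub>R t) \<longlongrightarrow> arrival f x j) (at_right 0)"
proof -
  have Rx: "0 < R - x" using x by simp
  have "\<forall>\<^sub>F t in at_right 0. norm ((arrival_integral f j (t + x) - arrival_integral f j x) /\<^sub>R t - arrival f x j) \<le> L * t"
    using eventually_at_right_real [OF Rx]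
  proof eventually_elim
    case (elim t)
    then have t: "0 < t" "t < R - x" using x by auto
    have "((\<lambda>u. arrival f u j - arrival f x j) has_integral
        (arrival_integral f j (t + x) - arrival_integral f j x) - t *\<^sub>R arrival f x j) (cbox x (t + x))"
    proof (intro has_integral_diff)
      show "((\<lambda>u. arrival f u j) has_integral arrival_integral f j (t + x) - arrival_integral f j x) (cbox x (t + x))"
        using t x arrival_integral_diff [OF f, of x "t + x" j]
          integrable_integral [OF arrival_integrable [OF f x(1), of j "t + x"]] by simp
      show "((\<lambda>u. arrival f x j) has_integral t *\<^sub>R arrival f x j) (cbox x (t + x))"
        using has_integral_const [of "arrival f x j" x "t + x"] t by simp
    qed
    then have "norm ((arrival_integral f j (t + x) - arrival_integral f j x) - t *\<^sub>R arrival f x j) \<le>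
        L * t * measure lborel (cbox x (t + x))"
    proof (rule has_integral_bound [rotated])
      show "0 \<le> L * t" using lipschitz_on_nonneg [OF lip] t by simp
      fix u assume u: "u \<in> cbox x (t + x)"
      then have "dist (arrival f u j) (arrival f x j) \<le> L * dist u x"
        using t x by (intro lipschitz_onD [OF lip]) auto
      also have "\<dots> \<le> L * t"
        using u lipschitz_on_nonneg [OF lip] by (intro mult_left_mono) (auto simp: dist_real_def)
      finally show "norm (arrival f u j - arrival f x j) \<le> L * t" by (simp add: dist_norm)
    qed
    then have est: "norm ((arrival_integral f j (t + x) - arrival_integral f j x) - t *\<^sub>R arrival f x j) \<le> (L * t) * t"
      using t by simp
    have "(arrival_integral f j (t + x) - arrival_integral f j x) /\<^sub>R t - arrival f x j =
        ((arrival_integral f j (t + x) - arrival_integral f j x) - t *\<^sub>R arrival f x j) /\<^sub>R t"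
      using t by (simp add: scaleR_diff_right)
    moreover have "norm (z /\<^sub>R t) = norm z / t" for z :: complex
      using t by (simp add: divide_inverse mult.commute)
    ultimately show ?case by (simp only: pos_divide_le_eq [OF t(1)] est)
  qed
  moreover have "((\<lambda>t. L * t) \<longlongrightarrow> 0) (at_right 0)"
    by (rule tendsto_mult_right_zero [OF tendsto_ident_at])
  ultimately have "((\<lambda>t. (arrival_integral f j (t + x) - arrival_integral f j x) /\<^sub>R t - arrival f x j) \<longlongrightarrow> 0) (at_right 0)"
    by (rule Lim_null_comparison)
  then show ?thesis by (simp add: LIM_zero_iff)
qed

lemma difference_quotient_if_in_domain:
  assumes f: "f \<in> W1inf" and F: "continuous_rep f F" "F 1 = K *v F 0"
  shows "limitin weak_star (\<lambda>t. (transport t f - f) /\<^sub>R t) (A_op c f) (at_right 0)"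
    and "bdd_above ((\<lambda>t. norm (transport t f - f) / t) ` {0<..1})"
proof -
  obtain g where g: "has_weak_deriv f g" using f by (auto simp: W1inf_def)
  obtain v where v: "AE s in unit_leb. rep_linf f s = v + indefinite_integral g s"
    using weakly_differentiable_indefinite_integral [OF g] by blast
  let ?G = "clamped_primitive v g"
  have rep: "AE s in unit_leb. rep_linf f s = ?G s"
    using v AE_space by eventually_elim (simp add: clamped_primitive_eq)
  have FG: "F x = ?G x" if "x \<in> {0..1}" for x
  proof -
    have "F x = v + indefinite_integral g x"
    proof (rule continuous_eq_if_AE_eq [OF _ _ _ that])
      show "continuous_on {0..1} F" using F(1) by (simp add: continuous_rep_def)
      show "continuous_on {0..1} (\<lambda>x. v + indefinite_integral g x)"
        by (intro continuous_intros continuous_on_indefinite_integral)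
      have "AE s in unit_leb. rep_linf f s = F s" using F(1) by (simp add: continuous_rep_def)
      with v show "AE s in unit_leb. F s = v + indefinite_integral g s"
        by eventually_elim simp
    qed
    then show ?thesis by (simp only: clamped_primitive_eq [OF that])
  qed
  have bc: "?G 1 = K *v ?G 0" using F(2) by (simp add: FG)
  note bB = bounded_Borel_clamped_primitive [of v g]
  define R where "R = 2 + (\<Sum>j\<in>UNIV. 1 / c j)"
  have R: "t + x / c j < R" if "t \<le> 1" "x \<le> 1" for t x j
  proof -
    have "x / c j \<le> 1 / c j" using that c_pos [of j] by (intro divide_right_mono) auto
    also have "\<dots> \<le> (\<Sum>j\<in>UNIV. 1 / c j)"
      by (rule member_le_sum) (auto simp: c_pos less_imp_le)
    finally show ?thesis using that by (simp add: R_def)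
  qed
  obtain L where L: "\<And>j. L-lipschitz_on {0..R} (\<lambda>t. arrival ?G t j)"
    using arrival_lipschitz [OF bc] by blast
  have L0: "0 \<le> L" using L lipschitz_on_nonneg by blast
  have at_start: "arrival ?G (x / c j) j = ?G x $ j" if x: "0 \<le> x" "x \<le> 1" for x j
  proof (cases "x < 1")
    case True
    then show ?thesis using c_pos [of j] by (simp add: arrival_initial)
  next
    case False
    then have "x = 1" using x by simp
    then have "arrival ?G (x / c j) j = (\<Sum>k\<in>UNIV. K $ j $ k * ?G 0 $ k)"
      using c_pos [of j] by (simp add: arrival_delay arrival_initial)
    then show ?thesis using \<open>x = 1\<close> by (simp add: bc matrix_vector_mult_def)
  qed
  have bound: "norm (transport t f - f) \<le> real CARD('m) * L * t" if t: "0 < t" "t \<le> 1" for t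
  proof (rule norm_linf_le)
    show "AE x in unit_leb. l1norm (rep_linf (transport t f - f) x) \<le> real CARD('m) * L * t"
      using rep_transport [OF clamped_primitive_measurable rep less_imp_le [OF t(1)]] rep
        rep_linf_diff [of "transport t f" f] AE_space
    proof eventually_elim
      case (elim x)
      then have x: "0 \<le> x" "x \<le> 1" by auto
      have "cmod (rep_linf (transport t f - f) x $ j) \<le> L * t" for j
      proof -
        have "x / c j \<in> {0..R}" "t + x / c j \<in> {0..R}"
          using x t R [of t x j] R [of 0 x j] c_pos [of j] by auto
        then have "dist (arrival ?G (t + x / c j) j) (arrival ?G (x / c j) j) \<le> L * dist (t + x / c j) (x / c j)"
          by (intro lipschitz_onD [OF L])
        then show ?thesis
          using elim t at_start [OF x, of j] by (simp add: dist_norm)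
      qed
      then have "l1norm (rep_linf (transport t f - f) x) \<le> (\<Sum>j\<in>(UNIV :: 'm set). L * t)"
        unfolding l1norm_def by (intro sum_mono)
      then show ?case by simp
    qed
  qed
  then show "bdd_above ((\<lambda>t. norm (transport t f - f) / t) ` {0<..1})"
    by (intro bdd_aboveI2 [where M = "real CARD('m) * L"]) (simp add: pos_divide_le_eq)
  show "limitin weak_star (\<lambda>t. (transport t f - f) /\<^sub>R t) (A_op c f) (at_right 0)"
    unfolding limitin_weak_star_iff
  proof (intro allI impI linf_pairing_tendsto_intervals)
    have ev: "\<forall>\<^sub>F t in at_right 0. 0 < t \<and> t < (1 :: real)"
      using eventually_at_right_real [of "0 :: real" 1] by simp
    then show "\<forall>\<^sub>F t in at_right 0. norm ((transport t f - f) /\<^sub>R t) \<le> real CARD('m) * L"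
    proof eventually_elim
      case (elim t)
      then have "norm (transport t f - f) \<le> (real CARD('m) * L) * t" using bound by simp
      with elim have "norm (transport t f - f) / t \<le> real CARD('m) * L" by (simp add: pos_divide_le_eq)
      then show ?case using elim by (simp add: divide_inverse mult.commute)
    qed
    fix j and a b :: real assume ab: "0 \<le> a" "a \<le> b" "b \<le> 1"
    let ?p = "arrival_integral ?G j" and ?\<alpha> = "a / c j" and ?\<beta> = "b / c j"
    have int: "integrable unit_leb (\<lambda>s. axis j (indicator {a..b} s) :: complex ^ 'm)"
      using ab by (intro integrable_axis integrable_indicator_Icc)
    have interval: "interval_integral (transport t f) j a b =
        c j * (?p (t + ?\<beta>) - ?p (t + ?\<alpha>))" if "0 \<le> t" for t
      by (rule transport_interval [OF bB rep that ab])
    have pos: "0 \<le> ?\<alpha>" "0 \<le> ?\<beta>" "?\<alpha> < R" "?\<beta> < R"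
      using ab c_pos [of j] R [of 0 a j] R [of 0 b j] by auto
    have "((\<lambda>t. of_real (c j) * ((?p (t + ?\<beta>) - ?p ?\<beta>) /\<^sub>R t - (?p (t + ?\<alpha>) - ?p ?\<alpha>) /\<^sub>R t)) \<longlongrightarrow>
        of_real (c j) * (arrival ?G ?\<beta> j - arrival ?G ?\<alpha> j)) (at_right 0)"
      by (intro tendsto_mult tendsto_const tendsto_diff arrival_integral_quotient [OF bB L] pos)
    moreover have "\<forall>\<^sub>F t in at_right 0. of_real (c j) * ((?p (t + ?\<beta>) - ?p ?\<beta>) /\<^sub>R t - (?p (t + ?\<alpha>) - ?p ?\<alpha>) /\<^sub>R t) =
        interval_integral ((transport t f - f) /\<^sub>R t) j a b"
      using ev
    proof eventually_elim
      case (elim t)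
      have "interval_integral ((transport t f - f) /\<^sub>R t) j a b =
          of_real (inverse t) * (interval_integral (transport t f) j a b -
            interval_integral f j a b)"
        unfolding linf_pairing_axis [symmetric]
        by (simp only: linf_pairing_scaleR [OF int] linf_pairing_diff [OF int])
      also have "interval_integral (transport t f) j a b =
          c j * (?p (t + ?\<beta>) - ?p (t + ?\<alpha>))"
        using elim by (intro interval) simp
      also have "interval_integral f j a b = c j * (?p ?\<beta> - ?p ?\<alpha>)"
        using interval [of 0] by (simp add: transport_0)
      finally have eq: "interval_integral ((transport t f - f) /\<^sub>R t) j a b =
          of_real (inverse t) * (c j * (?p (t + ?\<beta>) - ?p (t + ?\<alpha>)) - c j * (?p ?\<beta> - ?p ?\<alpha>))" .
      show ?case
        unfolding eq by (simp add: scaleR_conv_of_real algebra_simps)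
    qed
    ultimately have "((\<lambda>t. interval_integral ((transport t f - f) /\<^sub>R t) j a b) \<longlongrightarrow>
        of_real (c j) * (arrival ?G ?\<beta> j - arrival ?G ?\<alpha> j)) (at_right 0)"
      by (rule Lim_transform_eventually)
    also have "of_real (c j) * (arrival ?G ?\<beta> j - arrival ?G ?\<alpha> j) =
        of_real (c j) * integral {a..b} (\<lambda>r. Borel_rep g r $ j)"
      using ab by (simp add: at_start clamped_primitive_diff)
    also have "\<dots> = integral {a..b} (\<lambda>r. of_real (c j) * Borel_rep g r $ j)"
      by (rule integral_mult_right [symmetric])
    also have "\<dots> = interval_integral (A_op c f) j a b"
    proof (rule integral_rep_linf_interval [symmetric, where S = "c j * norm g"])
      show "(\<lambda>r. of_real (c j) * Borel_rep g r $ j) \<in> borel_measurable borel"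
        using Borel_rep_nth_measurable [of g j] by measurable
      show "cmod (of_real (c j) * Borel_rep g r $ j) \<le> c j * norm g" for r
        using cmod_Borel_rep [of g r j] c_pos [of j] by (simp add: norm_mult)
      show "AE s in unit_leb. rep_linf (A_op c f) s $ j = of_real (c j) * Borel_rep g s $ j"
        using rep_matrix_app [of "diag_matrix c" g] rep_linf_eq_Borel_rep [of g]
        unfolding A_op_def weak_deriv_eq [OF g]
        by eventually_elim (simp add: diag_matrix_vector_nth)
    qed (use ab in auto)
    finally show "((\<lambda>t. interval_integral ((transport t f - f) /\<^sub>R t) j a b) \<longlongrightarrow>
        interval_integral (A_op c f) j a b) (at_right 0)" .
  qed
qed

lemma in_domain_if_difference_quotient:
  assumes lim: "limitin weak_star (\<lambda>t. (transport t f - f) /\<^sub>R t) g (at_right 0)"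
    and bdd: "bdd_above ((\<lambda>t. norm (transport t f - f) / t) ` {0<..1})"
  shows "f \<in> W1inf" and "\<exists>F. continuous_rep f F \<and> F 1 = K *v F 0"
proof -
  obtain h where h: "has_weak_deriv f h"
    using weakly_differentiable_if_difference_quotient [OF lim] by blast
  then show "f \<in> W1inf" by (auto simp: W1inf_def)
  obtain v where v: "AE s in unit_leb. rep_linf f s = v + indefinite_integral h s"
    using weakly_differentiable_indefinite_integral [OF h] by blast
  have rep: "AE s in unit_leb. rep_linf f s = clamped_primitive v h s"
    using v AE_space by eventually_elim (simp add: clamped_primitive_eq)
  have "continuous_rep f (\<lambda>s. v + indefinite_integral h s)"
    unfolding continuous_rep_def
    by (intro conjI v continuous_intros continuous_on_indefinite_integral)
  moreover have "v + indefinite_integral h 1 = K *v (v + indefinite_integral h 0)"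
    using boundary_condition_if_bounded [OF rep bdd] by (simp add: clamped_primitive_eq)
  ultimately show "\<exists>F. continuous_rep f F \<and> F 1 = K *v F 0"
    by (intro exI [of _ "\<lambda>s. v + indefinite_integral h s"] conjI)
qed

lemma generator_transport:
  "is_generator weak_star transport (A_op c) {f \<in> W1inf. \<exists>F. continuous_rep f F \<and> F 1 = K *v F 0}"
  unfolding is_generator_def
proof (intro conjI ballI set_eqI iffI)
  fix f
  assume "f \<in> {f \<in> W1inf. \<exists>F. continuous_rep f F \<and> F 1 = K *v F 0}"
  then obtain F where F: "f \<in> W1inf" "continuous_rep f F" "F 1 = K *v F 0" by blast
  show "f \<in> {f. (\<exists>g. limitin weak_star (\<lambda>t. (transport t f - f) /\<^sub>R t) g (at_right 0)) \<and>
      bdd_above ((\<lambda>t. norm (transport t f - f) / t) ` {0<..1})}"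
    by (intro CollectI conjI exI) (rule difference_quotient_if_in_domain [OF F])+
  show "limitin weak_star (\<lambda>t. (transport t f - f) /\<^sub>R t) (A_op c f) (at_right 0)"
    by (rule difference_quotient_if_in_domain [OF F])
next
  fix f
  assume "f \<in> {f. (\<exists>g. limitin weak_star (\<lambda>t. (transport t f - f) /\<^sub>R t) g (at_right 0)) \<and>
      bdd_above ((\<lambda>t. norm (transport t f - f) / t) ` {0<..1})}"
  then obtain g where "limitin weak_star (\<lambda>t. (transport t f - f) /\<^sub>R t) g (at_right 0)"
    "bdd_above ((\<lambda>t. norm (transport t f - f) / t) ` {0<..1})" by blast
  from in_domain_if_difference_quotient [OF this]
  show "f \<in> {f \<in> W1inf. \<exists>F. continuous_rep f F \<and> F 1 = K *v F 0}" by (intro CollectI conjI)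
qed

end

theorem theorem3p13:
  fixes G :: "'v pair_pre_digraph"
    and e :: "'m::finite \<Rightarrow> 'v \<times> 'v"
    and w :: "'m \<Rightarrow> 'm \<Rightarrow> real"
    and c :: "'m \<Rightarrow> real"
  assumes "weighted_digraph G e w"
    and "\<And>j. c j > 0"
  shows "generates_bicontinuous_semigroup weak_star (A_op c) (A_dom c (line_adjacency e w))"
proof -
  interpret transport_network c "conj_diag c (line_adjacency e w)"
    by unfold_locales (rule assms(2))
  show ?thesis
    unfolding generates_bicontinuous_semigroup_def A_dom_def
    using bicontinuous_transport generator_transport by blast
qed

end
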